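(* There is a constant $c>0$, independent of $h$, $\tau$ and $Z$, such that the following holds. Let $Z\in\mathbb R^{N_1}$, $C_Z=2\|Z\|_M$, $\mathcal B_N=\{Y\in\mathbb R^{N_1}:\ \|Y\|_M\le C_Z\}$, and $$0<\tau\le\frac18\min\left\{\frac{4}{\|\hat k\|_\infty},\ \frac{h^2}{c\,C_Z}\right\}.$$ Then for all $Y^{(1)},Y^{(2)}\in\mathcal B_N$, $$\|G(Y^{(1)})-G(Y^{(2)})\|_M\le\frac12\,\|Y^{(1)}-Y^{(2)}\|_M,$$ and hence, under such a restriction on $\tau$ and $h$, the fixed point problem $Y=G(Y)$ admits a unique solution. Here $G(Y)=B^{-1}\big[MZ-\tau\,S(K^{-1}MY)\,Y\big]$.
   Context: Let $L>0$, $\Omega=(0,L)\times(0,L)$, and let $\hat k\in\mathbb R$ be a constant, $\|\hat k\|_\infty=|\hat k|$ (a quotient with zero denominator in the bound on $\tau$ is read as $+\infty$). $\langle\cdot,\cdot\rangle$ is the $L^2(\Omega)$ inner product and $\langle u,v\rangle_1=\langle u,v\rangle+\langle\nabla u,\nabla v\rangle$. $H^1_P(\Omega)$ is the space of $u\in H^1(\Omega)$ with $u(x,0)=u(x,L)$ for a.e. $x$ and $u(0,y)=u(L,y)$ for a.e. $y$. $\vec V(v)=(-v_y,v_x)$. For $n\ge2$, let $0=x_1<\dots<x_n=L$ and $0=y_1<\dots<y_n=L$ be partitions and $\mathcal T$ the triangulation of $\overline\Omega$ obtained by cutting each rectangle $[x_i,x_{i+1}]\times[y_j,y_{j+1}]$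 along the diagonal from its lower-left to its upper-right vertex; $h$ is the mesh size. The family of meshes is assumed quasi-uniform (so that standard finite element inverse inequalities hold). $X_N$ ($N=n^2$) is the space of continuous functions on $\overline\Omega$ that are affine on each triangle, and $X_{N,P}=X_N\cap H^1_P(\Omega)$, of dimension $N_1=(n-1)^2$, with periodic nodal basis $\varphi_1,\dots,\varphi_{N_1}$. A vector $V\in\mathbb R^{N_1}$ is identified with $v_N=\sum_I V_I\varphi_I$. Matrices (row $J$, column $I$): $M_{JI}=\langle\varphi_I,\varphi_J\rangle$, $K_{JI}=\langle\varphi_I,\varphi_J\rangle_1$, $R_{JI}=\langle\hat k\,\partial_y\varphi_I,\varphi_J\rangle$, and for $U\in\mathbb R^{N_1}$ with $u_N=\sum_I U_I\varphi_I$, $S(U)_{JI}=\langle\vec V(u_N)\cdot\nabla\varphi_I,\varphi_J\rangle$. $\|V\|_M^2=V^TMV$. Put $B=M-\tau RK^{-1}M$, which is invertible for $0<\tau\le 1/(2\|\hat k\|_\infty)$. With $Z=W(t)$, a fixed point $Y=W(t+\tau)$ of $G$ together with $U(t+\tau)=K^{-1}MY$ is a solution of the fully implicit scheme $(M+\tau S(U(t+\tau)))W(t+\tau)-\tau RU(t+\tau)=MW(t)$, $KU(t+\tau)=MW(t+\tau)$. *)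

theory Defs
  imports "HOL-Analysis.Analysis" "Jordan_Normal_Form.Gauss_Jordan_Elimination"
begin

text \<open>
  Both libraries declare types named \<open>vec\<close>, infix \<open>$\<close> and a bullet for scalar products.
  Here \<open>vec\<close>, \<open>mat\<close> and \<open>$\<close> refer to the dimension-varying vectors and matrices of
  Jordan Normal Form.
\<close>

no_notation Finite_Cartesian_Product.vec_nth (infixl "$" 90)
no_notation Matrix.scalar_prod (infix "\<bullet>" 70)
hide_type (open) Finite_Cartesian_Product.vec
hide_const (open) Finite_Cartesian_Product.vec Finite_Cartesian_Product.mat

definition Omega :: "real \<Rightarrow> (real \<times> real) set" where
  "Omega L = {0<..<L} \<times> {0<..<L}"

definition L2 :: "(real \<times> real) set \<Rightarrow> (real \<times> real \<Rightarrow> real) set" where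
  "L2 D = {f. f \<in> borel_measurable (lebesgue_on D) \<and> integrable (lebesgue_on D) (\<lambda>p. (f p)\<^sup>2)}"

definition ip :: "real \<Rightarrow> (real \<times> real \<Rightarrow> real) \<Rightarrow> (real \<times> real \<Rightarrow> real) \<Rightarrow> real" where
  "ip L f g = (\<integral>p. f p * g p \<partial>(lebesgue_on (Omega L)))"

definition classical_dx :: "(real \<times> real \<Rightarrow> real) \<Rightarrow> real \<times> real \<Rightarrow> real" where
  "classical_dx \<psi> p = frechet_derivative \<psi> (at p) (1, 0)"

definition classical_dy :: "(real \<times> real \<Rightarrow> real) \<Rightarrow> real \<times> real \<Rightarrow> real" where
  "classical_dy \<psi> p = frechet_derivative \<psi> (at p) (0, 1)"

text \<open>
  Continuously differentiable functions (extended by zero to the plane) with compact support in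
  the open set \<open>D\<close>. By mollification they define the same weak derivatives
  as the infinitely differentiable ones.
\<close>

definition test_functions :: "(real \<times> real) set \<Rightarrow> (real \<times> real \<Rightarrow> real) set" where
  "test_functions D = {\<psi>.
     (\<forall>p. \<psi> differentiable (at p)) \<and>
     continuous_on UNIV (classical_dx \<psi>) \<and> continuous_on UNIV (classical_dy \<psi>) \<and>
     (\<exists>K. compact K \<and> K \<subseteq> D \<and> (\<forall>p. p \<notin> K \<longrightarrow> \<psi> p = 0))}"

definition has_weak_gradient ::
  "(real \<times> real) set \<Rightarrow> (real \<times> real \<Rightarrow> real) \<Rightarrow> (real \<times> real \<Rightarrow> real \<times> real) \<Rightarrow> bool" where
  "has_weak_gradient D u g \<longleftrightarrow>
     (\<lambda>p. fst (g p)) \<in> L2 D \<and> (\<lambda>p. snd (g p)) \<in> L2 D \<and>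
     (\<forall>\<psi>\<in>test_functions D.
        (\<integral>p. u p * classical_dx \<psi> p \<partial>(lebesgue_on D)) = - (\<integral>p. fst (g p) * \<psi> p \<partial>(lebesgue_on D)) \<and>
        (\<integral>p. u p * classical_dy \<psi> p \<partial>(lebesgue_on D)) = - (\<integral>p. snd (g p) * \<psi> p \<partial>(lebesgue_on D)))"

definition H1 :: "(real \<times> real) set \<Rightarrow> (real \<times> real \<Rightarrow> real) set" where
  "H1 D = {u \<in> L2 D. \<exists>g. has_weak_gradient D u g}"

text \<open>The weak gradient is determined only up to a null set; all uses below are under integrals.\<close>

definition grad :: "real \<Rightarrow> (real \<times> real \<Rightarrow> real) \<Rightarrow> real \<times> real \<Rightarrow> real \<times> real" where
  "grad L u = (SOME g. has_weak_gradient (Omega L) u g)"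

definition ip1 :: "real \<Rightarrow> (real \<times> real \<Rightarrow> real) \<Rightarrow> (real \<times> real \<Rightarrow> real) \<Rightarrow> real" where
  "ip1 L u v = ip L u v + (\<integral>p. inner (grad L u p) (grad L v p) \<partial>(lebesgue_on (Omega L)))"

text \<open>
  The boundary values are pointwise values of \<open>u\<close>. They agree with the traces whenever \<open>u\<close> is
  continuous on the closed square, which is the only case used below.
\<close>

definition H1P :: "real \<Rightarrow> (real \<times> real \<Rightarrow> real) set" where
  "H1P L = {u \<in> H1 (Omega L).
     (AE x in lborel. 0 < x \<and> x < L \<longrightarrow> u (x, 0) = u (x, L)) \<and>
     (AE y in lborel. 0 < y \<and> y < L \<longrightarrow> u (0, y) = u (L, y))}"

definition Vfield :: "real \<Rightarrow> (real \<times> real \<Rightarrow> real) \<Rightarrow> real \<times> real \<Rightarrow> real \<times> real" where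
  "Vfield L v p = (- snd (grad L v p), fst (grad L v p))"

text \<open>The partition points \<open>xs m i\<close>, \<open>ys m i\<close> are meaningful for \<open>1 \<le> i \<le> npts m\<close> only.\<close>

record mesh =
  npts :: nat
  xs :: "nat \<Rightarrow> real"
  ys :: "nat \<Rightarrow> real"

definition is_partition :: "real \<Rightarrow> nat \<Rightarrow> (nat \<Rightarrow> real) \<Rightarrow> bool" where
  "is_partition L n x \<longleftrightarrow> x 1 = 0 \<and> x n = L \<and> (\<forall>i\<in>{1..<n}. x i < x (i + 1))"

definition is_mesh :: "real \<Rightarrow> mesh \<Rightarrow> bool" where
  "is_mesh L m \<longleftrightarrow>
     npts m \<ge> 2 \<and> is_partition L (npts m) (xs m) \<and> is_partition L (npts m) (ys m)"

definition lower_triangle :: "mesh \<Rightarrow> nat \<Rightarrow> nat \<Rightarrow> (real \<times> real) set" where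
  "lower_triangle m i j =
     convex hull {(xs m i, ys m j), (xs m (i + 1), ys m j), (xs m (i + 1), ys m (j + 1))}"

definition upper_triangle :: "mesh \<Rightarrow> nat \<Rightarrow> nat \<Rightarrow> (real \<times> real) set" where
  "upper_triangle m i j =
     convex hull {(xs m i, ys m j), (xs m (i + 1), ys m (j + 1)), (xs m i, ys m (j + 1))}"

definition triangulation :: "mesh \<Rightarrow> (real \<times> real) set set" where
  "triangulation m =
     (\<Union>i\<in>{1..<npts m}. \<Union>j\<in>{1..<npts m}. {lower_triangle m i j, upper_triangle m i j})"

definition mesh_size :: "mesh \<Rightarrow> real" where
  "mesh_size m = Max (diameter ` triangulation m)"

definition quasi_uniform :: "mesh set \<Rightarrow> bool" where
  "quasi_uniform F \<longleftrightarrow>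
     (\<exists>\<rho>>0. \<forall>m\<in>F. \<forall>T\<in>triangulation m. \<exists>p. cball p (\<rho> * mesh_size m) \<subseteq> T)"

definition affine_fun_on :: "(real \<times> real) set \<Rightarrow> (real \<times> real \<Rightarrow> real) \<Rightarrow> bool" where
  "affine_fun_on T u \<longleftrightarrow> (\<exists>a b c. \<forall>(x, y)\<in>T. u (x, y) = a + b * x + c * y)"

definition XN :: "real \<Rightarrow> mesh \<Rightarrow> (real \<times> real \<Rightarrow> real) set" where
  "XN L m = {u. continuous_on (closure (Omega L)) u \<and> (\<forall>T\<in>triangulation m. affine_fun_on T u)}"

definition XNP :: "real \<Rightarrow> mesh \<Rightarrow> (real \<times> real \<Rightarrow> real) set" where
  "XNP L m = XN L m \<inter> H1P L"

definition N1 :: "mesh \<Rightarrow> nat" where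
  "N1 m = (npts m - 1)\<^sup>2"

text \<open>
  Under periodicity the nodes on the right and top sides are identified with those on the left and
  bottom sides, which leaves \<open>(xs m i, ys m j)\<close> with \<open>1 \<le> i, j \<le> npts m - 1\<close>; these are
  numbered row by row, by \<open>I \<in> {0..<N1 m}\<close>.
\<close>

definition node :: "mesh \<Rightarrow> nat \<Rightarrow> real \<times> real" where
  "node m I = (xs m (I mod (npts m - 1) + 1), ys m (I div (npts m - 1) + 1))"

definition periodic_nodal_basis :: "real \<Rightarrow> mesh \<Rightarrow> (nat \<Rightarrow> real \<times> real \<Rightarrow> real) \<Rightarrow> bool" where
  "periodic_nodal_basis L m \<phi> \<longleftrightarrow>
     (\<forall>I<N1 m. \<phi> I \<in> XNP L m \<and> (\<forall>J<N1 m. \<phi> I (node m J) = (if I = J then 1 else 0)))"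

definition fe_fun :: "mesh \<Rightarrow> (nat \<Rightarrow> real \<times> real \<Rightarrow> real) \<Rightarrow> real vec \<Rightarrow> real \<times> real \<Rightarrow> real" where
  "fe_fun m \<phi> V p = (\<Sum>I<N1 m. V $ I * \<phi> I p)"

definition Mmat :: "real \<Rightarrow> mesh \<Rightarrow> (nat \<Rightarrow> real \<times> real \<Rightarrow> real) \<Rightarrow> real mat" where
  "Mmat L m \<phi> = Matrix.mat (N1 m) (N1 m) (\<lambda>(J, I). ip L (\<phi> I) (\<phi> J))"

definition Kmat :: "real \<Rightarrow> mesh \<Rightarrow> (nat \<Rightarrow> real \<times> real \<Rightarrow> real) \<Rightarrow> real mat" where
  "Kmat L m \<phi> = Matrix.mat (N1 m) (N1 m) (\<lambda>(J, I). ip1 L (\<phi> I) (\<phi> J))"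

definition Rmat :: "real \<Rightarrow> real \<Rightarrow> mesh \<Rightarrow> (nat \<Rightarrow> real \<times> real \<Rightarrow> real) \<Rightarrow> real mat" where
  "Rmat L khat m \<phi> = Matrix.mat (N1 m) (N1 m)
     (\<lambda>(J, I). ip L (\<lambda>p. khat * snd (grad L (\<phi> I) p)) (\<phi> J))"

definition Smat ::
  "real \<Rightarrow> mesh \<Rightarrow> (nat \<Rightarrow> real \<times> real \<Rightarrow> real) \<Rightarrow> real vec \<Rightarrow> real mat" where
  "Smat L m \<phi> U = Matrix.mat (N1 m) (N1 m)
     (\<lambda>(J, I). ip L (\<lambda>p. inner (Vfield L (fe_fun m \<phi> U) p) (grad L (\<phi> I) p)) (\<phi> J))"

definition Mnorm :: "real \<Rightarrow> mesh \<Rightarrow> (nat \<Rightarrow> real \<times> real \<Rightarrow> real) \<Rightarrow> real vec \<Rightarrow> real" where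
  "Mnorm L m \<phi> V = sqrt (scalar_prod V (Mmat L m \<phi> *\<^sub>v V))"

text \<open>An arbitrary value if the matrix is not invertible.\<close>

definition minv :: "real mat \<Rightarrow> real mat" where
  "minv A = the (mat_inverse A)"

definition Bmat ::
  "real \<Rightarrow> real \<Rightarrow> mesh \<Rightarrow> (nat \<Rightarrow> real \<times> real \<Rightarrow> real) \<Rightarrow> real \<Rightarrow> real mat" where
  "Bmat L khat m \<phi> \<tau> =
     Mmat L m \<phi> - \<tau> \<cdot>\<^sub>m (Rmat L khat m \<phi> * minv (Kmat L m \<phi>) * Mmat L m \<phi>)"

definition G ::
  "real \<Rightarrow> real \<Rightarrow> mesh \<Rightarrow> (nat \<Rightarrow> real \<times> real \<Rightarrow> real) \<Rightarrow> real \<Rightarrow> real vec \<Rightarrow> real vec \<Rightarrow> real vec" where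
  "G L khat m \<phi> \<tau> Z Y =
     minv (Bmat L khat m \<phi> \<tau>) *\<^sub>v
       (Mmat L m \<phi> *\<^sub>v Z -
        \<tau> \<cdot>\<^sub>v (Smat L m \<phi> (minv (Kmat L m \<phi>) *\<^sub>v (Mmat L m \<phi> *\<^sub>v Y)) *\<^sub>v Y))"

definition CZ :: "real \<Rightarrow> mesh \<Rightarrow> (nat \<Rightarrow> real \<times> real \<Rightarrow> real) \<Rightarrow> real vec \<Rightarrow> real" where
  "CZ L m \<phi> Z = 2 * Mnorm L m \<phi> Z"

definition ballN ::
  "real \<Rightarrow> mesh \<Rightarrow> (nat \<Rightarrow> real \<times> real \<Rightarrow> real) \<Rightarrow> real vec \<Rightarrow> real vec set" where
  "ballN L m \<phi> Z = {Y \<in> carrier_vec (N1 m). Mnorm L m \<phi> Y \<le> CZ L m \<phi> Z}"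

text \<open>
  The time step restriction is stated in \<^typ>\<open>ereal\<close>, where \<open>a / 0 = \<infinity>\<close> for \<open>a > 0\<close>:
  a quotient with zero denominator imposes no restriction.
\<close>

definition tau_bound ::
  "real \<Rightarrow> real \<Rightarrow> mesh \<Rightarrow> (nat \<Rightarrow> real \<times> real \<Rightarrow> real) \<Rightarrow> real \<Rightarrow> real vec \<Rightarrow> ereal" where
  "tau_bound L khat m \<phi> c Z =
     ereal (1 / 8) * min (ereal 4 / ereal \<bar>khat\<bar>)
                         (ereal ((mesh_size m)\<^sup>2) / ereal (c * CZ L m \<phi> Z))"

end

theory Submission
  imports Defs "Jordan_Normal_Form.Determinant"
begin

text \<open>
  Identify a vector \<open>W\<close> with its finite element function \<open>w\<close> and put
  \<open>u = K\<inverse> M W\<close>, the discrete solution of \<open>u - \<Delta>u = w\<close>. The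
  matrix \<open>S\<close> is the trilinear form \<open>\<integral> (u\<^sub>x v\<^sub>y - u\<^sub>y v\<^sub>x) \<psi>\<close>,
  called the convection form below, so that \<open>G(Y)\<close> solves
  \<open>X \<cdot> B G(Y) = X \<cdot> M Z - \<tau> convection(K\<inverse> M Y, Y, X)\<close> for all \<open>X\<close>, where
  \<open>\<psi>\<close> is the function of \<open>X\<close>. Four facts carry the proof.

  Elliptic bound. Testing \<open>K U = M W\<close> with \<open>U\<close> gives
  \<open>\<parallel>u\<parallel>\<^sup>2 + \<parallel>\<nabla>u\<parallel>\<^sup>2 \<le> \<parallel>w\<parallel> \<parallel>u\<parallel>\<close>, whence \<open>\<parallel>\<nabla>u\<parallel> \<le> \<parallel>w\<parallel> / 2\<close>.
  For \<open>\<tau> \<bar>khat\<bar> \<le> 1/2\<close> the matrix \<open>B\<close> is therefore coercive with constant \<open>3/4\<close>,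
  and in particular invertible (lemma \<open>B_coercive\<close>).

  Inverse inequality. Quasi-uniformity puts a disc of radius \<open>\<rho> h\<close> into every triangle. An affine
  function with gradient \<open>g\<close> has squared \<open>L\<^sup>2\<close> norm at least a constant times
  \<open>\<bar>g\<bar>\<^sup>2 (\<rho> h)\<^sup>4\<close> on that disc, so \<open>\<bar>\<nabla>v\<bar> \<le> C h\<^sup>-\<^sup>2 \<parallel>v\<parallel>\<close> almost everywhere. With the
  elliptic bound this estimates the convection form by
  \<open>C h\<^sup>-\<^sup>2 \<parallel>w\<parallel> \<parallel>v\<parallel> \<parallel>\<psi>\<parallel> / 2\<close> (lemma \<open>convection_bound\<close>).

  Contraction. The two estimates make \<open>G\<close> Lipschitz on the ball of radius \<open>C\<^sub>Z\<close> with a constant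
  proportional to \<open>\<tau> C\<^sub>Z h\<^sup>-\<^sup>2\<close>. The choice \<open>c = 4 / \<rho>\<^sup>2\<close> leaves enough room for \<open>G\<close> also to
  map the ball into itself, and Banach's theorem gives a fixed point in it.

  Skew symmetry. Uniqueness is claimed among all vectors, and \<open>G\<close> is quadratic, so the contraction on
  the ball does not suffice. But \<open>convection(U, V, V) = 0\<close>: on each triangle the integral is a
  multiple of the boundary integral of \<open>v\<^sup>2 du\<close>, and since \<open>u\<close> and \<open>v\<close> are continuous and periodic the
  contributions of the edges cancel (lemma \<open>integral_jacobian_zero\<close>). Testing the fixed point equation
  with \<open>Y\<close> itself then gives \<open>\<parallel>Y\<parallel> \<le> 4/3 \<parallel>Z\<parallel>\<close>, so every fixed point lies in the ball.

  All of this needs to know what the weak gradient of a finite element function is. By the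
  fundamental lemma of the calculus of variations it agrees almost everywhere with the piecewise
  constant gradient of the affine pieces (lemma \<open>weak_gradient_of_affine_piece\<close>).
\<close>

section \<open>Test functions that approximate indicators of boxes\<close>

lemma has_real_derivative_max_0_power2:
  "((\<lambda>t::real. (max 0 t)\<^sup>2) has_real_derivative 2 * max 0 t) (at t)"
proof -
  consider "t > 0" | "t < 0" | "t = 0" by linarith
  then show ?thesis
  proof cases
    case 1
    have "((\<lambda>t::real. t\<^sup>2) has_real_derivative 2 * t) (at t)"
      by (auto intro!: derivative_eq_intros)
    then show ?thesis
      by (rule has_field_derivative_transform_within[where d = t, THEN DERIV_cong]) (use 1 in \<open>auto simp: dist_real_def max_def\<close>)
  next
    case 2
    have "((\<lambda>t::real. 0) has_real_derivative 0) (at t)" by simp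
    then show ?thesis
      by (rule has_field_derivative_transform_within[where d = "-t", THEN DERIV_cong]) (use 2 in \<open>auto simp: dist_real_def max_def\<close>)
  next
    case 3
    have "(\<lambda>h. ((max 0 h)\<^sup>2) / h) \<midarrow>0\<rightarrow> (0::real)"
    proof (rule Lim_null_comparison)
      have "norm ((max 0 h)\<^sup>2 / h) \<le> \<bar>h\<bar>" for h :: real
        by (cases "h > 0") (auto simp: max_def power2_eq_square)
      then show "\<forall>\<^sub>F h in at 0. norm ((max 0 h)\<^sup>2 / h) \<le> \<bar>h::real\<bar>" by simp
      show "(\<lambda>h::real. \<bar>h\<bar>) \<midarrow>0\<rightarrow> 0" by (auto intro!: tendsto_eq_intros)
    qed
    then show ?thesis using 3 by (simp add: DERIV_def)
  qed
qed

lemma test_functionsI: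
  assumes "\<And>p. (\<psi> has_derivative (\<lambda>h. fst h * dx p + snd h * dy p)) (at p)"
    and "continuous_on UNIV dx" "continuous_on UNIV dy"
    and "compact K" "K \<subseteq> D" "\<And>p. p \<notin> K \<Longrightarrow> \<psi> p = 0"
  shows "\<psi> \<in> test_functions D" "classical_dx \<psi> = dx" "classical_dy \<psi> = dy"
proof -
  have fd: "frechet_derivative \<psi> (at p) = (\<lambda>h. fst h * dx p + snd h * dy p)" for p
    using frechet_derivative_at[OF assms(1)] by simp
  show dx: "classical_dx \<psi> = dx" and dy: "classical_dy \<psi> = dy"
    by (auto simp: classical_dx_def classical_dy_def fd)
  show "\<psi> \<in> test_functions D"
    using assms dx dy unfolding test_functions_def differentiable_def by auto
qed

text \<open>The derivatives of a test function vanish off the same compact set as the function itself, because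
  the complement of that set is open.\<close>

lemma test_functionsD:
  assumes "\<psi> \<in> test_functions D"
  shows "(\<psi> has_derivative (\<lambda>h. fst h * classical_dx \<psi> p + snd h * classical_dy \<psi> p)) (at p)"
    and "continuous_on UNIV \<psi>"
    and "continuous_on UNIV (classical_dx \<psi>)" "continuous_on UNIV (classical_dy \<psi>)"
    and "\<exists>K. compact K \<and> K \<subseteq> D \<and> (\<forall>p. p \<notin> K \<longrightarrow> \<psi> p = 0 \<and> classical_dx \<psi> p = 0 \<and> classical_dy \<psi> p = 0)"
proof -
  have d: "\<psi> differentiable (at p)" for p using assms unfolding test_functions_def by blast
  have *: "(\<psi> has_derivative frechet_derivative \<psi> (at p)) (at p)" for p
    using d frechet_derivative_works by blast
  have lin: "linear (frechet_derivative \<psi> (at p))" for p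
    using d linear_frechet_derivative by blast
  have eq: "frechet_derivative \<psi> (at p) h = fst h * classical_dx \<psi> p + snd h * classical_dy \<psi> p" for p h
  proof -
    have h: "h = fst h *\<^sub>R (1,0) + snd h *\<^sub>R (0,1)" by (simp add: prod_eq_iff)
    have "frechet_derivative \<psi> (at p) h = frechet_derivative \<psi> (at p) (fst h *\<^sub>R (1,0) + snd h *\<^sub>R (0,1))"
      using h by metis
    then show ?thesis
      by (simp add: linear_add[OF lin] linear_scale[OF lin] classical_dx_def classical_dy_def
          del: scaleR_Pair)
  qed
  show "(\<psi> has_derivative (\<lambda>h. fst h * classical_dx \<psi> p + snd h * classical_dy \<psi> p)) (at p)"
    using *[of p] eq by (simp add: eq[abs_def])
  show "continuous_on UNIV \<psi>" using d
    by (simp add: differentiable_imp_continuous_within continuous_on_eq_continuous_within)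
  show "continuous_on UNIV (classical_dx \<psi>)" "continuous_on UNIV (classical_dy \<psi>)"
    using assms by (auto simp: test_functions_def)
  obtain K where K: "compact K" "K \<subseteq> D" "\<forall>p. p \<notin> K \<longrightarrow> \<psi> p = 0"
    using assms by (auto simp: test_functions_def)
  have "frechet_derivative \<psi> (at p) = (\<lambda>h. 0)" if "p \<notin> K" for p
  proof -
    have "open (- K)" using K(1) compact_imp_closed by blast
    have "((\<lambda>p. 0) has_derivative (\<lambda>h. 0)) (at p)" by simp
    then have "(\<psi> has_derivative (\<lambda>h. 0)) (at p)"
      by (rule has_derivative_transform_within_open[OF _ \<open>open (- K)\<close>])
         (use that K in auto)
    then show ?thesis using frechet_derivative_at by metis
  qed
  then show "\<exists>K. compact K \<and> K \<subseteq> D \<and> (\<forall>p. p \<notin> K \<longrightarrow> \<psi> p = 0 \<and> classical_dx \<psi> p = 0 \<and> classical_dy \<psi> p = 0)"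
    using K by (intro exI[of _ K]) (auto simp: classical_dx_def classical_dy_def)
qed

text \<open>A continuously differentiable function that is positive exactly on the open box; the squares of the
  positive parts make the derivative continuous across the boundary.\<close>

definition plateau :: "real \<times> real \<Rightarrow> real \<times> real \<Rightarrow> real \<times> real \<Rightarrow> real" where
  "plateau a b p = (max 0 (fst p - fst a))\<^sup>2 * (max 0 (fst b - fst p))\<^sup>2 *
     ((max 0 (snd p - snd a))\<^sup>2 * (max 0 (snd b - snd p))\<^sup>2)"

text \<open>The map \<open>t \<mapsto> k t / (1 + k t)\<close> is smooth on \<open>[0, \<infinity>)\<close>, stays in \<open>[0, 1]\<close>, fixes \<open>0\<close>
  and tends to \<open>1\<close> for \<open>t > 0\<close>. Composed with \<open>plateau\<close> it yields test functions that
  converge boundedly to the indicator of the box.\<close>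

definition bump :: "real \<times> real \<Rightarrow> real \<times> real \<Rightarrow> nat \<Rightarrow> real \<times> real \<Rightarrow> real" where
  "bump a b k p = real k * plateau a b p / (1 + real k * plateau a b p)"

lemma plateau_nonneg: "plateau a b p \<ge> 0"
  by (simp add: plateau_def)

lemma plateau_pos_iff: "plateau a b p > 0 \<longleftrightarrow> p \<in> box a b"
proof -
  have pos: "x * y > 0 \<longleftrightarrow> x > 0 \<and> y > 0" if "x \<ge> 0" "y \<ge> 0" for x y :: real
    using that by (auto simp: zero_less_mult_iff)
  have sq: "(max 0 t)\<^sup>2 > 0 \<longleftrightarrow> t > 0" for t :: real
    by (auto simp: max_def)
  show ?thesis
    unfolding plateau_def
    by (cases a; cases b; cases p)
       (auto simp: pos sq mem_box Basis_prod_def simp del: zero_less_power2)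
qed

lemma bump_in_test_functions:
  assumes "cbox a b \<subseteq> D"
  shows "bump a b k \<in> test_functions D"
proof (rule test_functionsI(1))
  define dq1 where "dq1 p = (2 * max 0 (fst p - fst a) * (max 0 (fst b - fst p))\<^sup>2 
      - (max 0 (fst p - fst a))\<^sup>2 * (2 * max 0 (fst b - fst p))) *
     ((max 0 (snd p - snd a))\<^sup>2 * (max 0 (snd b - snd p))\<^sup>2)" for p :: "real \<times> real"
  define dq2 where "dq2 p = (max 0 (fst p - fst a))\<^sup>2 * (max 0 (fst b - fst p))\<^sup>2 * (2 * max 0 (snd p - snd a) * (max 0 (snd b - snd p))\<^sup>2 
      - (max 0 (snd p - snd a))\<^sup>2 * (2 * max 0 (snd b - snd p)))" for p :: "real \<times> real"
  define r where "r p = real k / (1 + real k * plateau a b p)\<^sup>2" for p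
  note D = has_real_derivative_max_0_power2[THEN DERIV_compose_FDERIV]
  have q: "(plateau a b has_derivative (\<lambda>h. fst h * dq1 p + snd h * dq2 p)) (at p)" for p
    unfolding plateau_def[abs_def] dq1_def dq2_def
    by (rule derivative_eq_intros D refl)+ (auto simp: algebra_simps)
  have pos: "1 + real k * plateau a b p > 0" for p
    by (simp add: add_pos_nonneg plateau_nonneg)
  have "((\<lambda>t. real k * t / (1 + real k * t)) has_real_derivative r p) (at (plateau a b p))" for p
    using pos[of p] unfolding r_def
    by (auto intro!: derivative_eq_intros simp: power2_eq_square field_simps)
  from DERIV_compose_FDERIV[OF this q]
  show "(bump a b k has_derivative (\<lambda>h. fst h * (r p * dq1 p) + snd h * (r p * dq2 p))) (at p)" for p
    unfolding bump_def[abs_def] by (simp add: algebra_simps)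
  have cq: "continuous_on UNIV (plateau a b)"
    unfolding plateau_def[abs_def] by (intro continuous_intros)
  have "continuous_on UNIV r"
    unfolding r_def using pos by (intro continuous_intros cq) (auto simp: less_le)
  then show "continuous_on UNIV (\<lambda>p. r p * dq1 p)" "continuous_on UNIV (\<lambda>p. r p * dq2 p)"
    unfolding dq1_def dq2_def by (intro continuous_intros; simp)+
  show "compact (cbox a b)" "cbox a b \<subseteq> D" using assms by auto
  show "bump a b k p = 0" if "p \<notin> cbox a b" for p
  proof -
    have "p \<notin> box a b" using that box_subset_cbox by blast
    then have "plateau a b p = 0" using plateau_pos_iff[of a b p] plateau_nonneg[of a b p] by linarith
    then show ?thesis by (simp add: bump_def)
  qed
qed

lemma bump_bounds: "0 \<le> bump a b k p" "bump a b k p \<le> 1"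
  using plateau_nonneg[of a b p] by (auto simp: bump_def divide_le_eq add_pos_nonneg)

lemma bump_tendsto: "(\<lambda>k. bump a b k p) \<longlonglongrightarrow> indicator (box a b) p"
proof (cases "p \<in> box a b")
  case True
  then have pos: "plateau a b p > 0" using plateau_pos_iff by blast
  have "(\<lambda>k. real k * plateau a b p / (1 + real k * plateau a b p)) \<longlonglongrightarrow> 1"
  proof -
    have "(\<lambda>k. 1 - 1 / (1 + real k * plateau a b p)) \<longlonglongrightarrow> 1 - 0"
      using pos
      by (intro tendsto_diff tendsto_const tendsto_divide_0[OF tendsto_const]
          filterlim_at_top_imp_at_infinity filterlim_tendsto_add_at_top[OF tendsto_const]
          filterlim_at_top_mult_tendsto_pos[OF tendsto_const] filterlim_real_sequentially) auto
    moreover have "1 - 1 / (1 + real k * plateau a b p) = real k * plateau a b p / (1 + real k * plateau a b p)" for k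
    proof -
      have "1 + real k * plateau a b p \<noteq> 0" using pos by (smt (verit) mult_nonneg_nonneg of_nat_0_le_iff)
      then show ?thesis by (simp add: field_simps)
    qed
    ultimately show ?thesis by simp
  qed
  then show ?thesis using True by (simp add: bump_def)
next
  case False
  then have "plateau a b p = 0" using plateau_pos_iff[of a b p] plateau_nonneg[of a b p] by linarith
  then show ?thesis using False by (simp add: bump_def)
qed

section \<open>The fundamental lemma of the calculus of variations\<close>

lemma bump_borel [measurable]: "bump a b k \<in> borel_measurable borel"
proof -
  have "continuous_on UNIV (bump a b k)"
    by (rule test_functionsD(2)[OF bump_in_test_functions[OF subset_UNIV]])
  then show ?thesis by (rule borel_measurable_continuous_onI)
qed

text \<open>The open boxes are an intersection-stable generator of the Borel sets, so the integral of \<open>f\<close>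
  vanishes over every Borel set.\<close>

lemma AE_zero_if_box_integrals_zero:
  fixes f :: "real \<times> real \<Rightarrow> real"
  assumes f: "integrable lborel f" and zero: "\<And>a b. (LINT p|lborel. indicator (box a b) p * f p) = 0"
  shows "AE p in lborel. f p = 0"
proof (rule sigma_finite_measure.density_zero[OF sigma_finite_lborel f])
  \<comment> \<open>Complements need the integral over the whole plane, a limit of integrals over growing boxes.\<close>
  have UNIV: "(LINT p|lborel. f p) = 0"
  proof -
    have "(\<lambda>n. LINT p|lborel. indicator (box (- real n, - real n) (real n, real n)) p * f p) \<longlonglongrightarrow> (LINT p|lborel. f p)"
    proof (rule integral_dominated_convergence[where w = "\<lambda>p. \<bar>f p\<bar>"])
      show "AE p in lborel. (\<lambda>n. indicator (box (- real n, - real n) (real n, real n)) p * f p) \<longlonglongrightarrow> f p"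
      proof (rule AE_I2)
        fix p :: "real \<times> real"
        obtain m :: nat where m: "real m > \<bar>fst p\<bar> + \<bar>snd p\<bar>" using reals_Archimedean2 by blast
        have "\<forall>\<^sub>F n in sequentially. f p = indicator (box (- real n, - real n) (real n, real n)) p * f p"
          using eventually_ge_at_top[of m]
        proof eventually_elim
          case (elim n)
          have "p \<in> box (- real n, - real n) (real n, real n)"
            using m elim by (cases p) (auto simp: mem_box Basis_prod_def)
          then show ?case by simp
        qed
        then show "(\<lambda>n. indicator (box (- real n, - real n) (real n, real n)) p * f p) \<longlonglongrightarrow> f p"
          by (rule Lim_transform_eventually[OF tendsto_const])
      qed
    qed (use f in \<open>auto split: split_indicator intro!: AE_I2\<close>)
    then show ?thesis by (simp only: zero LIMSEQ_const_iff)
  qed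
  fix A :: "(real \<times> real) set" assume "A \<in> sets lborel"
  define Bx where "Bx = range (\<lambda>(a, b). box a b :: (real \<times> real) set)"
  have borel: "B \<in> sigma_sets UNIV Bx \<longleftrightarrow> B \<in> sets borel" for B
    by (simp add: borel_eq_box Bx_def)
  have sub: "set_integrable lborel B f" if "B \<in> sets borel" for B
    unfolding set_integrable_def using f that by (intro integrable_mult_indicator) auto
  have A: "A \<in> sigma_sets UNIV Bx" using \<open>A \<in> sets lborel\<close> borel by simp
  have stable: "Int_stable Bx"
    by (auto simp: Int_stable_def box_Int_box Bx_def)
  show "set_lebesgue_integral lborel A f = 0"
  proof (rule sigma_sets_induct_disjoint[OF stable _ A])
    show "Bx \<subseteq> Pow UNIV" by simp
    show "set_lebesgue_integral lborel B f = 0" if "B \<in> Bx" for B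
      using that zero by (auto simp: set_lebesgue_integral_def Bx_def)
    show "set_lebesgue_integral lborel {} f = 0" by (simp add: set_lebesgue_integral_def)
    show "set_lebesgue_integral lborel (UNIV - B) f = 0"
      if B: "B \<in> sigma_sets UNIV Bx" and IH: "set_lebesgue_integral lborel B f = 0" for B
    proof -
      have "set_lebesgue_integral lborel (B \<union> (UNIV - B)) f = set_lebesgue_integral lborel B f + set_lebesgue_integral lborel (UNIV - B) f"
        using B borel by (intro set_integral_Un sub) auto
      moreover have "B \<union> (UNIV - B) = UNIV" by blast
      ultimately show ?thesis using UNIV IH by (simp add: set_lebesgue_integral_def)
    qed
    show "set_lebesgue_integral lborel (\<Union> (range B)) f = 0"
      if B: "disjoint_family B" "range B \<subseteq> sigma_sets UNIV Bx" and IH: "\<And>i. set_lebesgue_integral lborel (B i) f = 0"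
      for B :: "nat \<Rightarrow> (real \<times> real) set"
    proof -
      have B': "B i \<in> sets borel" for i using B(2) borel by auto
      have "set_lebesgue_integral lborel (\<Union> (range B)) f = (\<Sum>i. set_lebesgue_integral lborel (B i) f)"
        using B B' by (intro lebesgue_integral_countable_add sub) (auto simp: disjoint_family_on_def)
      then show ?thesis using IH by simp
    qed
  qed
qed

text \<open>The bumps of a box whose closure lies in \<open>D\<close> converge to its indicator, so by dominated
  convergence the integral of \<open>f\<close> over the box is zero. Hence \<open>f\<close> vanishes almost everywhere on each
  such box, and countably many of them cover \<open>D\<close>.\<close>

lemma fundamental_lemma_test_functions:
  assumes D: "open D" and f: "integrable (lebesgue_on D) f"
    and zero: "\<And>\<psi>. \<psi> \<in> test_functions D \<Longrightarrow> (LINT p|lebesgue_on D. f p * \<psi> p) = 0"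
  shows "AE p in lebesgue_on D. f p = 0"
proof -
  have DS: "D \<in> sets lebesgue" using D by simp
  have fint: "integrable lebesgue (\<lambda>p. indicator D p * f p)"
    using f DS by (simp add: integrable_restrict_space)
  then obtain g where g[measurable]: "g \<in> borel_measurable lborel" and
    ae: "AE p in lborel. indicator D p * f p = g p"
    using completion_ex_borel_measurable_real[of "\<lambda>p. indicator D p * f p" lborel] by auto
  have ae': "AE p in lebesgue. indicator D p * f p = g p" using ae by (rule AE_completion)
  have intg: "integrable lborel g"
  proof -
    have "integrable lebesgue g" using ae' fint g
      by (subst integrable_cong_AE[symmetric, OF _ _ ae']) (auto intro: measurable_completion)
    then show ?thesis using g integrable_completion by blast
  qed
  have conv: "(LINT p|lebesgue_on D. f p * \<psi> p) = (LINT p|lborel. g p * \<psi> p)" if [measurable]: "\<psi> \<in> borel_measurable borel" for \<psi>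
  proof -
    have "(LINT p|lebesgue_on D. f p * \<psi> p) = (LINT p|lebesgue. indicator D p * f p * \<psi> p)"
      using DS by (simp add: integral_restrict_space mult.assoc)
    also have "\<dots> = (LINT p|lebesgue. g p * \<psi> p)"
    proof (rule integral_cong_AE)
      have [measurable]: "\<psi> \<in> borel_measurable lebesgue" "g \<in> borel_measurable lebesgue"
        using that g by (auto intro: measurable_completion)
      have [measurable]: "(\<lambda>p. indicator D p * f p) \<in> borel_measurable lebesgue"
        using fint by auto
      show "(\<lambda>p. indicator D p * f p * \<psi> p) \<in> borel_measurable lebesgue"
        "(\<lambda>p. g p * \<psi> p) \<in> borel_measurable lebesgue" by measurable
      show "AE p in lebesgue. indicator D p * f p * \<psi> p = g p * \<psi> p"
        using ae' by eventually_elim simp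
    qed
    also have "\<dots> = (LINT p|lborel. g p * \<psi> p)" by (rule integral_completion) measurable
    finally show ?thesis .
  qed
  have box0: "(LINT p|lborel. indicator (box a b) p * g p) = 0" if "cbox a b \<subseteq> D" for a b
  proof -
    have "(\<lambda>k. LINT p|lborel. g p * bump a b k p) \<longlonglongrightarrow> (LINT p|lborel. g p * indicator (box a b) p)"
    proof (rule integral_dominated_convergence[where w = "\<lambda>p. \<bar>g p\<bar>"])
      show "AE p in lborel. (\<lambda>k. g p * bump a b k p) \<longlonglongrightarrow> g p * indicator (box a b) p"
        by (intro AE_I2 tendsto_mult tendsto_const bump_tendsto)
      show "AE p in lborel. norm (g p * bump a b k p) \<le> \<bar>g p\<bar>" for k
        by (rule AE_I2) (simp add: abs_mult bump_bounds mult_left_le)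
    qed (use intg in auto)
    moreover have "(LINT p|lborel. g p * bump a b k p) = 0" for k
      using zero[OF bump_in_test_functions[OF that]] conv[of "bump a b k"] by simp
    ultimately show ?thesis by (simp add: LIMSEQ_const_iff mult.commute)
  qed
  \<comment> \<open>The boxes that test the restriction to \<open>box a b\<close> need not lie in \<open>D\<close>, but their intersections with it do.\<close>
  have ae_box: "AE p in lborel. p \<in> cbox a b \<longrightarrow> g p = 0" if ab: "cbox a b \<subseteq> D" for a b
  proof -
    have "AE p in lborel. indicator (box a b) p * g p = 0"
    proof (rule AE_zero_if_box_integrals_zero)
      show "integrable lborel (\<lambda>p. indicator (box a b) p * g p)"
        using integrable_mult_indicator[OF _ intg, of "box a b"] by (simp del: indicator_simps)
      fix c d :: "real \<times> real"
      obtain c' d' where cd: "box c d \<inter> box a b = box c' d'" "cbox c d \<inter> cbox a b = cbox c' d'"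
        unfolding box_Int_box Int_interval by blast
      have "(LINT p|lborel. indicator (box c' d') p * g p) = 0"
        using cd ab by (intro box0) auto
      then show "(LINT p|lborel. indicator (box c d) p * (indicator (box a b) p * g p)) = 0"
        unfolding cd(1)[symmetric] indicator_inter_arith by (simp only: mult.assoc)
    qed
    moreover have "AE p in lborel. p \<notin> cbox a b - box a b"
      by (rule AE_not_in[OF null_sets_cbox_Diff_box])
    ultimately show ?thesis by eventually_elim (auto simp: indicator_def)
  qed
  obtain \<D> where \<D>: "countable \<D>" "\<D> \<subseteq> Pow D" "\<And>X. X \<in> \<D> \<Longrightarrow> \<exists>a b. X = cbox a b" "\<Union>\<D> = D"
    using open_countable_Union_open_cbox[OF D] by metis
  have "AE p in lborel. \<forall>X\<in>\<D>. p \<in> X \<longrightarrow> g p = 0"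
    unfolding AE_ball_countable[OF \<D>(1)] using ae_box \<D> by (metis PowD subsetD)
  then have "AE p in lebesgue. \<forall>X\<in>\<D>. p \<in> X \<longrightarrow> g p = 0" by (rule AE_completion)
  then have "AE p in lebesgue. p \<in> D \<longrightarrow> f p = 0"
    using ae' by eventually_elim (use \<D>(4) in \<open>auto simp: indicator_def\<close>)
  then show ?thesis using DS by (simp add: AE_restrict_space_iff)
qed

section \<open>Weak gradients of locally affine functions\<close>

lemma integral_derivative_compact_support:
  fixes H f :: "real \<Rightarrow> real"
  assumes "R > 0" and cont: "continuous_on UNIV f"
    and H: "\<And>x. (H has_real_derivative f x) (at x)"
    and out: "\<And>x. \<bar>x\<bar> \<ge> R \<Longrightarrow> H x = 0 \<and> f x = 0"
  shows "(LINT x|lborel. f x) = 0"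
proof -
  have "(LINT x|lborel. f x) = (LINT x|lborel. indicator {-R..R} x *\<^sub>R f x)"
  proof (rule Bochner_Integration.integral_cong[OF refl])
    fix x show "f x = indicator {-R..R} x *\<^sub>R f x"
      using out[of x] by (cases "\<bar>x\<bar> \<ge> R") (auto simp: indicator_def)
  qed
  also have "\<dots> = H R - H (- R)"
  proof (rule integral_FTC_atLeastAtMost)
    show "(H has_vector_derivative f x) (at x within {-R..R})" for x
      using H has_real_derivative_iff_has_vector_derivative has_vector_derivative_at_within by blast
  qed (use assms in \<open>auto intro: continuous_on_subset\<close>)
  also have "\<dots> = 0" using out[of R] out[of "-R"] \<open>R > 0\<close> by simp
  finally show ?thesis .
qed

lemma integrable_continuous_compact_support:
  fixes g :: "real \<times> real \<Rightarrow> real"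
  assumes "continuous_on UNIV g" "compact K" "\<And>p. p \<notin> K \<Longrightarrow> g p = 0"
  shows "integrable lborel g"
proof -
  have "integrable lborel (\<lambda>p. indicator K p *\<^sub>R g p)"
    by (rule borel_integrable_compact[OF assms(2)]) (use assms(1) continuous_on_subset in blast)
  moreover have "(\<lambda>p. indicator K p *\<^sub>R g p) = g" using assms(3) by (intro ext) (auto simp: indicator_def)
  ultimately show ?thesis by simp
qed

text \<open>Fubini reduces the claim to lines, where the fundamental theorem of calculus applies.\<close>

lemma integral_classical_derivative_zero:
  assumes "\<psi> \<in> test_functions UNIV"
  shows "(LINT p|lborel. classical_dx \<psi> p) = 0" "(LINT p|lborel. classical_dy \<psi> p) = 0"
proof -
  note T = test_functionsD[OF assms]
  obtain K where K: "compact K" "\<And>p. p \<notin> K \<Longrightarrow> \<psi> p = 0 \<and> classical_dx \<psi> p = 0 \<and> classical_dy \<psi> p = 0"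
    using T(5) by auto
  obtain R where R: "R > 0" "\<And>p. p \<in> K \<Longrightarrow> norm p < R"
    using compact_imp_bounded[OF K(1)] by (auto simp: bounded_pos_less)
  have outK: "(x, y) \<notin> K" if "\<bar>x\<bar> \<ge> R \<or> \<bar>y\<bar> \<ge> R" for x y
    using R(2)[of "(x, y)"] norm_fst_le[of x y] norm_snd_le[of y x] that by auto
  have int: "integrable (lborel \<Otimes>\<^sub>M lborel) g" if "continuous_on UNIV g" "\<And>p. p \<notin> K \<Longrightarrow> g p = 0" for g :: "real \<times> real \<Rightarrow> real"
    using integrable_continuous_compact_support[OF that(1) K(1) that(2)] by (simp add: lborel_prod)
  have dx: "((\<lambda>x. \<psi> (x, y)) has_real_derivative classical_dx \<psi> (x, y)) (at x)" for x y
  proof -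
    have "((\<lambda>x. (x, y)) has_derivative (\<lambda>h. (h, 0))) (at x)"
      by (auto intro!: derivative_eq_intros)
    from has_derivative_compose[OF this T(1)] show ?thesis
      by (simp add: has_field_derivative_def mult_commute_abs)
  qed
  have dy: "((\<lambda>y. \<psi> (x, y)) has_real_derivative classical_dy \<psi> (x, y)) (at y)" for x y
  proof -
    have "((\<lambda>y. (x, y)) has_derivative (\<lambda>h. (0, h))) (at y)"
      by (auto intro!: derivative_eq_intros)
    from has_derivative_compose[OF this T(1)] show ?thesis
      by (simp add: has_field_derivative_def mult_commute_abs)
  qed
  have "(LINT x|lborel. classical_dx \<psi> (x, y)) = 0" for y
  proof (rule integral_derivative_compact_support[OF R(1) _ dx])
    show "continuous_on UNIV (\<lambda>x. classical_dx \<psi> (x, y))"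
      by (rule continuous_on_compose2[OF T(3)]) (auto intro!: continuous_intros)
  qed (use K(2) outK in auto)
  then show "(LINT p|lborel. classical_dx \<psi> p) = 0"
    using lborel_pair.integral_snd[of "\<lambda>x y. classical_dx \<psi> (x, y)"] int[of "classical_dx \<psi>"] T(3) K(2)
    by (simp add: lborel_prod)
  have "(LINT y|lborel. classical_dy \<psi> (x, y)) = 0" for x
  proof (rule integral_derivative_compact_support[OF R(1) _ dy])
    show "continuous_on UNIV (\<lambda>y. classical_dy \<psi> (x, y))"
      by (rule continuous_on_compose2[OF T(4)]) (auto intro!: continuous_intros)
  qed (use K(2) outK in auto)
  then show "(LINT p|lborel. classical_dy \<psi> p) = 0"
    using lborel_pair.integral_fst[of "\<lambda>x y. classical_dy \<psi> (x, y)"] int[of "classical_dy \<psi>"] T(4) K(2)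
    by (simp add: lborel_prod)
qed

lemma test_functions_mono: "U \<subseteq> D \<Longrightarrow> test_functions U \<subseteq> test_functions D"
  unfolding test_functions_def by blast

text \<open>The product of an affine function and a test function is again a test function; its derivatives
  integrate to zero.\<close>

lemma affine_integration_by_parts:
  assumes "\<psi> \<in> test_functions UNIV"
  shows "(LINT p|lborel. (a + b * fst p + c * snd p) * classical_dx \<psi> p) = - (LINT p|lborel. b * \<psi> p)"
    and "(LINT p|lborel. (a + b * fst p + c * snd p) * classical_dy \<psi> p) = - (LINT p|lborel. c * \<psi> p)"
proof -
  note T = test_functionsD[OF assms]
  obtain K where K: "compact K" "\<And>p. p \<notin> K \<Longrightarrow> \<psi> p = 0 \<and> classical_dx \<psi> p = 0 \<and> classical_dy \<psi> p = 0"
    using T(5) by auto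
  define A where "A p = a + b * fst p + c * snd p" for p :: "real \<times> real"
  define \<eta> where "\<eta> p = A p * \<psi> p" for p
  have contA: "continuous_on UNIV A" unfolding A_def[abs_def] by (intro continuous_intros)
  have dA: "(A has_derivative (\<lambda>h. fst h * b + snd h * c)) (at p)" for p
    unfolding A_def[abs_def] by (auto intro!: derivative_eq_intros)
  have "(\<eta> has_derivative (\<lambda>h. fst h * (b * \<psi> p + A p * classical_dx \<psi> p) + snd h * (c * \<psi> p + A p * classical_dy \<psi> p))) (at p)" for p
    unfolding \<eta>_def[abs_def] using has_derivative_mult[OF dA T(1)] by (simp add: algebra_simps)
  note \<eta> = test_functionsI[OF this _ _ K(1) subset_UNIV]
  have \<eta>: "\<eta> \<in> test_functions UNIV" "classical_dx \<eta> = (\<lambda>p. b * \<psi> p + A p * classical_dx \<psi> p)"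
    "classical_dy \<eta> = (\<lambda>p. c * \<psi> p + A p * classical_dy \<psi> p)"
    by (rule \<eta>; (intro continuous_intros contA T)?; simp add: \<eta>_def K)+
  have i: "integrable lborel \<psi>" "integrable lborel (\<lambda>p. A p * classical_dx \<psi> p)" "integrable lborel (\<lambda>p. A p * classical_dy \<psi> p)"
    by (rule integrable_continuous_compact_support[OF _ K(1)]; (intro continuous_intros contA T)?; simp add: K)+
  from i integral_classical_derivative_zero[OF \<eta>(1)]
  show "(LINT p|lborel. (a + b * fst p + c * snd p) * classical_dx \<psi> p) = - (LINT p|lborel. b * \<psi> p)"
    and "(LINT p|lborel. (a + b * fst p + c * snd p) * classical_dy \<psi> p) = - (LINT p|lborel. c * \<psi> p)"
    unfolding \<eta>(2,3) A_def by simp_all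
qed

lemma Omega_sets [simp]: "Omega L \<in> sets lebesgue" "Omega L \<in> sets lborel" "open (Omega L)"
proof -
  show "open (Omega L)" unfolding Omega_def by (intro open_Times) auto
  then show "Omega L \<in> sets lebesgue" "Omega L \<in> sets lborel" by auto
qed

lemma finite_measure_Omega: "finite_measure (lebesgue_on (Omega L))"
proof (rule finite_measure_lebesgue_on)
  have "Omega L \<subseteq> cbox (0, 0) (L, L)"
    by (auto simp: Omega_def mem_box Basis_prod_def)
  then have "bounded (Omega L)" using bounded_cbox bounded_subset by blast
  then show "Omega L \<in> lmeasurable" by (simp add: bounded_set_imp_lmeasurable)
qed

lemma L2_integrable:
  assumes "f \<in> L2 (Omega L)"
  shows "integrable (lebesgue_on (Omega L)) f"
proof -
  interpret finite_measure "lebesgue_on (Omega L)" by (rule finite_measure_Omega)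
  show ?thesis
    using assms square_integrable_imp_integrable unfolding L2_def by blast
qed

lemma integral_lebesgue_on_support:
  fixes g :: "real \<times> real \<Rightarrow> real"
  assumes "K \<subseteq> D" "D \<in> sets lebesgue" "g \<in> borel_measurable borel" "\<And>p. p \<in> K \<Longrightarrow> f p = g p" "\<And>p. p \<notin> K \<Longrightarrow> f p = 0 \<and> g p = 0"
  shows "(LINT p|lebesgue_on D. f p) = (LINT p|lborel. g p)"
proof -
  have "(LINT p|lebesgue_on D. f p) = (LINT p|lebesgue. indicator D p *\<^sub>R f p)"
    using assms(2) by (simp add: integral_restrict_space)
  also have "(\<lambda>p. indicator D p *\<^sub>R f p) = g"
  proof
    fix p show "indicator D p *\<^sub>R f p = g p"
      using assms(1) assms(4)[of p] assms(5)[of p] by (cases "p \<in> K") (auto simp: indicator_def)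
  qed
  also have "(LINT p|lebesgue. g p) = (LINT p|lborel. g p)"
    using assms(3) by (intro integral_completion) simp
  finally show ?thesis .
qed

text \<open>Test functions supported in \<open>U\<close> only see the affine piece. Integration by parts shows that the weak
  gradient minus the constant gradient is orthogonal to all of them, so the fundamental lemma applies
  on \<open>U\<close>. In particular any two weak gradients agree almost everywhere on \<open>U\<close>.\<close>

lemma weak_gradient_of_affine_piece:
  assumes wg: "has_weak_gradient (Omega L) u g"
    and U: "open U" "U \<subseteq> Omega L" and u: "\<And>p. p \<in> U \<Longrightarrow> u p = a + b * fst p + c * snd p"
  shows "AE p in lebesgue_on (Omega L). p \<in> U \<longrightarrow> g p = (b, c)"
proof -
  define A where "A p = a + b * fst p + c * snd p" for p :: "real \<times> real"
  have contA: "continuous_on UNIV A" unfolding A_def[abs_def] by (intro continuous_intros)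
  have ULebesgue: "U \<in> sets lebesgue" "U \<in> sets lborel" using U by auto
  have g1: "integrable (lebesgue_on (Omega L)) (\<lambda>p. fst (g p))" and g2: "integrable (lebesgue_on (Omega L)) (\<lambda>p. snd (g p))"
    using wg L2_integrable unfolding has_weak_gradient_def by auto
  have intU: "integrable (lebesgue_on U) f" if "integrable (lebesgue_on (Omega L)) f" for f :: "real \<times> real \<Rightarrow> real"
  proof -
    have "integrable lebesgue (\<lambda>p. indicator (Omega L) p *\<^sub>R f p)"
      using that by (simp add: integrable_restrict_space)
    from integrable_mult_indicator[OF ULebesgue(1) this]
    have "integrable lebesgue (\<lambda>p. indicator U p *\<^sub>R indicator (Omega L) p *\<^sub>R f p)" .
    also have "(\<lambda>p. indicator U p *\<^sub>R indicator (Omega L) p *\<^sub>R f p) = (\<lambda>p. indicator U p *\<^sub>R f p)"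
      using U(2) by (intro ext) (auto simp: indicator_def)
    finally show ?thesis using ULebesgue by (simp add: integrable_restrict_space)
  qed
  have finU: "U \<in> lmeasurable"
  proof (rule bounded_set_imp_lmeasurable)
    have "Omega L \<subseteq> cbox (0, 0) (L, L)"
      by (auto simp: Omega_def mem_box Basis_prod_def)
    then show "bounded U" using U(2) bounded_cbox bounded_subset by blast
  qed (use ULebesgue in auto)
  have const: "integrable (lebesgue_on U) (\<lambda>p. d)" for d :: real
    using finite_measure.integrable_const[OF finite_measure_lebesgue_on[OF finU]] .
  have main: "AE p in lebesgue_on U. f p - d = 0" 
    if f: "integrable (lebesgue_on (Omega L)) f"
      and eq: "\<And>\<psi>. \<psi> \<in> test_functions U \<Longrightarrow> (LINT p|lebesgue_on (Omega L). f p * \<psi> p) = (LINT p|lborel. d * \<psi> p)" for f d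
  proof (rule fundamental_lemma_test_functions[OF U(1)])
    show "integrable (lebesgue_on U) (\<lambda>p. f p - d)" using intU[OF f] const by simp
    fix \<psi> assume \<psi>: "\<psi> \<in> test_functions U"
    note T = test_functionsD[OF \<psi>]
    obtain K where K: "compact K" "K \<subseteq> U" "\<And>p. p \<notin> K \<Longrightarrow> \<psi> p = 0"
      using T(5) by auto
    have [measurable]: "\<psi> \<in> borel_measurable borel" using T(2) by (rule borel_measurable_continuous_onI)
    have bdd: "\<exists>B. \<forall>p. \<bar>\<psi> p\<bar> \<le> B"
    proof -
      have "bounded (\<psi> ` K)" using compact_imp_bounded[OF compact_continuous_image[OF continuous_on_subset[OF T(2)] K(1)]] by simp
      then obtain B where "\<And>p. p \<in> K \<Longrightarrow> norm (\<psi> p) \<le> B" "B > 0" unfolding bounded_pos by auto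
      then show ?thesis using K(3) by (intro exI[of _ B]) (metis abs_zero less_eq_real_def real_norm_def)
    qed
    then obtain B where B: "\<And>p. \<bar>\<psi> p\<bar> \<le> B" by auto
    have intm: "integrable (lebesgue_on U) (\<lambda>p. h p * \<psi> p)" if h: "integrable (lebesgue_on U) h" for h
    proof (rule Bochner_Integration.integrable_bound)
      show "integrable (lebesgue_on U) (\<lambda>p. B * h p)" using h by simp
      have "\<psi> \<in> borel_measurable (lebesgue_on U)"
        by (rule measurable_restrict_space1, rule measurable_completion) simp
      then show "(\<lambda>p. h p * \<psi> p) \<in> borel_measurable (lebesgue_on U)"
        using h by (intro borel_measurable_times) auto
      show "AE p in lebesgue_on U. norm (h p * \<psi> p) \<le> norm (B * h p)"
        using B by (intro AE_I2) (auto simp: abs_mult mult.commute intro!: mult_mono order_trans[OF B])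
    qed
    have "(LINT p|lebesgue_on U. (f p - d) * \<psi> p) = (LINT p|lebesgue_on U. f p * \<psi> p) - (LINT p|lebesgue_on U. d * \<psi> p)"
      using intm[OF intU[OF f]] intm[OF const[of d]] by (simp add: left_diff_distrib)
    also have "(LINT p|lebesgue_on U. f p * \<psi> p) = (LINT p|lebesgue_on (Omega L). f p * \<psi> p)"
    proof -
      have "indicator U p *\<^sub>R (f p * \<psi> p) = indicator (Omega L) p *\<^sub>R (f p * \<psi> p)" for p
        using K(2) K(3)[of p] U(2) by (cases "p \<in> U") (auto simp: indicator_def)
      then have "(\<lambda>p. indicator U p *\<^sub>R (f p * \<psi> p)) = (\<lambda>p. indicator (Omega L) p *\<^sub>R (f p * \<psi> p))" by (rule ext)
      then show ?thesis using ULebesgue by (simp add: integral_restrict_space del: real_scaleR_def)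
    qed
    also have "\<dots> = (LINT p|lborel. d * \<psi> p)" by (rule eq[OF \<psi>])
    also have "(LINT p|lebesgue_on U. d * \<psi> p) = (LINT p|lborel. d * \<psi> p)"
      using K ULebesgue by (intro integral_lebesgue_on_support[of K]) auto
    finally show "(LINT p|lebesgue_on U. (f p - d) * \<psi> p) = 0" by simp
  qed
  have "AE p in lebesgue_on U. fst (g p) - b = 0 \<and> snd (g p) - c = 0"
  proof (intro AE_conjI main g1 g2)
    fix \<psi> assume \<psi>: "\<psi> \<in> test_functions U"
    then have \<psi>O: "\<psi> \<in> test_functions (Omega L)" and \<psi>U: "\<psi> \<in> test_functions UNIV"
      using test_functions_mono U(2) by (blast, blast)
    note T = test_functionsD[OF \<psi>]
    obtain K where K: "compact K" "K \<subseteq> U" "\<And>p. p \<notin> K \<Longrightarrow> \<psi> p = 0 \<and> classical_dx \<psi> p = 0 \<and> classical_dy \<psi> p = 0"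
      using T(5) by auto
    have sup: "(LINT p|lebesgue_on (Omega L). u p * d p) = (LINT p|lborel. A p * d p)"
      if "continuous_on UNIV d" "\<And>p. p \<notin> K \<Longrightarrow> d p = 0" for d
    proof (rule integral_lebesgue_on_support[of K])
      show "(\<lambda>p. A p * d p) \<in> borel_measurable borel"
        by (intro borel_measurable_continuous_onI continuous_intros contA that)
    qed (use K U(2) u that in \<open>auto simp: A_def\<close>)
    show "(LINT p|lebesgue_on (Omega L). fst (g p) * \<psi> p) = (LINT p|lborel. b * \<psi> p)"
      using wg \<psi>O sup[OF T(3)] K(3) affine_integration_by_parts(1)[OF \<psi>U, of a b c]
      unfolding has_weak_gradient_def A_def by auto
    show "(LINT p|lebesgue_on (Omega L). snd (g p) * \<psi> p) = (LINT p|lborel. c * \<psi> p)"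
      using wg \<psi>O sup[OF T(4)] K(3) affine_integration_by_parts(2)[OF \<psi>U, of a b c]
      unfolding has_weak_gradient_def A_def by auto
  qed
  then have "AE p in lebesgue. p \<in> U \<longrightarrow> fst (g p) - b = 0 \<and> snd (g p) - c = 0"
    by (subst (asm) AE_restrict_space_iff) (use ULebesgue in auto)
  then have "AE p in lebesgue. p \<in> Omega L \<longrightarrow> p \<in> U \<longrightarrow> g p = (b, c)"
    by eventually_elim (auto simp: prod_eq_iff)
  then show ?thesis by (simp add: AE_restrict_space_iff)
qed

section \<open>Integrals over squares and right triangles\<close>

lemma integral_Ioo_FTC:
  fixes f F :: "real \<Rightarrow> real"
  assumes "a \<le> b" "continuous_on {a..b} f" "\<And>x. x \<in> {a..b} \<Longrightarrow> (F has_real_derivative f x) (at x)"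
  shows "(LINT x|lborel. indicator {a<..<b} x * f x) = F b - F a"
proof -
  have "(LBINT x=a..b. f x) = F b - F a"
    using assms by (intro interval_integral_FTC_finite)
      (auto simp: min_def max_def has_real_derivative_iff_has_vector_derivative intro: has_vector_derivative_at_within)
  then show ?thesis
    using assms(1) by (simp add: interval_integral_Ioo set_lebesgue_integral_def)
qed

definition between_graphs :: "real \<Rightarrow> real \<Rightarrow> (real \<Rightarrow> real) \<Rightarrow> (real \<Rightarrow> real) \<Rightarrow> (real \<times> real) set" where
  "between_graphs a b l r = {p. a < fst p \<and> fst p < b \<and> l (fst p) < snd p \<and> snd p < r (fst p)}"

text \<open>Iterated integration, given an antiderivative \<open>H\<close> of \<open>F\<close> in \<open>y\<close> and an antiderivative \<open>Q\<close> of
  the inner integral. Squares and right triangles are both of this form.\<close>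

lemma integral_between_graphs:
  fixes F :: "real \<times> real \<Rightarrow> real"
  assumes ab: "a \<le> b" and l: "continuous_on UNIV l" and r: "continuous_on UNIV r"
    and lr: "\<And>x. a < x \<Longrightarrow> x < b \<Longrightarrow> l x \<le> r x"
    and F: "continuous_on UNIV F"
    and H: "\<And>x y. ((\<lambda>y. H x y) has_real_derivative F (x, y)) (at y)"
    and Q: "\<And>x. (Q has_real_derivative H x (r x) - H x (l x)) (at x)"
    and D: "continuous_on UNIV (\<lambda>x. H x (r x) - H x (l x))"
  shows "integrable lborel (\<lambda>p. indicator (between_graphs a b l r) p * F p)"
    and "(LINT p|lborel. indicator (between_graphs a b l r) p * F p) = Q b - Q a"
proof -
  define S where "S = between_graphs a b l r"
  have "open S"
    unfolding S_def between_graphs_def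
    by (intro open_Collect_conj open_Collect_less continuous_intros continuous_on_compose2[OF l] continuous_on_compose2[OF r]) auto
  obtain m where m: "\<And>x. x \<in> {a..b} \<Longrightarrow> m \<le> l x"
  proof -
    have "bounded (l ` {a..b})"
      by (intro compact_imp_bounded compact_continuous_image continuous_on_subset[OF l]) auto
    then obtain B where "\<And>x. x \<in> {a..b} \<Longrightarrow> norm (l x) \<le> B" unfolding bounded_iff by blast
    then show ?thesis using that[of "- B"] by (force simp: abs_le_iff)
  qed
  obtain M where M: "\<And>x. x \<in> {a..b} \<Longrightarrow> r x \<le> M"
  proof -
    have "bounded (r ` {a..b})"
      by (intro compact_imp_bounded compact_continuous_image continuous_on_subset[OF r]) auto
    then obtain B where "\<And>x. x \<in> {a..b} \<Longrightarrow> norm (r x) \<le> B" unfolding bounded_iff by blast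
    then show ?thesis using that[of "B"] by (force simp: abs_le_iff)
  qed
  have "S \<subseteq> cbox (a, m) (b, M)"
  proof
    fix p assume "p \<in> S"
    then show "p \<in> cbox (a, m) (b, M)"
      using m[of "fst p"] M[of "fst p"]
      by (cases p) (auto simp: S_def between_graphs_def mem_box Basis_prod_def)
  qed
  moreover have "integrable lborel (\<lambda>p. indicator (cbox (a, m) (b, M)) p *\<^sub>R F p)"
    by (intro borel_integrable_compact compact_cbox continuous_on_subset[OF F]) auto
  from integrable_mult_indicator[of S, OF _ this] \<open>open S\<close>
  have "integrable lborel (\<lambda>p. indicator S p *\<^sub>R (indicator (cbox (a, m) (b, M)) p *\<^sub>R F p))" by simp
  moreover have "(\<lambda>p. indicator S p *\<^sub>R (indicator (cbox (a, m) (b, M)) p *\<^sub>R F p)) = (\<lambda>p. indicator S p * F p)"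
    using \<open>S \<subseteq> cbox (a, m) (b, M)\<close> by (intro ext) (auto simp: indicator_def)
  ultimately have int: "integrable lborel (\<lambda>p. indicator S p * F p)" by simp
  then show "integrable lborel (\<lambda>p. indicator (between_graphs a b l r) p * F p)" by (simp add: S_def)
  have inner: "(LINT y|lborel. indicator S (x, y) * F (x, y)) = indicator {a<..<b} x * (H x (r x) - H x (l x))" for x
  proof (cases "x \<in> {a<..<b}")
    case True
    have "(LINT y|lborel. indicator S (x, y) * F (x, y)) = (LINT y|lborel. indicator {l x<..<r x} y * F (x, y))"
      using True by (intro Bochner_Integration.integral_cong) (auto simp: S_def between_graphs_def indicator_def)
    also have "\<dots> = H x (r x) - H x (l x)"
    proof (rule integral_Ioo_FTC)
      show "continuous_on {l x..r x} (\<lambda>y. F (x, y))"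
        by (rule continuous_on_compose2[OF F]) (auto intro!: continuous_intros)
    qed (use H lr True in auto)
    finally show ?thesis using True by simp
  next
    case False
    then have "indicator S (x, y) = (0::real)" for y
      by (auto simp: S_def between_graphs_def indicator_def)
    then show ?thesis using False by simp
  qed
  have "(LINT p|lborel. indicator S p * F p) = (LINT x|lborel. LINT y|lborel. indicator S (x, y) * F (x, y))"
    using lborel_pair.integral_fst'[of "\<lambda>p. indicator S p * F p"] int by (simp add: lborel_prod)
  also have "\<dots> = (LINT x|lborel. indicator {a<..<b} x * (H x (r x) - H x (l x)))"
    by (simp only: inner)
  also have "\<dots> = Q b - Q a"
    by (rule integral_Ioo_FTC[OF ab]) (use Q continuous_on_subset[OF D] in auto)
  finally show "(LINT p|lborel. indicator (between_graphs a b l r) p * F p) = Q b - Q a" by (simp add: S_def)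
qed

text \<open>By symmetry about the centre the mixed terms cancel; what remains bounds both the value at the
  centre and the gradient by the integral.\<close>

lemma integral_affine_squared_square:
  fixes \<alpha> \<beta> \<gamma> s :: real
  assumes "s > 0"
  shows "(LINT p|lborel. indicator (box (u - s, v - s) (u + s, v + s)) p * (\<alpha> + \<beta> * (fst p - u) + \<gamma> * (snd p - v))\<^sup>2)
      = 4 * s\<^sup>2 * \<alpha>\<^sup>2 + 4 / 3 * s ^ 4 * (\<beta>\<^sup>2 + \<gamma>\<^sup>2)"
proof -
  define H where "H x y = (\<alpha> + \<beta> * (x - u))\<^sup>2 * (y - v) + (\<alpha> + \<beta> * (x - u)) * \<gamma> * (y - v)\<^sup>2 + \<gamma>\<^sup>2 * (y - v) ^ 3 / 3" for x y
  define Q where "Q x = 2 * s * (\<alpha>\<^sup>2 * (x - u) + \<alpha> * \<beta> * (x - u)\<^sup>2 + \<beta>\<^sup>2 * (x - u) ^ 3 / 3) + 2 * \<gamma>\<^sup>2 * s ^ 3 / 3 * (x - u)" for x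
  have D: "H x (v + s) - H x (v - s) = 2 * s * (\<alpha> + \<beta> * (x - u))\<^sup>2 + 2 * \<gamma>\<^sup>2 * s ^ 3 / 3" for x
    unfolding H_def by (simp add: field_simps power2_eq_square power3_eq_cube)
  have box: "box (u - s, v - s) (u + s, v + s) = between_graphs (u - s) (u + s) (\<lambda>_. v - s) (\<lambda>_. v + s)"
    by (auto simp: between_graphs_def mem_box Basis_prod_def)
  have "(LINT p|lborel. indicator (box (u - s, v - s) (u + s, v + s)) p * (\<alpha> + \<beta> * (fst p - u) + \<gamma> * (snd p - v))\<^sup>2) = Q (u + s) - Q (u - s)"
    unfolding box
  proof (rule integral_between_graphs(2)[where H = H])
    show "((\<lambda>y. H x y) has_real_derivative (\<alpha> + \<beta> * (fst (x, y) - u) + \<gamma> * (snd (x, y) - v))\<^sup>2) (at y)" for x y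
      unfolding H_def by (auto intro!: derivative_eq_intros simp: field_simps power2_eq_square)
    show "(Q has_real_derivative H x (v + s) - H x (v - s)) (at x)" for x
      unfolding D Q_def by (auto intro!: derivative_eq_intros simp: field_simps power2_eq_square)
    show "continuous_on UNIV (\<lambda>x. H x (v + s) - H x (v - s))"
      unfolding D by (intro continuous_intros)
  qed (use assms in \<open>auto intro!: continuous_intros\<close>)
  also have "\<dots> = 4 * s\<^sup>2 * \<alpha>\<^sup>2 + 4 / 3 * s ^ 4 * (\<beta>\<^sup>2 + \<gamma>\<^sup>2)"
    unfolding Q_def by (simp add: field_simps power2_eq_square power3_eq_cube power4_eq_xxxx)
  finally show ?thesis .
qed

text \<open>Interiors of the two triangles of a cell, described by inequalities: the product form of the last
  one compares slopes with the diagonal.\<close>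

definition open_lower :: "real \<Rightarrow> real \<Rightarrow> real \<Rightarrow> real \<Rightarrow> (real \<times> real) set" where
  "open_lower x0 x1 y0 y1 = {p. x0 < fst p \<and> fst p < x1 \<and> y0 < snd p \<and> snd p < y1 \<and>
     (snd p - y0) * (x1 - x0) < (fst p - x0) * (y1 - y0)}"

definition open_upper :: "real \<Rightarrow> real \<Rightarrow> real \<Rightarrow> real \<Rightarrow> (real \<times> real) set" where
  "open_upper x0 x1 y0 y1 = {p. x0 < fst p \<and> fst p < x1 \<and> y0 < snd p \<and> snd p < y1 \<and>
     (fst p - x0) * (y1 - y0) < (snd p - y0) * (x1 - x0)}"

lemma open_lower_graphs:
  assumes "x0 < x1" "y0 < y1"
  shows "open_lower x0 x1 y0 y1 = between_graphs x0 x1 (\<lambda>_. y0) (\<lambda>x. y0 + (x - x0) * ((y1 - y0) / (x1 - x0)))"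
proof -
  have "snd p < y1" if "snd p < y0 + (fst p - x0) * ((y1 - y0) / (x1 - x0))" "fst p < x1" for p :: "real \<times> real"
  proof -
    have "(fst p - x0) * ((y1 - y0) / (x1 - x0)) \<le> (x1 - x0) * ((y1 - y0) / (x1 - x0))"
      using that assms by (intro mult_right_mono) auto
    also have "\<dots> = y1 - y0" using assms by simp
    finally show ?thesis using that by linarith
  qed
  moreover have "(snd p - y0) * (x1 - x0) < (fst p - x0) * (y1 - y0) \<longleftrightarrow> snd p < y0 + (fst p - x0) * ((y1 - y0) / (x1 - x0))" for p :: "real \<times> real"
    using assms by (auto simp: field_simps)
  ultimately show ?thesis unfolding open_lower_def between_graphs_def by blast
qed

lemma open_upper_graphs:
  assumes "x0 < x1" "y0 < y1"
  shows "open_upper x0 x1 y0 y1 = between_graphs x0 x1 (\<lambda>x. y0 + (x - x0) * ((y1 - y0) / (x1 - x0))) (\<lambda>_. y1)"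
proof -
  have "y0 < snd p" if "y0 + (fst p - x0) * ((y1 - y0) / (x1 - x0)) < snd p" "x0 < fst p" for p :: "real \<times> real"
  proof -
    have "0 \<le> (fst p - x0) * ((y1 - y0) / (x1 - x0))"
      using that assms by (intro mult_nonneg_nonneg divide_nonneg_nonneg) auto
    then show ?thesis using that by linarith
  qed
  moreover have "(fst p - x0) * (y1 - y0) < (snd p - y0) * (x1 - x0) \<longleftrightarrow> y0 + (fst p - x0) * ((y1 - y0) / (x1 - x0)) < snd p" for p :: "real \<times> real"
    using assms by (auto simp: field_simps)
  ultimately show ?thesis unfolding open_upper_def between_graphs_def by blast
qed

text \<open>Area times the value at the centroid.\<close>

lemma integral_affine_lower:
  assumes "x0 < x1" "y0 < y1"
  shows "(LINT p|lborel. indicator (open_lower x0 x1 y0 y1) p * (a + b * fst p + c * snd p))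
    = (x1 - x0) * (y1 - y0) / 2 * (a + b * (x0 + 2 * x1) / 3 + c * (2 * y0 + y1) / 3)"
proof -
  define k where "k = (y1 - y0) / (x1 - x0)"
  have k: "y1 = y0 + k * (x1 - x0)" using assms by (simp add: k_def)
  define H where "H x y = (a + b * x) * y + c * y\<^sup>2 / 2" for x y :: real
  \<comment> \<open>Expanded at \<open>x0\<close>, where the triangle has height zero, so that \<open>Q x0 = 0\<close>.\<close>
  define Q where "Q x = (a + b * x0) * k * (x - x0)\<^sup>2 / 2 + b * k * (x - x0) ^ 3 / 3 + c * (y0 * k * (x - x0)\<^sup>2 / 2 + k\<^sup>2 * (x - x0) ^ 3 / 6)" for x
  have D: "H x (y0 + (x - x0) * k) - H x y0 = (a + b * x) * ((x - x0) * k) + c / 2 * (2 * y0 * ((x - x0) * k) + ((x - x0) * k)\<^sup>2)" for x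
    unfolding H_def by (simp add: field_simps power2_eq_square)
  have "(LINT p|lborel. indicator (open_lower x0 x1 y0 y1) p * (a + b * fst p + c * snd p)) = Q x1 - Q x0"
    unfolding open_lower_graphs[OF assms] k_def[symmetric]
  proof (rule integral_between_graphs(2)[where H = H])
    show "((\<lambda>y. H x y) has_real_derivative (a + b * fst (x, y) + c * snd (x, y))) (at y)" for x y
      unfolding H_def by (auto intro!: derivative_eq_intros simp: field_simps power2_eq_square)
    show "(Q has_real_derivative H x (y0 + (x - x0) * k) - H x y0) (at x)" for x
      unfolding D Q_def by (auto intro!: derivative_eq_intros simp: field_simps power2_eq_square)
    show "continuous_on UNIV (\<lambda>x. H x (y0 + (x - x0) * k) - H x y0)"
      unfolding D by (intro continuous_intros)
    show "y0 \<le> y0 + (x - x0) * k" if "x0 < x" for x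
      using that assms by (simp add: k_def)
  qed (use assms in \<open>auto intro!: continuous_intros\<close>)
  also have "\<dots> = (x1 - x0) * (y1 - y0) / 2 * (a + b * (x0 + 2 * x1) / 3 + c * (2 * y0 + y1) / 3)"
    unfolding Q_def k by (simp add: field_simps power2_eq_square power3_eq_cube)
  finally show ?thesis .
qed

lemma integral_affine_upper:
  assumes "x0 < x1" "y0 < y1"
  shows "(LINT p|lborel. indicator (open_upper x0 x1 y0 y1) p * (a + b * fst p + c * snd p))
    = (x1 - x0) * (y1 - y0) / 2 * (a + b * (2 * x0 + x1) / 3 + c * (y0 + 2 * y1) / 3)"
proof -
  define k where "k = (y1 - y0) / (x1 - x0)"
  have k: "y1 = y0 + k * (x1 - x0)" using assms by (simp add: k_def)
  define H where "H x y = (a + b * x) * y + c * y\<^sup>2 / 2" for x y :: real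
  \<comment> \<open>Expanded at \<open>x1\<close>, where the triangle has height zero, so that \<open>Q x1 = 0\<close>.\<close>
  define Q where "Q x = (a + b * x1) * - k * (x1 - x)\<^sup>2 / 2 + b * k * (x1 - x) ^ 3 / 3 - c * (y1 * k * (x1 - x)\<^sup>2 / 2 - k\<^sup>2 * (x1 - x) ^ 3 / 6)" for x
  have y0: "y0 = y1 - k * (x1 - x0)" using k by simp
  have D: "H x y1 - H x (y0 + (x - x0) * k) = (a + b * x) * ((x1 - x) * k) + c / 2 * (2 * y1 * ((x1 - x) * k) - ((x1 - x) * k)\<^sup>2)" for x
    unfolding H_def y0 by (simp add: field_simps power2_eq_square)
  have "(LINT p|lborel. indicator (open_upper x0 x1 y0 y1) p * (a + b * fst p + c * snd p)) = Q x1 - Q x0"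
    unfolding open_upper_graphs[OF assms] k_def[symmetric]
  proof (rule integral_between_graphs(2)[where H = H])
    show "((\<lambda>y. H x y) has_real_derivative (a + b * fst (x, y) + c * snd (x, y))) (at y)" for x y
      unfolding H_def by (auto intro!: derivative_eq_intros simp: field_simps power2_eq_square)
    show "(Q has_real_derivative H x y1 - H x (y0 + (x - x0) * k)) (at x)" for x
      unfolding D Q_def by (auto intro!: derivative_eq_intros simp: field_simps power2_eq_square)
    show "continuous_on UNIV (\<lambda>x. H x y1 - H x (y0 + (x - x0) * k))"
      unfolding D by (intro continuous_intros)
    show "y0 + (x - x0) * k \<le> y1" if "x < x1" for x
    proof -
      have "(x - x0) * k \<le> (x1 - x0) * k" using that assms by (intro mult_right_mono) (auto simp: k_def)
      then show ?thesis using k by (simp add: mult.commute)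
    qed
  qed (use assms in \<open>auto intro!: continuous_intros\<close>)
  also have "\<dots> = (x1 - x0) * (y1 - y0) / 2 * (a + b * (2 * x0 + x1) / 3 + c * (y0 + 2 * y1) / 3)"
    unfolding Q_def y0 by (simp add: field_simps power2_eq_square power3_eq_cube)
  finally show ?thesis .
qed

section \<open>Geometry of the triangulation\<close>

text \<open>Triangles are indexed by their cell and by the side of the diagonal, \<open>True\<close> meaning below it.\<close>

definition open_tri :: "mesh \<Rightarrow> nat \<times> nat \<times> bool \<Rightarrow> (real \<times> real) set" where
  "open_tri m = (\<lambda>(i, j, low). (if low then open_lower else open_upper)
     (xs m i) (xs m (i + 1)) (ys m j) (ys m (j + 1)))"

definition closed_tri :: "mesh \<Rightarrow> nat \<times> nat \<times> bool \<Rightarrow> (real \<times> real) set" where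
  "closed_tri m = (\<lambda>(i, j, low). (if low then lower_triangle else upper_triangle) m i j)"

definition tri_idx :: "mesh \<Rightarrow> (nat \<times> nat \<times> bool) set" where
  "tri_idx m = {1..<npts m} \<times> {1..<npts m} \<times> UNIV"

lemma finite_tri_idx [simp]: "finite (tri_idx m)"
  by (simp add: tri_idx_def)

lemma triangulation_eq: "triangulation m = closed_tri m ` tri_idx m"
proof
  show "triangulation m \<subseteq> closed_tri m ` tri_idx m"
  proof
    fix T assume "T \<in> triangulation m"
    then obtain i j where "i \<in> {1..<npts m}" "j \<in> {1..<npts m}" "T = lower_triangle m i j \<or> T = upper_triangle m i j"
      unfolding triangulation_def by auto
    then have "T = closed_tri m (i, j, True) \<or> T = closed_tri m (i, j, False)"
      "(i, j, True) \<in> tri_idx m" "(i, j, False) \<in> tri_idx m"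
      by (auto simp: closed_tri_def tri_idx_def)
    then show "T \<in> closed_tri m ` tri_idx m" by blast
  qed
  show "closed_tri m ` tri_idx m \<subseteq> triangulation m"
  proof
    fix T assume "T \<in> closed_tri m ` tri_idx m"
    then obtain i j b where "i \<in> {1..<npts m}" "j \<in> {1..<npts m}" "T = closed_tri m (i, j, b)"
      unfolding tri_idx_def by auto
    then have "T \<in> {lower_triangle m i j, upper_triangle m i j}" "i \<in> {1..<npts m}" "j \<in> {1..<npts m}"
      by (auto simp: closed_tri_def)
    then show "T \<in> triangulation m" unfolding triangulation_def by blast
  qed
qed

lemma partition_mono:
  assumes "is_partition L n x" "1 \<le> i" "i \<le> j" "j \<le> n"
  shows "x i \<le> x j"
  using assms(3,4)
proof (induction j rule: dec_induct)
  case (step k)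
  then have "x k < x (k + 1)" using assms by (auto simp: is_partition_def)
  then show ?case using step by auto
qed simp

lemma partition_strict_mono:
  assumes "is_partition L n x" "1 \<le> i" "i < j" "j \<le> n"
  shows "x i < x j"
proof -
  have "x i < x (i + 1)" using assms by (auto simp: is_partition_def)
  also have "\<dots> \<le> x j" using assms by (intro partition_mono[OF assms(1)]) auto
  finally show ?thesis .
qed

lemma partition_range:
  assumes "is_partition L n x" "1 \<le> i" "i \<le> n"
  shows "0 \<le> x i" "x i \<le> L"
  using partition_mono[OF assms(1), of 1 i] partition_mono[OF assms(1), of i n] assms
  by (auto simp: is_partition_def)

lemma partition_cell_exists:
  assumes "is_partition L n x" "0 < t" "t < L" "\<And>i. i \<in> {1..n} \<Longrightarrow> t \<noteq> x i" "n \<ge> 1"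
  shows "\<exists>i\<in>{1..<n}. x i < t \<and> t < x (i + 1)"
proof -
  define A where "A = {i\<in>{1..n}. x i < t}"
  have "1 \<in> A" using assms by (auto simp: A_def is_partition_def)
  have fin: "finite A" by (simp add: A_def)
  define i where "i = Max A"
  have iA: "i \<in> A" unfolding i_def using fin \<open>1 \<in> A\<close> by (intro Max_in) auto
  have "i \<noteq> n" using iA assms by (auto simp: A_def is_partition_def)
  then have i: "i \<in> {1..<n}" using iA by (auto simp: A_def)
  have "i + 1 \<notin> A" using Max_ge[OF fin, of "i + 1"] by (auto simp: i_def)
  then have "t \<le> x (i + 1)" using i by (auto simp: A_def)
  moreover have "t \<noteq> x (i + 1)" using assms(4)[of "i + 1"] i by auto
  ultimately show ?thesis using i iA by (auto simp: A_def intro!: bexI[of _ i])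
qed

lemma partition_cell_unique:
  assumes "is_partition L n x" "i \<in> {1..<n}" "j \<in> {1..<n}"
    "x i < t" "t < x (i + 1)" "x j < t" "t < x (j + 1)"
  shows "i = j"
proof (rule ccontr)
  assume "i \<noteq> j"
  then consider "i + 1 \<le> j" | "j + 1 \<le> i" by linarith
  then show False
  proof cases
    case 1
    then show ?thesis using partition_mono[OF assms(1), of "i + 1" j] assms by auto
  next
    case 2
    then show ?thesis using partition_mono[OF assms(1), of "j + 1" i] assms by auto
  qed
qed

lemma mem_convex_hull_3:
  fixes a b c :: "'a::real_vector"
  assumes "0 \<le> u" "0 \<le> v" "0 \<le> w" "u + v + w = 1"
  shows "u *\<^sub>R a + v *\<^sub>R b + w *\<^sub>R c \<in> convex hull {a, b, c}"
  unfolding convex_hull_3 by (intro CollectI exI conjI refl) (use assms in auto)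

context
  fixes L :: real and m :: mesh
  assumes mesh: "is_mesh L m"
begin

lemma mesh_parts: "is_partition L (npts m) (xs m)" "is_partition L (npts m) (ys m)" "npts m \<ge> 2"
  using mesh by (auto simp: is_mesh_def)

lemma mesh_cell_pos: "i \<in> {1..<npts m} \<Longrightarrow> xs m i < xs m (i + 1)" "i \<in> {1..<npts m} \<Longrightarrow> ys m i < ys m (i + 1)"
  using mesh_parts by (auto simp: is_partition_def)

lemma open_open_tri [simp]: "open (open_tri m t)"
  unfolding open_tri_def open_lower_def open_upper_def
  by (auto split: prod.split intro!: open_Collect_conj open_Collect_less continuous_intros)

lemma open_tri_subset_Omega:
  assumes "t \<in> tri_idx m"
  shows "open_tri m t \<subseteq> Omega L"
proof -
  obtain i j b where t: "t = (i, j, b)" by (cases t) auto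
  have ij: "i \<in> {1..<npts m}" "j \<in> {1..<npts m}" using assms t by (auto simp: tri_idx_def)
  have "0 \<le> xs m i" "xs m (i + 1) \<le> L" "0 \<le> ys m j" "ys m (j + 1) \<le> L"
    using ij partition_range[OF mesh_parts(1)] partition_range[OF mesh_parts(2)] by auto
  then show ?thesis
    by (auto simp: t open_tri_def open_lower_def open_upper_def Omega_def mem_Times_iff split: if_splits)
qed

lemma open_tri_disjoint:
  assumes "t \<in> tri_idx m" "t' \<in> tri_idx m" "p \<in> open_tri m t" "p \<in> open_tri m t'"
  shows "t = t'"
proof -
  obtain i j b where t: "t = (i, j, b)" by (cases t) auto
  obtain i' j' b' where t': "t' = (i', j', b')" by (cases t') auto
  have "i = i'" "j = j'"
    using partition_cell_unique[OF mesh_parts(1), of i i' "fst p"] partition_cell_unique[OF mesh_parts(2), of j j' "snd p"] assms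
    by (auto simp: t t' tri_idx_def open_tri_def open_lower_def open_upper_def split: if_splits)
  then show ?thesis using assms
    by (auto simp: t t' tri_idx_def open_tri_def open_lower_def open_upper_def split: if_splits)
qed

text \<open>What the open triangles miss lies on the finitely many grid lines and diagonals, which are null
  sets.\<close>

lemma AE_in_open_tri: "AE p in lebesgue_on (Omega L). \<exists>t\<in>tri_idx m. p \<in> open_tri m t"
proof -
  let ?n = "npts m"
  have hyper: "AE p in lebesgue. v \<bullet> p \<noteq> d" if "v \<noteq> 0" for v :: "real \<times> real" and d
    using AE_not_in[of "{p. v \<bullet> p = d}" lebesgue] negligible_hyperplane[of v d] that
    by (simp add: negligible_iff_null_sets)
  have "AE p in lebesgue. \<forall>i\<in>{1..?n}. (1 :: real, 0 :: real) \<bullet> p \<noteq> xs m i \<and> (0 :: real, 1 :: real) \<bullet> p \<noteq> ys m i"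
  proof (rule AE_finite_allI)
    have n: "(1, 0) \<noteq> (0 :: real \<times> real)" "(0, 1) \<noteq> (0 :: real \<times> real)" by (simp_all add: zero_prod_def)
    show "AE p in lebesgue. (1 :: real, 0 :: real) \<bullet> p \<noteq> xs m i \<and> (0 :: real, 1 :: real) \<bullet> p \<noteq> ys m i" for i
      by (rule AE_conjI[OF hyper[OF n(1)] hyper[OF n(2)]])
  qed simp
  moreover have "AE p in lebesgue. \<forall>(i, j)\<in>{1..<?n}\<times>{1..<?n}.
      (- (ys m (j + 1) - ys m j), xs m (i + 1) - xs m i) \<bullet> p \<noteq>
      ys m j * (xs m (i + 1) - xs m i) - xs m i * (ys m (j + 1) - ys m j)"
  proof (rule AE_finite_allI)
    fix ij assume "ij \<in> {1..<?n}\<times>{1..<?n}"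
    then obtain i j where ij: "ij = (i, j)" "i \<in> {1..<?n}" by auto
    have "(- (ys m (j + 1) - ys m j), xs m (i + 1) - xs m i) \<noteq> 0"
      using mesh_cell_pos(1)[OF ij(2)] by (simp add: zero_prod_def)
    from hyper[OF this] show "AE p in lebesgue. case ij of (i, j) \<Rightarrow> (- (ys m (j + 1) - ys m j), xs m (i + 1) - xs m i) \<bullet> p \<noteq>
      ys m j * (xs m (i + 1) - xs m i) - xs m i * (ys m (j + 1) - ys m j)" by (simp add: ij)
  qed simp
  ultimately have "AE p in lebesgue. p \<in> Omega L \<longrightarrow> (\<exists>t\<in>tri_idx m. p \<in> open_tri m t)"
  proof eventually_elim
    case (elim p)
    show ?case
    proof
      assume p: "p \<in> Omega L"
      obtain i where i: "i \<in> {1..<?n}" "xs m i < fst p" "fst p < xs m (i + 1)"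
        using partition_cell_exists[OF mesh_parts(1), of "fst p"] p elim(1) mesh_parts(3)
        by (cases p) (auto simp: Omega_def)
      obtain j where j: "j \<in> {1..<?n}" "ys m j < snd p" "snd p < ys m (j + 1)"
        using partition_cell_exists[OF mesh_parts(2), of "snd p"] p elim(1) mesh_parts(3)
        by (cases p) (auto simp: Omega_def)
      define d1 where "d1 = (snd p - ys m j) * (xs m (i + 1) - xs m i)"
      define d2 where "d2 = (fst p - xs m i) * (ys m (j + 1) - ys m j)"
      have "d1 \<noteq> d2"
      proof
        assume "d1 = d2"
        then have "(- (ys m (j + 1) - ys m j), xs m (i + 1) - xs m i) \<bullet> p =
            ys m j * (xs m (i + 1) - xs m i) - xs m i * (ys m (j + 1) - ys m j)"
          unfolding d1_def d2_def by (cases p) (simp add: algebra_simps)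
        moreover have "(i, j) \<in> {1..<?n} \<times> {1..<?n}" using i(1) j(1) by simp
        ultimately show False using elim(2) by fastforce
      qed
      then consider "d1 < d2" | "d2 < d1" by linarith
      then show "\<exists>t\<in>tri_idx m. p \<in> open_tri m t"
      proof cases
        case 1
        then show ?thesis using i j
          by (intro bexI[of _ "(i, j, True)"]) (auto simp: open_tri_def open_lower_def tri_idx_def d1_def d2_def)
      next
        case 2
        then show ?thesis using i j
          by (intro bexI[of _ "(i, j, False)"]) (auto simp: open_tri_def open_upper_def tri_idx_def d1_def d2_def)
      qed
    qed
  qed
  then show ?thesis by (simp add: AE_restrict_space_iff)
qed

lemma open_tri_subset_closed_tri:
  assumes "t \<in> tri_idx m"
  shows "open_tri m t \<subseteq> closed_tri m t"
proof
  fix p assume p: "p \<in> open_tri m t"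
  obtain i j b where t: "t = (i, j, b)" by (cases t) auto
  have ij: "i \<in> {1..<npts m}" "j \<in> {1..<npts m}" using assms t by (auto simp: tri_idx_def)
  define h where "h = xs m (i + 1) - xs m i"
  define k where "k = ys m (j + 1) - ys m j"
  have hk: "h > 0" "k > 0" using mesh_cell_pos ij by (auto simp: h_def k_def)
  define r where "r = (fst p - xs m i) / h"
  define s where "s = (snd p - ys m j) / k"
  have p_eq: "p = (xs m i + r * h, ys m j + s * k)" using hk by (simp add: r_def s_def prod_eq_iff)
  have nodes: "xs m (i + 1) = xs m i + h" "ys m (j + 1) = ys m j + k" by (auto simp: h_def k_def)
  have fs: "fst p = xs m i + r * h" "snd p = ys m j + s * k" by (simp_all add: p_eq)
  show "p \<in> closed_tri m t"
  proof (cases b)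
    case True
    have "p \<in> open_lower (xs m i) (xs m (i + 1)) (ys m j) (ys m (j + 1))"
      using p True by (simp add: t open_tri_def)
    then have "xs m i + r * h < xs m i + h" "ys m j < ys m j + s * k" "(s * k) * h < (r * h) * k"
      unfolding open_lower_def mem_Collect_eq fs nodes add_diff_cancel_left' by blast+
    then have b: "r < 1" "0 < s" "s < r"
      using mult_less_cancel_right_pos[OF hk(1), of r 1] zero_less_mult_pos2[OF _ hk(2), of s]
        mult_less_cancel_right_pos[OF mult_pos_pos[OF hk], of s r] by (simp_all only: mult_1 mult_ac less_add_same_cancel1 add_less_cancel_left)
    have "p = (1 - r) *\<^sub>R (xs m i, ys m j) + (r - s) *\<^sub>R (xs m i + h, ys m j) + s *\<^sub>R (xs m i + h, ys m j + k)"
      unfolding p_eq by (simp add: algebra_simps)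
    also have "\<dots> \<in> convex hull {(xs m i, ys m j), (xs m i + h, ys m j), (xs m i + h, ys m j + k)}"
      using b by (intro mem_convex_hull_3) auto
    finally show ?thesis using True by (simp only: t closed_tri_def lower_triangle_def nodes prod.case if_True)
  next
    case False
    have "p \<in> open_upper (xs m i) (xs m (i + 1)) (ys m j) (ys m (j + 1))"
      using p False by (simp add: t open_tri_def)
    then have "xs m i < xs m i + r * h" "ys m j + s * k < ys m j + k" "(r * h) * k < (s * k) * h"
      unfolding open_upper_def mem_Collect_eq fs nodes add_diff_cancel_left' by blast+
    then have b: "0 < r" "s < 1" "r < s"
      using mult_less_cancel_right_pos[OF hk(2), of s 1] zero_less_mult_pos2[OF _ hk(1), of r]
        mult_less_cancel_right_pos[OF mult_pos_pos[OF hk], of r s] by (simp_all only: mult_1 mult_ac less_add_same_cancel1 add_less_cancel_left)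
    have "p = (1 - s) *\<^sub>R (xs m i, ys m j) + r *\<^sub>R (xs m i + h, ys m j + k) + (s - r) *\<^sub>R (xs m i, ys m j + k)"
      unfolding p_eq by (simp add: algebra_simps)
    also have "\<dots> \<in> convex hull {(xs m i, ys m j), (xs m i + h, ys m j + k), (xs m i, ys m j + k)}"
      using b by (intro mem_convex_hull_3) auto
    finally show ?thesis using False by (simp only: t closed_tri_def upper_triangle_def nodes prod.case if_False)
  qed
qed

lemma closed_tri_subset_square:
  assumes "t \<in> tri_idx m"
  shows "closed_tri m t \<subseteq> cbox (0, 0) (L, L)"
proof -
  obtain i j b where t: "t = (i, j, b)" by (cases t) auto
  have ij: "i \<in> {1..<npts m}" "j \<in> {1..<npts m}" using assms t by (auto simp: tri_idx_def)
  have "xs m i \<in> {0..L}" "xs m (i + 1) \<in> {0..L}" "ys m j \<in> {0..L}" "ys m (j + 1) \<in> {0..L}"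
    using ij partition_range[OF mesh_parts(1)] partition_range[OF mesh_parts(2)] by auto
  then have "lower_triangle m i j \<subseteq> cbox (0, 0) (L, L)" "upper_triangle m i j \<subseteq> cbox (0, 0) (L, L)"
    unfolding lower_triangle_def upper_triangle_def
    by (intro hull_minimal convex_box(1); simp add: mem_box Basis_prod_def)+
  then show ?thesis by (simp add: t closed_tri_def)
qed

lemma mesh_size_pos: "mesh_size m > 0"
proof -
  define t where "t = (1::nat, 1::nat, True)"
  have t: "t \<in> tri_idx m" using mesh_parts(3) by (auto simp: t_def tri_idx_def)
  have bd: "bounded (closed_tri m t)"
    using closed_tri_subset_square[OF t] bounded_cbox bounded_subset by blast
  have in1: "(xs m 1, ys m 1) \<in> closed_tri m t" and in2: "(xs m (1 + 1), ys m 1) \<in> closed_tri m t"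
    unfolding t_def closed_tri_def lower_triangle_def by (auto intro!: hull_inc)
  have "0 < dist (xs m 1, ys m 1) (xs m (1 + 1), ys m 1)"
    using mesh_cell_pos(1)[of 1] mesh_parts(3) by auto
  also have "\<dots> \<le> diameter (closed_tri m t)"
    by (rule diameter_bounded_bound[OF bd in1 in2])
  also have "\<dots> \<le> mesh_size m"
    unfolding mesh_size_def triangulation_eq using t by (intro Max_ge) auto
  finally show ?thesis .
qed

lemma integral_Omega_eq_sum_triangles:
  fixes f :: "real \<times> real \<Rightarrow> real"
  assumes "integrable (lebesgue_on (Omega L)) f"
  shows "(LINT p|lebesgue_on (Omega L). f p) =
    (\<Sum>t\<in>tri_idx m. LINT p|lebesgue_on (Omega L). indicator (open_tri m t) p * f p)"
proof -
  have i: "integrable (lebesgue_on (Omega L)) (\<lambda>p. indicator (open_tri m t) p * f p)" if "t \<in> tri_idx m" for t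
  proof -
    have "open_tri m t \<in> sets (lebesgue_on (Omega L))"
      using open_tri_subset_Omega[OF that] by (simp add: sets_restrict_space_iff)
    from integrable_mult_indicator[OF this assms] show ?thesis by (simp del: indicator_simps)
  qed
  have "(LINT p|lebesgue_on (Omega L). f p) = (LINT p|lebesgue_on (Omega L). (\<Sum>t\<in>tri_idx m. indicator (open_tri m t) p * f p))"
  proof (rule integral_cong_AE)
    show "AE p in lebesgue_on (Omega L). f p = (\<Sum>t\<in>tri_idx m. indicator (open_tri m t) p * f p)"
      using AE_in_open_tri
    proof eventually_elim
      case (elim p)
      then obtain t where t: "t \<in> tri_idx m" "p \<in> open_tri m t" by blast
      have "(\<Sum>t\<in>tri_idx m. indicator (open_tri m t) p * f p) = (\<Sum>t'\<in>tri_idx m. if t' = t then f p else 0)"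
      proof (rule sum.cong[OF refl])
        fix t' assume "t' \<in> tri_idx m"
        then have "p \<in> open_tri m t' \<longleftrightarrow> t' = t" using open_tri_disjoint t by blast
        then show "indicator (open_tri m t') p * f p = (if t' = t then f p else 0)" by (simp add: indicator_def)
      qed
      then show ?case using t by simp
    qed
    show "(\<lambda>p. \<Sum>t\<in>tri_idx m. indicator (open_tri m t) p * f p) \<in> borel_measurable (lebesgue_on (Omega L))"
      using i by (intro borel_measurable_sum) auto
  qed (use assms in auto)
  also have "\<dots> = (\<Sum>t\<in>tri_idx m. LINT p|lebesgue_on (Omega L). indicator (open_tri m t) p * f p)"
    by (rule Bochner_Integration.integral_sum) (rule i)
  finally show ?thesis .
qed

end

section \<open>Finite element functions and their matrices\<close>

text \<open>Finite element functions and their gradients are essentially bounded. This class is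
  closed under products and, the domain being bounded, consists of integrable functions.\<close>

definition ess_bounded :: "real \<Rightarrow> (real \<times> real \<Rightarrow> real) \<Rightarrow> bool" where
  "ess_bounded L f \<longleftrightarrow> f \<in> borel_measurable (lebesgue_on (Omega L)) \<and>
     (\<exists>C. AE p in lebesgue_on (Omega L). \<bar>f p\<bar> \<le> C)"

lemma ess_boundedI:
  "f \<in> borel_measurable (lebesgue_on (Omega L)) \<Longrightarrow> (AE p in lebesgue_on (Omega L). \<bar>f p\<bar> \<le> C) \<Longrightarrow> ess_bounded L f"
  by (auto simp: ess_bounded_def)

lemma ess_bounded_integrable:
  assumes "ess_bounded L f"
  shows "integrable (lebesgue_on (Omega L)) f"
proof -
  interpret finite_measure "lebesgue_on (Omega L)" by (rule finite_measure_Omega)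
  show ?thesis using assms integrable_const_bound[of f] unfolding ess_bounded_def real_norm_def by blast
qed

lemma ess_bounded_const [simp, intro]: "ess_bounded L (\<lambda>_. c)"
  by (rule ess_boundedI[where C = "\<bar>c\<bar>"]) auto

lemma ess_bounded_add [intro]:
  assumes "ess_bounded L f" "ess_bounded L g"
  shows "ess_bounded L (\<lambda>p. f p + g p)"
proof -
  obtain C D where C: "AE p in lebesgue_on (Omega L). \<bar>f p\<bar> \<le> C" and D: "AE p in lebesgue_on (Omega L). \<bar>g p\<bar> \<le> D"
    using assms by (auto simp: ess_bounded_def)
  from C D have "AE p in lebesgue_on (Omega L). \<bar>f p + g p\<bar> \<le> C + D" by eventually_elim linarith
  then show ?thesis using assms by (intro ess_boundedI) (auto simp: ess_bounded_def)
qed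

lemma ess_bounded_mult [intro]:
  assumes "ess_bounded L f" "ess_bounded L g"
  shows "ess_bounded L (\<lambda>p. f p * g p)"
proof -
  obtain C D where C: "AE p in lebesgue_on (Omega L). \<bar>f p\<bar> \<le> C" and D: "AE p in lebesgue_on (Omega L). \<bar>g p\<bar> \<le> D"
    using assms by (auto simp: ess_bounded_def)
  from C D have "AE p in lebesgue_on (Omega L). \<bar>f p * g p\<bar> \<le> C * D"
    by eventually_elim (auto simp: abs_mult intro!: mult_mono)
  then show ?thesis using assms by (intro ess_boundedI) (auto simp: ess_bounded_def)
qed

lemma ess_bounded_minus [intro]: "ess_bounded L f \<Longrightarrow> ess_bounded L (\<lambda>p. - f p)"
  using ess_bounded_mult[OF ess_bounded_const[of L "-1"]] by simp

lemma ess_bounded_diff [intro]: "ess_bounded L f \<Longrightarrow> ess_bounded L g \<Longrightarrow> ess_bounded L (\<lambda>p. f p - g p)"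
  using ess_bounded_add[OF _ ess_bounded_minus] by simp

lemma ess_bounded_power2 [intro]: "ess_bounded L f \<Longrightarrow> ess_bounded L (\<lambda>p. (f p)\<^sup>2)"
  by (auto simp: power2_eq_square)

lemma ess_bounded_sum [intro]: "(\<And>i. i \<in> A \<Longrightarrow> ess_bounded L (f i)) \<Longrightarrow> ess_bounded L (\<lambda>p. \<Sum>i\<in>A. f i p)"
  by (induction A rule: infinite_finite_induct) auto

lemma ess_bounded_continuous_on_square:
  assumes "continuous_on (closure (Omega L)) f"
  shows "ess_bounded L f"
proof -
  have "Omega L \<subseteq> cbox (0, 0) (L, L)"
    by (auto simp: Omega_def mem_box Basis_prod_def)
  then have "bounded (Omega L)" using bounded_cbox bounded_subset by blast
  then have "bounded (f ` closure (Omega L))"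
    by (intro compact_imp_bounded compact_continuous_image assms) (simp add: compact_closure)
  then obtain C where C: "\<And>p. p \<in> closure (Omega L) \<Longrightarrow> norm (f p) \<le> C" unfolding bounded_iff by blast
  have "f \<in> borel_measurable (lebesgue_on (Omega L))"
    by (intro continuous_imp_measurable_on_sets_lebesgue continuous_on_subset[OF assms] closure_subset) simp
  moreover have "AE p in lebesgue_on (Omega L). \<bar>f p\<bar> \<le> C"
    using C closure_subset by (intro AE_I2) (auto simp: space_restrict_space)
  ultimately show ?thesis by (rule ess_boundedI)
qed

lemma ess_bounded_continuous: "continuous_on UNIV f \<Longrightarrow> ess_bounded L f"
  by (intro ess_bounded_continuous_on_square) (auto intro: continuous_on_subset)

text \<open>Turns the entries of the finite element matrices into integrals of finite element functions; the
  weight \<open>k\<close> covers the constant of \<open>R\<close> and the velocity components of \<open>S\<close>.\<close>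

lemma integral_sum_mult_sum:
  assumes "\<And>i. i < n \<Longrightarrow> ess_bounded L (f i)" "\<And>j. j < n \<Longrightarrow> ess_bounded L (g j)" "ess_bounded L k"
  shows "(LINT p|lebesgue_on (Omega L). k p * (\<Sum>i<n. v i * f i p) * (\<Sum>j<n. w j * g j p)) =
    (\<Sum>j<n. \<Sum>i<n. w j * v i * (LINT p|lebesgue_on (Omega L). k p * f i p * g j p))"
proof -
  have "(LINT p|lebesgue_on (Omega L). k p * (\<Sum>i<n. v i * f i p) * (\<Sum>j<n. w j * g j p)) =
     (LINT p|lebesgue_on (Omega L). (\<Sum>j<n. \<Sum>i<n. w j * v i * (k p * f i p * g j p)))"
  proof (rule Bochner_Integration.integral_cong[OF refl])
    fix p
    have "k p * (\<Sum>i<n. v i * f i p) * (\<Sum>j<n. w j * g j p) = k p * ((\<Sum>j<n. w j * g j p) * (\<Sum>i<n. v i * f i p))"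
      by simp
    then show "k p * (\<Sum>i<n. v i * f i p) * (\<Sum>j<n. w j * g j p) = (\<Sum>j<n. \<Sum>i<n. w j * v i * (k p * f i p * g j p))"
      unfolding sum_product by (simp add: sum_distrib_left mult_ac)
  qed
  also have "\<dots> = (\<Sum>j<n. LINT p|lebesgue_on (Omega L). (\<Sum>i<n. w j * v i * (k p * f i p * g j p)))"
    using assms by (intro Bochner_Integration.integral_sum ess_bounded_integrable ess_bounded_sum ess_bounded_mult ess_bounded_const) auto
  also have "\<dots> = (\<Sum>j<n. \<Sum>i<n. LINT p|lebesgue_on (Omega L). w j * v i * (k p * f i p * g j p))"
    using assms by (intro sum.cong refl Bochner_Integration.integral_sum ess_bounded_integrable ess_bounded_mult ess_bounded_const) auto
  finally show ?thesis by simp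
qed

lemma scalar_prod_mat_mult_vec:
  fixes V W :: "real Matrix.vec"
  assumes "V \<in> carrier_vec n" "W \<in> carrier_vec n"
  shows "scalar_prod W (Matrix.mat n n a *\<^sub>v V) = (\<Sum>j<n. \<Sum>i<n. W $ j * V $ i * a (j, i))"
  using assms
  by (auto simp: scalar_prod_def atLeast0LessThan sum_distrib_left mult_ac intro!: sum.cong)

locale fem =
  fixes L :: real and m :: mesh and \<phi> :: "nat \<Rightarrow> real \<times> real \<Rightarrow> real"
  assumes mesh: "is_mesh L m" and basis: "periodic_nodal_basis L m \<phi>"
begin

abbreviation "N \<equiv> N1 m"
abbreviation "\<mu> \<equiv> lebesgue_on (Omega L)"

lemma basis_XN: "I < N \<Longrightarrow> \<phi> I \<in> XN L m" and basis_H1P: "I < N \<Longrightarrow> \<phi> I \<in> H1P L"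
  using basis by (auto simp: periodic_nodal_basis_def XNP_def)

lemma basis_weak_gradient: "I < N \<Longrightarrow> has_weak_gradient (Omega L) (\<phi> I) (grad L (\<phi> I))"
proof -
  assume "I < N"
  then have "\<exists>g. has_weak_gradient (Omega L) (\<phi> I) g" using basis_H1P by (auto simp: H1P_def H1_def)
  then show ?thesis unfolding grad_def by (rule someI_ex)
qed

lemma basis_affine_ex:
  assumes "I < N" "t \<in> tri_idx m"
  shows "\<exists>c. \<forall>p\<in>closed_tri m t. \<phi> I p = fst c + fst (snd c) * fst p + snd (snd c) * snd p"
proof -
  have "affine_fun_on (closed_tri m t) (\<phi> I)"
    using basis_XN[OF assms(1)] assms(2) by (auto simp: XN_def triangulation_eq)
  then obtain a b c where *: "\<forall>(x, y)\<in>closed_tri m t. \<phi> I (x, y) = a + b * x + c * y"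
    unfolding affine_fun_on_def by blast
  show ?thesis by (rule exI[of _ "(a, b, c)"]) (use * in force)
qed

text \<open>Coefficients of the affine function \<open>a + b x + c y\<close> with which a basis function agrees on a
  triangle. Choosing them for basis functions and extending linearly to \<open>c0\<close>, \<open>cx\<close>, \<open>cy\<close>
  makes linearity in the vector automatic.\<close>

definition coef :: "nat \<Rightarrow> nat \<times> nat \<times> bool \<Rightarrow> real \<times> real \<times> real" where
  "coef I t = (SOME c. \<forall>p\<in>closed_tri m t. \<phi> I p = fst c + fst (snd c) * fst p + snd (snd c) * snd p)"

definition c0 :: "real Matrix.vec \<Rightarrow> nat \<times> nat \<times> bool \<Rightarrow> real" where
  "c0 V t = (\<Sum>I<N. V $ I * fst (coef I t))"
definition cx :: "real Matrix.vec \<Rightarrow> nat \<times> nat \<times> bool \<Rightarrow> real" where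
  "cx V t = (\<Sum>I<N. V $ I * fst (snd (coef I t)))"
definition cy :: "real Matrix.vec \<Rightarrow> nat \<times> nat \<times> bool \<Rightarrow> real" where
  "cy V t = (\<Sum>I<N. V $ I * snd (snd (coef I t)))"

abbreviation fe :: "real Matrix.vec \<Rightarrow> real \<times> real \<Rightarrow> real" where "fe \<equiv> fe_fun m \<phi>"

text \<open>The gradient of \<open>fe V\<close> assembled from the weak gradients of the basis functions. It is linear in
  \<open>V\<close> everywhere, whereas \<open>grad L (fe V)\<close> involves a choice of its own for each \<open>V\<close>.\<close>

definition gx :: "real Matrix.vec \<Rightarrow> real \<times> real \<Rightarrow> real" where
  "gx V p = (\<Sum>I<N. V $ I * fst (grad L (\<phi> I) p))"
definition gy :: "real Matrix.vec \<Rightarrow> real \<times> real \<Rightarrow> real" where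
  "gy V p = (\<Sum>I<N. V $ I * snd (grad L (\<phi> I) p))"

lemma basis_on_tri:
  assumes "I < N" "t \<in> tri_idx m" "p \<in> closed_tri m t"
  shows "\<phi> I p = fst (coef I t) + fst (snd (coef I t)) * fst p + snd (snd (coef I t)) * snd p"
  using someI_ex[OF basis_affine_ex[OF assms(1,2)]] assms(3) unfolding coef_def[symmetric] by blast

lemma fe_on_tri:
  assumes "t \<in> tri_idx m" "p \<in> closed_tri m t"
  shows "fe V p = c0 V t + cx V t * fst p + cy V t * snd p"
proof -
  have "fe V p = (\<Sum>I<N. V $ I * (fst (coef I t) + fst (snd (coef I t)) * fst p + snd (snd (coef I t)) * snd p))"
    unfolding fe_fun_def using basis_on_tri[OF _ assms] by (intro sum.cong) auto
  then show ?thesis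
    by (simp add: c0_def cx_def cy_def sum.distrib sum_distrib_left algebra_simps)
qed

lemma tri_subset: "t \<in> tri_idx m \<Longrightarrow> open_tri m t \<subseteq> closed_tri m t"
  by (rule open_tri_subset_closed_tri[OF mesh])

lemma AE_basis_gradient:
  assumes "I < N"
  shows "AE p in \<mu>. \<forall>t\<in>tri_idx m. p \<in> open_tri m t \<longrightarrow> grad L (\<phi> I) p = snd (coef I t)"
proof (rule AE_finite_allI)
  fix t assume t: "t \<in> tri_idx m"
  show "AE p in \<mu>. p \<in> open_tri m t \<longrightarrow> grad L (\<phi> I) p = snd (coef I t)"
    using weak_gradient_of_affine_piece[OF basis_weak_gradient[OF assms] open_open_tri[OF mesh]
        open_tri_subset_Omega[OF mesh t] basis_on_tri[OF assms t subsetD[OF tri_subset[OF t]]]]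
    by simp
qed simp

lemma AE_gradient:
  "AE p in \<mu>. \<forall>t\<in>tri_idx m. p \<in> open_tri m t \<longrightarrow> gx V p = cx V t \<and> gy V p = cy V t"
proof -
  have "AE p in \<mu>. \<forall>I\<in>{..<N}. \<forall>t\<in>tri_idx m. p \<in> open_tri m t \<longrightarrow> grad L (\<phi> I) p = snd (coef I t)"
    by (intro AE_finite_allI AE_basis_gradient) auto
  then show ?thesis
    by eventually_elim (auto simp: gx_def gy_def cx_def cy_def)
qed

lemma basis_ess_bounded: "I < N \<Longrightarrow> ess_bounded L (\<phi> I)"
  using basis_XN by (intro ess_bounded_continuous_on_square) (auto simp: XN_def)

lemma basis_gradient_ess_bounded:
  assumes "I < N"
  shows "ess_bounded L (\<lambda>p. fst (grad L (\<phi> I) p))" "ess_bounded L (\<lambda>p. snd (grad L (\<phi> I) p))"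
proof -
  define C where "C = (\<Sum>t\<in>tri_idx m. norm (snd (coef I t)))"
  have "AE p in \<mu>. norm (grad L (\<phi> I) p) \<le> C"
    using AE_basis_gradient[OF assms] AE_in_open_tri[OF mesh]
  proof eventually_elim
    case (elim p)
    then obtain t where t: "t \<in> tri_idx m" "grad L (\<phi> I) p = snd (coef I t)" by blast
    then show ?case unfolding C_def by (auto intro!: member_le_sum)
  qed
  then have "AE p in \<mu>. \<bar>fst (grad L (\<phi> I) p)\<bar> \<le> C" "AE p in \<mu>. \<bar>snd (grad L (\<phi> I) p)\<bar> \<le> C"
    by (eventually_elim, metis norm_fst_le order_trans prod.collapse real_norm_def norm_snd_le)+
  moreover have "(\<lambda>p. fst (grad L (\<phi> I) p)) \<in> borel_measurable \<mu>" "(\<lambda>p. snd (grad L (\<phi> I) p)) \<in> borel_measurable \<mu>"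
    using basis_weak_gradient[OF assms] by (auto simp: has_weak_gradient_def L2_def)
  ultimately show "ess_bounded L (\<lambda>p. fst (grad L (\<phi> I) p))" "ess_bounded L (\<lambda>p. snd (grad L (\<phi> I) p))"
    using ess_boundedI by blast+
qed

lemma fe_ess_bounded [intro]: "ess_bounded L (fe V)"
  unfolding fe_fun_def[abs_def] by (intro ess_bounded_sum ess_bounded_mult ess_bounded_const) (simp add: basis_ess_bounded)

lemma gx_ess_bounded [intro]: "ess_bounded L (gx V)" and gy_ess_bounded [intro]: "ess_bounded L (gy V)"
  unfolding gx_def[abs_def] gy_def[abs_def]
  by (intro ess_bounded_sum ess_bounded_mult ess_bounded_const; simp add: basis_gradient_ess_bounded)+

lemma ess_bounded_L2: "ess_bounded L f \<Longrightarrow> f \<in> L2 (Omega L)"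
  using ess_bounded_integrable[OF ess_bounded_power2] by (auto simp: L2_def ess_bounded_def)

text \<open>Weak gradients are linear; this also shows that \<open>grad\<close> is not arbitrary on finite element
  functions.\<close>

lemma fe_weak_gradient: "has_weak_gradient (Omega L) (fe V) (\<lambda>p. (gx V p, gy V p))"
  unfolding has_weak_gradient_def
proof (intro conjI ballI)
  show "(\<lambda>p. fst (gx V p, gy V p)) \<in> L2 (Omega L)" "(\<lambda>p. snd (gx V p, gy V p)) \<in> L2 (Omega L)"
    using ess_bounded_L2 gx_ess_bounded gy_ess_bounded by auto
  fix \<psi> assume \<psi>: "\<psi> \<in> test_functions (Omega L)"
  note T = test_functionsD[OF \<psi>]
  note eb = T(2-4)[THEN ess_bounded_continuous, of L]
  have lin: "(LINT p|\<mu>. (\<Sum>I<N. V $ I * f I p) * h p) = (\<Sum>I<N. V $ I * (LINT p|\<mu>. f I p * h p))"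
    if "\<And>I. I < N \<Longrightarrow> ess_bounded L (f I)" "ess_bounded L h" for f h
  proof -
    have "(LINT p|\<mu>. (\<Sum>I<N. V $ I * f I p) * h p) = (LINT p|\<mu>. (\<Sum>I<N. V $ I * (f I p * h p)))"
      by (simp add: sum_distrib_right mult.assoc)
    also have "\<dots> = (\<Sum>I<N. LINT p|\<mu>. V $ I * (f I p * h p))"
      by (intro Bochner_Integration.integral_sum ess_bounded_integrable ess_bounded_mult ess_bounded_const that) auto
    finally show ?thesis by simp
  qed
  note b = basis_ess_bounded basis_gradient_ess_bounded
  show "(LINT p|\<mu>. fe V p * classical_dx \<psi> p) = - (LINT p|\<mu>. fst (gx V p, gy V p) * \<psi> p)"
    using basis_weak_gradient \<psi> unfolding fe_fun_def gx_def fst_conv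
    by (simp add: lin b eb has_weak_gradient_def sum_negf)
  show "(LINT p|\<mu>. fe V p * classical_dy \<psi> p) = - (LINT p|\<mu>. snd (gx V p, gy V p) * \<psi> p)"
    using basis_weak_gradient \<psi> unfolding fe_fun_def gy_def snd_conv
    by (simp add: lin b eb has_weak_gradient_def sum_negf)
qed

text \<open>Both sides equal the classical gradient of the affine piece almost everywhere on each triangle.\<close>

lemma AE_grad_fe: "AE p in \<mu>. grad L (fe V) p = (gx V p, gy V p)"
proof -
  have wg: "has_weak_gradient (Omega L) (fe V) (grad L (fe V))"
    unfolding grad_def by (rule someI[of _ "\<lambda>p. (gx V p, gy V p)"]) (rule fe_weak_gradient)
  have "AE p in \<mu>. \<forall>t\<in>tri_idx m. p \<in> open_tri m t \<longrightarrow> grad L (fe V) p = (cx V t, cy V t)"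
  proof (rule AE_finite_allI)
    fix t assume t: "t \<in> tri_idx m"
    show "AE p in \<mu>. p \<in> open_tri m t \<longrightarrow> grad L (fe V) p = (cx V t, cy V t)"
      by (rule weak_gradient_of_affine_piece[OF wg open_open_tri[OF mesh]
        open_tri_subset_Omega[OF mesh t] fe_on_tri[OF t subsetD[OF tri_subset[OF t]]]])
  qed simp
  then show ?thesis using AE_gradient[of V] AE_in_open_tri[OF mesh]
    by eventually_elim auto
qed

lemma scalar_prod_M:
  assumes "V \<in> carrier_vec N" "W \<in> carrier_vec N"
  shows "scalar_prod W (Mmat L m \<phi> *\<^sub>v V) = (LINT p|\<mu>. fe V p * fe W p)"
  using integral_sum_mult_sum[of N L \<phi> \<phi> "\<lambda>_. 1" "\<lambda>i. V $ i" "\<lambda>i. W $ i"] basis_ess_bounded assms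
  by (simp add: Mmat_def scalar_prod_mat_mult_vec ip_def fe_fun_def)

lemma scalar_prod_K:
  assumes "V \<in> carrier_vec N" "W \<in> carrier_vec N"
  shows "scalar_prod W (Kmat L m \<phi> *\<^sub>v V) =
    (LINT p|\<mu>. fe V p * fe W p) + ((LINT p|\<mu>. gx V p * gx W p) + (LINT p|\<mu>. gy V p * gy W p))"
proof -
  have "(LINT p|\<mu>. inner (grad L (\<phi> I) p) (grad L (\<phi> J) p)) =
     (LINT p|\<mu>. fst (grad L (\<phi> I) p) * fst (grad L (\<phi> J) p)) + (LINT p|\<mu>. snd (grad L (\<phi> I) p) * snd (grad L (\<phi> J) p))"
    if "I < N" "J < N" for I J
    unfolding inner_prod_def inner_real_def
    using basis_gradient_ess_bounded that
    by (intro Bochner_Integration.integral_add ess_bounded_integrable ess_bounded_mult) auto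
  then have "scalar_prod W (Kmat L m \<phi> *\<^sub>v V) =
     (\<Sum>j<N. \<Sum>i<N. W $ j * V $ i * (LINT p|\<mu>. \<phi> i p * \<phi> j p)) +
     ((\<Sum>j<N. \<Sum>i<N. W $ j * V $ i * (LINT p|\<mu>. fst (grad L (\<phi> i) p) * fst (grad L (\<phi> j) p))) +
     (\<Sum>j<N. \<Sum>i<N. W $ j * V $ i * (LINT p|\<mu>. snd (grad L (\<phi> i) p) * snd (grad L (\<phi> j) p))))"
    using assms by (simp add: Kmat_def scalar_prod_mat_mult_vec ip1_def ip_def distrib_left sum.distrib)
  then show ?thesis
    using integral_sum_mult_sum[of N L \<phi> \<phi> "\<lambda>_. 1" "\<lambda>i. V $ i" "\<lambda>i. W $ i"]
     integral_sum_mult_sum[of N L "\<lambda>i p. fst (grad L (\<phi> i) p)" "\<lambda>i p. fst (grad L (\<phi> i) p)" "\<lambda>_. 1" "\<lambda>i. V $ i" "\<lambda>i. W $ i"]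
     integral_sum_mult_sum[of N L "\<lambda>i p. snd (grad L (\<phi> i) p)" "\<lambda>i p. snd (grad L (\<phi> i) p)" "\<lambda>_. 1" "\<lambda>i. V $ i" "\<lambda>i. W $ i"]
     basis_ess_bounded basis_gradient_ess_bounded
    by (simp add: fe_fun_def gx_def gy_def)
qed

lemma scalar_prod_R:
  assumes "V \<in> carrier_vec N" "W \<in> carrier_vec N"
  shows "scalar_prod W (Rmat L khat m \<phi> *\<^sub>v V) = khat * (LINT p|\<mu>. gy V p * fe W p)"
  using integral_sum_mult_sum[of N L "\<lambda>i p. snd (grad L (\<phi> i) p)" \<phi> "\<lambda>_. khat" "\<lambda>i. V $ i" "\<lambda>i. W $ i"] 
    basis_ess_bounded basis_gradient_ess_bounded assms
  by (simp add: Rmat_def scalar_prod_mat_mult_vec ip_def fe_fun_def gy_def mult.assoc)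

text \<open>Here the velocity is built from \<open>grad L (fe U)\<close>, which may be replaced by \<open>(gx U, gy U)\<close>
  because only null sets are affected.\<close>

lemma scalar_prod_S:
  assumes "V \<in> carrier_vec N" "W \<in> carrier_vec N"
  shows "scalar_prod W (Smat L m \<phi> U *\<^sub>v V) = (LINT p|\<mu>. (gx U p * gy V p - gy U p * gx V p) * fe W p)"
proof -
  have S: "ip L (\<lambda>p. inner (Vfield L (fe U) p) (grad L (\<phi> I) p)) (\<phi> J) =
     (LINT p|\<mu>. gx U p * snd (grad L (\<phi> I) p) * \<phi> J p) + (LINT p|\<mu>. - gy U p * fst (grad L (\<phi> I) p) * \<phi> J p)"
    if IJ: "I < N" "J < N" for I J
  proof -
    have meas: "h \<in> borel_measurable \<mu>" if "ess_bounded L h" for h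
      using that by (simp add: ess_bounded_def)
    have wg: "has_weak_gradient (Omega L) (fe U) (grad L (fe U))"
      unfolding grad_def by (rule someI[of _ "\<lambda>p. (gx U p, gy U p)"]) (rule fe_weak_gradient)
    have m1: "(\<lambda>p. fst (grad L (fe U) p)) \<in> borel_measurable \<mu>" "(\<lambda>p. snd (grad L (fe U) p)) \<in> borel_measurable \<mu>"
      using wg by (auto simp: has_weak_gradient_def L2_def)
    have "ip L (\<lambda>p. inner (Vfield L (fe U) p) (grad L (\<phi> I) p)) (\<phi> J) =
      (LINT p|\<mu>. gx U p * snd (grad L (\<phi> I) p) * \<phi> J p + - gy U p * fst (grad L (\<phi> I) p) * \<phi> J p)"
      unfolding ip_def
    proof (rule integral_cong_AE)
      show "(\<lambda>p. inner (Vfield L (fe U) p) (grad L (\<phi> I) p) * \<phi> J p) \<in> borel_measurable \<mu>"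
        unfolding Vfield_def inner_prod_def inner_real_def fst_conv snd_conv
        by (intro borel_measurable_times borel_measurable_add borel_measurable_uminus m1
            basis_gradient_ess_bounded[THEN meas] basis_ess_bounded[THEN meas] IJ)
      show "(\<lambda>p. gx U p * snd (grad L (\<phi> I) p) * \<phi> J p + - gy U p * fst (grad L (\<phi> I) p) * \<phi> J p) \<in> borel_measurable \<mu>"
        by (intro meas ess_bounded_add ess_bounded_mult ess_bounded_minus basis_gradient_ess_bounded basis_ess_bounded gx_ess_bounded gy_ess_bounded IJ)
      show "AE p in \<mu>. inner (Vfield L (fe U) p) (grad L (\<phi> I) p) * \<phi> J p =
         gx U p * snd (grad L (\<phi> I) p) * \<phi> J p + - gy U p * fst (grad L (\<phi> I) p) * \<phi> J p"
        using AE_grad_fe[of U]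
        by eventually_elim (simp add: Vfield_def inner_prod_def algebra_simps)
    qed
    also have "\<dots> = (LINT p|\<mu>. gx U p * snd (grad L (\<phi> I) p) * \<phi> J p) + (LINT p|\<mu>. - gy U p * fst (grad L (\<phi> I) p) * \<phi> J p)"
      by (intro Bochner_Integration.integral_add ess_bounded_integrable ess_bounded_mult ess_bounded_minus basis_gradient_ess_bounded basis_ess_bounded gx_ess_bounded gy_ess_bounded IJ)
    finally show ?thesis .
  qed
  have "scalar_prod W (Smat L m \<phi> U *\<^sub>v V) =
     (\<Sum>j<N. \<Sum>i<N. W $ j * V $ i * (LINT p|\<mu>. gx U p * snd (grad L (\<phi> i) p) * \<phi> j p)) +
     (\<Sum>j<N. \<Sum>i<N. W $ j * V $ i * (LINT p|\<mu>. - gy U p * fst (grad L (\<phi> i) p) * \<phi> j p))"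
    using assms S by (simp add: Smat_def scalar_prod_mat_mult_vec right_diff_distrib sum_subtractf sum_negf)
  also have "\<dots> = (LINT p|\<mu>. gx U p * gy V p * fe W p) + (LINT p|\<mu>. - gy U p * gx V p * fe W p)"
    unfolding fe_fun_def[of m \<phi> W] gy_def[of V] gx_def[of V]
    by (subst (1 2) integral_sum_mult_sum)
      (auto intro: basis_ess_bounded basis_gradient_ess_bounded simp del: mult_minus_left)
  also have "\<dots> = (LINT p|\<mu>. gx U p * gy V p * fe W p + - gy U p * gx V p * fe W p)"
    by (intro Bochner_Integration.integral_add[symmetric] ess_bounded_integrable ess_bounded_mult ess_bounded_minus fe_ess_bounded gx_ess_bounded gy_ess_bounded)
  also have "\<dots> = (LINT p|\<mu>. (gx U p * gy V p - gy U p * gx V p) * fe W p)"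
    by (simp add: algebra_simps)
  finally show ?thesis .
qed

end

section \<open>Local energy bound and skew symmetry of the convection form\<close>

lemma Omega_box: "Omega L = box (0, 0) (L, L)"
  by (auto simp: Omega_def mem_box Basis_prod_def)

text \<open>The set of points where \<open>d\<close> does not vanish is open and null, hence empty.\<close>

lemma continuous_AE_zero_on_interval:
  fixes d :: "real \<Rightarrow> real"
  assumes "0 < L" and d: "continuous_on {0..L} d" and ae: "AE x in lborel. 0 < x \<and> x < L \<longrightarrow> d x = 0"
    and x: "x \<in> {0..L}"
  shows "d x = 0"
proof -
  define Z where "Z = {0<..<L} \<inter> d -` (- {0})"
  have "open Z"
    unfolding Z_def by (intro continuous_open_preimage continuous_on_subset[OF d]) auto
  have "AE x in lborel. x \<notin> Z" using ae by eventually_elim (auto simp: Z_def)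
  then have "Z \<in> null_sets lborel" using \<open>open Z\<close> AE_iff_null_sets[of Z lborel] by auto
  then have "negligible Z" using null_sets_completionI by (simp add: negligible_iff_null_sets)
  then have "Z = {}" using open_not_negligible[OF \<open>open Z\<close>] by blast
  then have "\<And>x. x \<in> {0<..<L} \<Longrightarrow> d x = 0" by (auto simp: Z_def)
  moreover have "closure {0<..<L} = {0..L}" using assms(1) by simp
  ultimately show ?thesis
    using continuous_constant_on_closure[of "{0<..<L}" d 0 x] d x by simp
qed

text \<open>Periodicity almost everywhere becomes periodicity everywhere by continuity; the nodal values need
  it at the single points of the grid.\<close>

lemma XNP_periodic:
  assumes L: "L > 0" and u: "u \<in> XNP L m" and t: "t \<in> {0..L}"
  shows "u (t, 0) = u (t, L)" "u (0, t) = u (L, t)"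
proof -
  have cl: "closure (Omega L) = cbox (0, 0) (L, L)"
    unfolding Omega_box using L by (intro closure_box) (auto simp: box_ne_empty Basis_prod_def)
  have cont: "continuous_on (cbox (0, 0) (L, L)) u"
    using u cl by (simp add: XNP_def XN_def)
  have in_sq: "(a, b) \<in> cbox (0, 0) (L, L)" if "a \<in> {0..L}" "b \<in> {0..L}" for a b
    using that by (auto simp: mem_box Basis_prod_def)
  have "u (t, 0) - u (t, L) = 0"
  proof (rule continuous_AE_zero_on_interval[OF L _ _ t])
    show "continuous_on {0..L} (\<lambda>x. u (x, 0) - u (x, L))"
      using L by (intro continuous_on_diff continuous_on_compose2[OF cont] continuous_intros) (auto intro!: in_sq)
    show "AE x in lborel. 0 < x \<and> x < L \<longrightarrow> u (x, 0) - u (x, L) = 0"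
      using u by (auto simp: XNP_def H1P_def)
  qed
  moreover have "u (0, t) - u (L, t) = 0"
  proof (rule continuous_AE_zero_on_interval[OF L _ _ t])
    show "continuous_on {0..L} (\<lambda>y. u (0, y) - u (L, y))"
      using L by (intro continuous_on_diff continuous_on_compose2[OF cont] continuous_intros) (auto intro!: in_sq)
    show "AE y in lborel. 0 < y \<and> y < L \<longrightarrow> u (0, y) - u (L, y) = 0"
      using u by (auto simp: XNP_def H1P_def)
  qed
  ultimately show "u (t, 0) = u (t, L)" "u (0, t) = u (L, t)" by simp_all
qed

text \<open>The integral of \<open>v\<^sup>2 du / 2\<close> along an edge on which \<open>u\<close> and \<open>v\<close> are affine with the
  given end values.\<close>

definition edge_flux :: "real \<Rightarrow> real \<Rightarrow> real \<Rightarrow> real \<Rightarrow> real" where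
  "edge_flux va vb ua ub = (va\<^sup>2 + va * vb + vb\<^sup>2) * (ub - ua) / 6"

text \<open>Fluxes through horizontal edges telescope in \<open>j\<close>, those through vertical edges in \<open>i\<close>, and
  periodicity makes the remaining boundary terms cancel.\<close>

lemma sum_discrete_curl_periodic:
  fixes u v :: "nat \<Rightarrow> nat \<Rightarrow> real"
  assumes "n \<ge> 1"
    and "\<And>i. i \<in> {1..n} \<Longrightarrow> u i n = u i 1 \<and> v i n = v i 1"
    and "\<And>j. j \<in> {1..n} \<Longrightarrow> u n j = u 1 j \<and> v n j = v 1 j"
  shows "(\<Sum>i\<in>{1..<n}. \<Sum>j\<in>{1..<n}.
      edge_flux (v i j) (v (i + 1) j) (u i j) (u (i + 1) j) - edge_flux (v i (j + 1)) (v (i + 1) (j + 1)) (u i (j + 1)) (u (i + 1) (j + 1))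
    + edge_flux (v (i + 1) j) (v (i + 1) (j + 1)) (u (i + 1) j) (u (i + 1) (j + 1)) - edge_flux (v i j) (v i (j + 1)) (u i j) (u i (j + 1))) = 0"
proof -
  define H where "H i j = edge_flux (v i j) (v (i + 1) j) (u i j) (u (i + 1) j)" for i j
  define K where "K j i = edge_flux (v i j) (v i (j + 1)) (u i j) (u i (j + 1))" for i j
  have "(\<Sum>i\<in>{1..<n}. \<Sum>j\<in>{1..<n}. H i j - H i (j + 1) + K j (i + 1) - K j i) =
     - (\<Sum>i\<in>{1..<n}. \<Sum>j\<in>{1..<n}. H i (Suc j) - H i j) + (\<Sum>i\<in>{1..<n}. \<Sum>j\<in>{1..<n}. K j (Suc i) - K j i)"
    by (simp add: sum.distrib sum_subtractf)
  also have "(\<Sum>i\<in>{1..<n}. \<Sum>j\<in>{1..<n}. H i (Suc j) - H i j) = (\<Sum>i\<in>{1..<n}. H i n - H i 1)"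
    using assms(1) by (intro sum.cong refl sum_Suc_diff') auto
  also have "\<dots> = 0" by (intro sum.neutral) (use assms(2) in \<open>auto simp: H_def\<close>)
  also have "(\<Sum>i\<in>{1..<n}. \<Sum>j\<in>{1..<n}. K j (Suc i) - K j i) = (\<Sum>j\<in>{1..<n}. \<Sum>i\<in>{1..<n}. K j (Suc i) - K j i)"
    by (rule sum.swap)
  also have "\<dots> = (\<Sum>j\<in>{1..<n}. K j n - K j 1)"
    using assms(1) by (intro sum.cong refl sum_Suc_diff') auto
  also have "\<dots> = 0" by (intro sum.neutral) (use assms(3) in \<open>auto simp: K_def\<close>)
  finally show ?thesis by (simp add: H_def K_def)
qed

lemma integral_Omega_indicator_continuous:
  fixes g :: "real \<times> real \<Rightarrow> real"
  assumes U: "open U" "U \<subseteq> Omega L" and g: "continuous_on UNIV g"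
  shows "(LINT p|lebesgue_on (Omega L). indicator U p * g p) = (LINT p|lborel. indicator U p * g p)"
proof (rule integral_lebesgue_on_support[OF U(2)])
  have "g \<in> borel_measurable borel" using g by (rule borel_measurable_continuous_onI)
  then show "(\<lambda>p. indicator U p * g p) \<in> borel_measurable borel"
    using U by (intro borel_measurable_times borel_measurable_indicator) auto
qed auto

context fem
begin

lemma mesh_L_pos: "L > 0"
  using partition_strict_mono[of L "npts m" "xs m" 1 "npts m"] mesh by (auto simp: is_mesh_def is_partition_def)

text \<open>The square with half side \<open>r / 2\<close> lies in the disc of radius \<open>r\<close>; on it \<open>fe V\<close> is one affine
  function, whose squared integral is explicit.\<close>

lemma fe_energy_lower_bound:
  assumes t: "t \<in> tri_idx m" and r: "r > 0" and ball: "cball (u, v) r \<subseteq> closed_tri m t"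
  shows "r\<^sup>2 * (c0 V t + cx V t * u + cy V t * v)\<^sup>2 + r ^ 4 / 12 * ((cx V t)\<^sup>2 + (cy V t)\<^sup>2) \<le> (LINT p|\<mu>. (fe V p)\<^sup>2)"
proof -
  define s where "s = r / 2"
  define B where "B = box (u - s, v - s) (u + s, v + s)"
  define \<alpha> where "\<alpha> = c0 V t + cx V t * u + cy V t * v"
  define q where "q p = (\<alpha> + cx V t * (fst p - u) + cy V t * (snd p - v))\<^sup>2" for p
  have s: "s > 0" using r by (simp add: s_def)
  have "B \<subseteq> cball (u, v) r"
  proof
    fix p assume "p \<in> B"
    then have "\<bar>u - fst p\<bar> \<le> s" "\<bar>v - snd p\<bar> \<le> s"
      by (cases p; auto simp: B_def mem_box Basis_prod_def)+
    then have "norm ((u, v) - p) \<le> 2 * s"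
      using norm_Pair_le[of "u - fst p" "v - snd p"] by (cases p) auto
    then show "p \<in> cball (u, v) r" by (simp add: s_def dist_norm)
  qed
  then have Bt: "B \<subseteq> closed_tri m t" using ball by blast
  have "B \<subseteq> interior (cbox (0, 0) (L, L))"
    using Bt closed_tri_subset_square[OF mesh t] by (intro interior_maximal) (auto simp: B_def)
  then have BO: "B \<subseteq> Omega L" by (simp add: Omega_box interior_cbox)
  have feq: "(fe V p)\<^sup>2 = q p" if "p \<in> B" for p
    unfolding fe_on_tri[OF t subsetD[OF Bt that]] q_def \<alpha>_def by (simp add: algebra_simps)
  have "4 * s\<^sup>2 * \<alpha>\<^sup>2 + 4 / 3 * s ^ 4 * ((cx V t)\<^sup>2 + (cy V t)\<^sup>2) = (LINT p|lborel. indicator B p * q p)"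
    using integral_affine_squared_square[OF s] by (simp add: B_def q_def)
  also have "\<dots> = (LINT p|\<mu>. indicator B p * q p)"
    by (rule integral_Omega_indicator_continuous[symmetric]) (use BO in \<open>auto simp: B_def q_def intro!: continuous_intros\<close>)
  also have "\<dots> = (LINT p|\<mu>. indicator B p * (fe V p)\<^sup>2)"
    using feq by (intro Bochner_Integration.integral_cong) (auto simp: indicator_def)
  also have "\<dots> \<le> (LINT p|\<mu>. (fe V p)\<^sup>2)"
  proof (rule integral_mono)
    have i: "integrable \<mu> (\<lambda>p. (fe V p)\<^sup>2)" by (intro ess_bounded_integrable ess_bounded_power2 fe_ess_bounded)
    then show "integrable \<mu> (\<lambda>p. (fe V p)\<^sup>2)" .
    have "B \<in> sets \<mu>" using BO by (simp add: sets_restrict_space_iff B_def)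
    from integrable_mult_indicator[OF this i] show "integrable \<mu> (\<lambda>p. indicator B p * (fe V p)\<^sup>2)" by (simp del: indicator_simps)
  qed (auto simp: indicator_def)
  finally show ?thesis unfolding \<alpha>_def by (simp add: s_def power2_eq_square power4_eq_xxxx field_simps)
qed

lemma fe_periodic:
  assumes "t \<in> {0..L}"
  shows "fe V (t, 0) = fe V (t, L)" "fe V (0, t) = fe V (L, t)"
  using XNP_periodic[OF mesh_L_pos _ assms] basis unfolding fe_fun_def periodic_nodal_basis_def
  by (metis (mono_tags, lifting) lessThan_iff sum.cong)+

abbreviation nodal :: "real Matrix.vec \<Rightarrow> nat \<Rightarrow> nat \<Rightarrow> real" where
  "nodal V i j \<equiv> fe V (xs m i, ys m j)"

lemma vertices_in_closed_tri:
  "(xs m i, ys m j) \<in> closed_tri m (i, j, True)" "(xs m (i + 1), ys m j) \<in> closed_tri m (i, j, True)"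
  "(xs m (i + 1), ys m (j + 1)) \<in> closed_tri m (i, j, True)"
  "(xs m i, ys m j) \<in> closed_tri m (i, j, False)" "(xs m (i + 1), ys m (j + 1)) \<in> closed_tri m (i, j, False)"
  "(xs m i, ys m (j + 1)) \<in> closed_tri m (i, j, False)"
  unfolding closed_tri_def lower_triangle_def upper_triangle_def by (auto intro!: hull_inc)

text \<open>Stokes' theorem for \<open>d(v\<^sup>2 du) = 2 v dv \<and> du\<close> on one triangle, checked on nodal values. The
  diagonal enters with opposite signs in the two triangles of a cell.\<close>

lemma integral_jacobian_lower:
  assumes "(i, j, True) \<in> tri_idx m"
  defines "t \<equiv> (i, j, True)"
  shows "(cx U t * cy V t - cy U t * cx V t) * (LINT p|lborel. indicator (open_tri m t) p * (c0 V t + cx V t * fst p + cy V t * snd p))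
     = edge_flux (nodal V i j) (nodal V (i + 1) (j + 1)) (nodal U i j) (nodal U (i + 1) (j + 1))
     - edge_flux (nodal V i j) (nodal V (i + 1) j) (nodal U i j) (nodal U (i + 1) j)
     - edge_flux (nodal V (i + 1) j) (nodal V (i + 1) (j + 1)) (nodal U (i + 1) j) (nodal U (i + 1) (j + 1))"
proof -
  have ij: "i \<in> {1..<npts m}" "j \<in> {1..<npts m}" using assms by (auto simp: tri_idx_def)
  note pos = mesh_cell_pos(1)[OF mesh ij(1)] mesh_cell_pos(2)[OF mesh ij(2)]
  define h where "h = xs m (i + 1) - xs m i"
  define k where "k = ys m (j + 1) - ys m j"
  have x1: "xs m (i + 1) = xs m i + h" and y1: "ys m (j + 1) = ys m j + k" by (simp_all add: h_def k_def)
  note on = fe_on_tri[OF assms(1)[folded t_def]]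
  note vt = vertices_in_closed_tri[of i j, folded t_def]
  have I: "(LINT p|lborel. indicator (open_tri m t) p * (c0 V t + cx V t * fst p + cy V t * snd p)) = 
      h * k / 2 * (c0 V t + cx V t * (xs m i + 2 * (xs m i + h)) / 3 + cy V t * (2 * ys m j + (ys m j + k)) / 3)"
    using integral_affine_lower[OF pos] unfolding open_tri_def t_def h_def k_def by simp
  have v: "nodal X i j = c0 X t + cx X t * xs m i + cy X t * ys m j"
    "nodal X (i + 1) j = c0 X t + cx X t * (xs m i + h) + cy X t * ys m j"
    "nodal X (i + 1) (j + 1) = c0 X t + cx X t * (xs m i + h) + cy X t * (ys m j + k)" for X
    using on[OF vt(1)] on[OF vt(2)] on[OF vt(3)] x1 y1 by simp_all
  show ?thesis
    unfolding I v edge_flux_def by (simp add: field_simps power2_eq_square)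
qed

lemma integral_jacobian_upper:
  assumes "(i, j, False) \<in> tri_idx m"
  defines "t \<equiv> (i, j, False)"
  shows "(cx U t * cy V t - cy U t * cx V t) * (LINT p|lborel. indicator (open_tri m t) p * (c0 V t + cx V t * fst p + cy V t * snd p))
     = edge_flux (nodal V i (j + 1)) (nodal V (i + 1) (j + 1)) (nodal U i (j + 1)) (nodal U (i + 1) (j + 1))
     + edge_flux (nodal V i j) (nodal V i (j + 1)) (nodal U i j) (nodal U i (j + 1))
     - edge_flux (nodal V i j) (nodal V (i + 1) (j + 1)) (nodal U i j) (nodal U (i + 1) (j + 1))"
proof -
  have ij: "i \<in> {1..<npts m}" "j \<in> {1..<npts m}" using assms by (auto simp: tri_idx_def)
  note pos = mesh_cell_pos(1)[OF mesh ij(1)] mesh_cell_pos(2)[OF mesh ij(2)]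
  define h where "h = xs m (i + 1) - xs m i"
  define k where "k = ys m (j + 1) - ys m j"
  have x1: "xs m (i + 1) = xs m i + h" and y1: "ys m (j + 1) = ys m j + k" by (simp_all add: h_def k_def)
  note on = fe_on_tri[OF assms(1)[folded t_def]]
  note vt = vertices_in_closed_tri[of i j, folded t_def]
  have I: "(LINT p|lborel. indicator (open_tri m t) p * (c0 V t + cx V t * fst p + cy V t * snd p)) = 
      h * k / 2 * (c0 V t + cx V t * (2 * xs m i + (xs m i + h)) / 3 + cy V t * (ys m j + 2 * (ys m j + k)) / 3)"
    using integral_affine_upper[OF pos] unfolding open_tri_def t_def h_def k_def by simp
  have v: "nodal X i j = c0 X t + cx X t * xs m i + cy X t * ys m j"
    "nodal X i (j + 1) = c0 X t + cx X t * xs m i + cy X t * (ys m j + k)"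
    "nodal X (i + 1) (j + 1) = c0 X t + cx X t * (xs m i + h) + cy X t * (ys m j + k)" for X
    using on[OF vt(4)] on[OF vt(5)] on[OF vt(6)] x1 y1 by simp_all
  show ?thesis
    unfolding I v edge_flux_def by (simp add: field_simps power2_eq_square)
qed

text \<open>Skew symmetry of the convection form. Summing the edge fluxes over all triangles, the diagonals
  cancel within the cells and the grid edges cancel between neighbours, periodically.\<close>

lemma integral_jacobian_zero:
  "(LINT p|\<mu>. (gx U p * gy V p - gy U p * gx V p) * fe V p) = 0"
proof -
  define w where "w t = (cx U t * cy V t - cy U t * cx V t) * (LINT p|lborel. indicator (open_tri m t) p * (c0 V t + cx V t * fst p + cy V t * snd p))" for t
  have "(LINT p|\<mu>. (gx U p * gy V p - gy U p * gx V p) * fe V p) =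
     (\<Sum>t\<in>tri_idx m. LINT p|\<mu>. indicator (open_tri m t) p * ((gx U p * gy V p - gy U p * gx V p) * fe V p))"
    by (intro integral_Omega_eq_sum_triangles[OF mesh] ess_bounded_integrable ess_bounded_mult ess_bounded_diff
        gx_ess_bounded gy_ess_bounded fe_ess_bounded)
  also have "\<dots> = (\<Sum>t\<in>tri_idx m. w t)"
  proof (rule sum.cong[OF refl])
    fix t assume t: "t \<in> tri_idx m"
    have ind: "indicator (open_tri m t) \<in> borel_measurable \<mu>"
      using open_tri_subset_Omega[OF mesh t] open_open_tri[OF mesh] by (intro borel_measurable_indicator) (simp add: sets_restrict_space_iff)
    have meas: "h \<in> borel_measurable \<mu>" if "ess_bounded L h" for h
      using that by (simp add: ess_bounded_def)
    define A where "A p = c0 V t + cx V t * fst p + cy V t * snd p" for p :: "real \<times> real"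
    have contA: "continuous_on UNIV A" unfolding A_def[abs_def] by (intro continuous_intros)
    have "(LINT p|\<mu>. indicator (open_tri m t) p * ((gx U p * gy V p - gy U p * gx V p) * fe V p)) =
      (LINT p|\<mu>. (cx U t * cy V t - cy U t * cx V t) * (indicator (open_tri m t) p * A p))"
    proof (rule integral_cong_AE)
      show "(\<lambda>p. indicator (open_tri m t) p * ((gx U p * gy V p - gy U p * gx V p) * fe V p)) \<in> borel_measurable \<mu>"
        by (intro borel_measurable_times ind meas ess_bounded_mult ess_bounded_diff
        gx_ess_bounded gy_ess_bounded fe_ess_bounded)
      show "(\<lambda>p. (cx U t * cy V t - cy U t * cx V t) * (indicator (open_tri m t) p * A p)) \<in> borel_measurable \<mu>"
        by (intro borel_measurable_times borel_measurable_const ind meas[OF ess_bounded_continuous[OF contA]])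
      show "AE p in \<mu>. indicator (open_tri m t) p * ((gx U p * gy V p - gy U p * gx V p) * fe V p) =
         (cx U t * cy V t - cy U t * cx V t) * (indicator (open_tri m t) p * A p)"
        using AE_gradient[of U] AE_gradient[of V]
      proof eventually_elim
        case (elim p)
        show ?case
        proof (cases "p \<in> open_tri m t")
          case True
          then show ?thesis using elim t fe_on_tri[OF t subsetD[OF tri_subset[OF t] True], of V] by (simp add: A_def)
        qed simp
      qed
    qed
    also have "\<dots> = w t"
      unfolding w_def A_def[symmetric]
      using integral_Omega_indicator_continuous[OF open_open_tri[OF mesh] open_tri_subset_Omega[OF mesh t] contA] by simp
    finally show "(LINT p|\<mu>. indicator (open_tri m t) p * ((gx U p * gy V p - gy U p * gx V p) * fe V p)) = w t" .
  qed
  also have "\<dots> = (\<Sum>i\<in>{1..<npts m}. \<Sum>j\<in>{1..<npts m}. w (i, j, True) + w (i, j, False))"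
  proof -
    have "(\<Sum>t\<in>tri_idx m. w t) = (\<Sum>i\<in>{1..<npts m}. \<Sum>j\<in>{1..<npts m}. \<Sum>b\<in>UNIV. w (i, j, b))"
      unfolding tri_idx_def by (simp add: sum.cartesian_product split_def)
    then show ?thesis by (simp add: UNIV_bool add.commute)
  qed
  also have "\<dots> = - (\<Sum>i\<in>{1..<npts m}. \<Sum>j\<in>{1..<npts m}.
      edge_flux (nodal V i j) (nodal V (i + 1) j) (nodal U i j) (nodal U (i + 1) j)
    - edge_flux (nodal V i (j + 1)) (nodal V (i + 1) (j + 1)) (nodal U i (j + 1)) (nodal U (i + 1) (j + 1))
    + edge_flux (nodal V (i + 1) j) (nodal V (i + 1) (j + 1)) (nodal U (i + 1) j) (nodal U (i + 1) (j + 1))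
    - edge_flux (nodal V i j) (nodal V i (j + 1)) (nodal U i j) (nodal U i (j + 1)))"
    unfolding sum_negf[symmetric]
  proof (intro sum.cong refl)
    fix i j assume ij: "i \<in> {1..<npts m}" "j \<in> {1..<npts m}"
    then have "(i, j, True) \<in> tri_idx m" "(i, j, False) \<in> tri_idx m" by (auto simp: tri_idx_def)
    from integral_jacobian_lower[OF this(1), of U V] integral_jacobian_upper[OF this(2), of U V]
    show "w (i, j, True) + w (i, j, False) = - (
        edge_flux (nodal V i j) (nodal V (i + 1) j) (nodal U i j) (nodal U (i + 1) j)
      - edge_flux (nodal V i (j + 1)) (nodal V (i + 1) (j + 1)) (nodal U i (j + 1)) (nodal U (i + 1) (j + 1))
      + edge_flux (nodal V (i + 1) j) (nodal V (i + 1) (j + 1)) (nodal U (i + 1) j) (nodal U (i + 1) (j + 1))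
      - edge_flux (nodal V i j) (nodal V i (j + 1)) (nodal U i j) (nodal U i (j + 1)))"
      unfolding w_def by linarith
  qed
  also have "(\<Sum>i\<in>{1..<npts m}. \<Sum>j\<in>{1..<npts m}.
      edge_flux (nodal V i j) (nodal V (i + 1) j) (nodal U i j) (nodal U (i + 1) j)
    - edge_flux (nodal V i (j + 1)) (nodal V (i + 1) (j + 1)) (nodal U i (j + 1)) (nodal U (i + 1) (j + 1))
    + edge_flux (nodal V (i + 1) j) (nodal V (i + 1) (j + 1)) (nodal U (i + 1) j) (nodal U (i + 1) (j + 1))
    - edge_flux (nodal V i j) (nodal V i (j + 1)) (nodal U i j) (nodal U i (j + 1))) = 0"
  proof (rule sum_discrete_curl_periodic)
    note P = mesh_parts[OF mesh]
    show "npts m \<ge> 1" using P(3) by simp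
    have e: "xs m 1 = 0" "xs m (npts m) = L" "ys m 1 = 0" "ys m (npts m) = L"
      using P by (auto simp: is_partition_def)
    show "nodal U i (npts m) = nodal U i 1 \<and> nodal V i (npts m) = nodal V i 1" if "i \<in> {1..npts m}" for i
      using fe_periodic(1)[of "xs m i"] partition_range[OF P(1), of i] that unfolding e by simp
    show "nodal U (npts m) j = nodal U 1 j \<and> nodal V (npts m) j = nodal V 1 j" if "j \<in> {1..npts m}" for j
      using fe_periodic(2)[of "ys m j"] partition_range[OF P(2), of j] that unfolding e by simp
  qed
  finally show ?thesis by simp
qed

end

section \<open>Norm estimates\<close>

lemma Cauchy_Schwarz_ess_bounded:
  assumes f: "ess_bounded L f" and g: "ess_bounded L g"
  shows "(LINT p|lebesgue_on (Omega L). f p * g p)\<^sup>2 \<le>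
    (LINT p|lebesgue_on (Omega L). (f p)\<^sup>2) * (LINT p|lebesgue_on (Omega L). (g p)\<^sup>2)"
proof -
  define A where "A = (LINT p|lebesgue_on (Omega L). (f p)\<^sup>2)"
  define B where "B = (LINT p|lebesgue_on (Omega L). f p * g p)"
  define C where "C = (LINT p|lebesgue_on (Omega L). (g p)\<^sup>2)"
  have nonneg: "A + 2 * t * B + t\<^sup>2 * C \<ge> 0" for t
  proof -
    have i: "integrable (lebesgue_on (Omega L)) (\<lambda>p. (f p)\<^sup>2)" "integrable (lebesgue_on (Omega L)) (\<lambda>p. (g p)\<^sup>2)"
      "integrable (lebesgue_on (Omega L)) (\<lambda>p. f p * g p)"
      using f g by (auto intro: ess_bounded_integrable)
    have "0 \<le> (LINT p|lebesgue_on (Omega L). (f p + t * g p)\<^sup>2)" by simp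
    also have "(\<lambda>p. (f p + t * g p)\<^sup>2) = (\<lambda>p. (f p)\<^sup>2 + (2 * t) * (f p * g p) + t\<^sup>2 * (g p)\<^sup>2)"
      by (intro ext) (simp add: power2_eq_square algebra_simps)
    also have "(LINT p|lebesgue_on (Omega L). (f p)\<^sup>2 + (2 * t) * (f p * g p) + t\<^sup>2 * (g p)\<^sup>2) = A + 2 * t * B + t\<^sup>2 * C"
      using i unfolding A_def B_def C_def by simp
    finally show ?thesis .
  qed
  have "B\<^sup>2 \<le> A * C"
  proof (cases "C = 0")
    case True
    have "B = 0"
    proof (rule ccontr)
      assume "B \<noteq> 0"
      then show False using nonneg[of "- (A + 1) / (2 * B)"] True by (simp add: field_simps)
    qed
    then show ?thesis using True by simp
  next
    case False
    have "C \<ge> 0" unfolding C_def by simp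
    then have "C > 0" using False by simp
    then show ?thesis using nonneg[of "- B / C"] by (simp add: field_simps power2_eq_square)
  qed
  then show ?thesis by (simp add: A_def B_def C_def)
qed

definition L2_norm :: "real \<Rightarrow> (real \<times> real \<Rightarrow> real) \<Rightarrow> real" where
  "L2_norm L f = sqrt (LINT p|lebesgue_on (Omega L). (f p)\<^sup>2)"

lemma L2_norm_nonneg [simp]: "L2_norm L f \<ge> 0"
  by (simp add: L2_norm_def)

lemma L2_norm_power2: "(L2_norm L f)\<^sup>2 = (LINT p|lebesgue_on (Omega L). (f p)\<^sup>2)"
  by (simp add: L2_norm_def)

lemma abs_integral_mult_le:
  assumes "ess_bounded L f" "ess_bounded L g"
  shows "\<bar>LINT p|lebesgue_on (Omega L). f p * g p\<bar> \<le> L2_norm L f * L2_norm L g"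
  using real_sqrt_le_mono[OF Cauchy_Schwarz_ess_bounded[OF assms]]
  by (simp add: L2_norm_def real_sqrt_mult)

lemma L2_norm_triangle:
  assumes f: "ess_bounded L f" and g: "ess_bounded L g"
  shows "L2_norm L (\<lambda>p. f p + g p) \<le> L2_norm L f + L2_norm L g"
proof -
  have i: "integrable (lebesgue_on (Omega L)) (\<lambda>p. (f p)\<^sup>2)" "integrable (lebesgue_on (Omega L)) (\<lambda>p. (g p)\<^sup>2)"
    "integrable (lebesgue_on (Omega L)) (\<lambda>p. f p * g p)"
    using f g by (auto intro: ess_bounded_integrable)
  have "(L2_norm L (\<lambda>p. f p + g p))\<^sup>2 = (LINT p|lebesgue_on (Omega L). (f p)\<^sup>2 + 2 * (f p * g p) + (g p)\<^sup>2)"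
    unfolding L2_norm_power2 by (simp add: power2_eq_square algebra_simps)
  also have "\<dots> = (L2_norm L f)\<^sup>2 + 2 * (LINT p|lebesgue_on (Omega L). f p * g p) + (L2_norm L g)\<^sup>2"
    using i by (simp add: L2_norm_power2)
  also have "\<dots> \<le> (L2_norm L f)\<^sup>2 + 2 * (L2_norm L f * L2_norm L g) + (L2_norm L g)\<^sup>2"
    using abs_integral_mult_le[OF f g] by linarith
  also have "\<dots> = (L2_norm L f + L2_norm L g)\<^sup>2" by (simp add: power2_eq_square algebra_simps)
  finally show ?thesis by (rule power2_le_imp_le) simp
qed

text \<open>Injectivity excludes the case in which \<open>minv\<close> is an arbitrary value.\<close>

lemma minv_inverse:
  assumes A: "A \<in> carrier_mat n n" and inj: "\<And>v. v \<in> carrier_vec n \<Longrightarrow> A *\<^sub>v v = 0\<^sub>v n \<Longrightarrow> v = 0\<^sub>v n"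
  shows "minv A \<in> carrier_mat n n" "A * minv A = 1\<^sub>m n"
proof -
  have "det A \<noteq> 0" using det_0_iff_vec_prod_zero_field[OF A] inj by blast
  from det_non_zero_imp_unit[OF A this, of "()"] mat_inverse(1)[OF A, of "()"]
  obtain B where "mat_inverse A = Some B" by (cases "mat_inverse A") auto
  with mat_inverse(2)[OF A this]
  show "minv A \<in> carrier_mat n n" "A * minv A = 1\<^sub>m n" by (auto simp: minv_def)
qed

lemma minv_mult_vec:
  assumes A: "A \<in> carrier_mat n n" and inj: "\<And>v. v \<in> carrier_vec n \<Longrightarrow> A *\<^sub>v v = 0\<^sub>v n \<Longrightarrow> v = 0\<^sub>v n"
    and v: "v \<in> carrier_vec n"
  shows "minv A *\<^sub>v v \<in> carrier_vec n" "A *\<^sub>v (minv A *\<^sub>v v) = v"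
proof -
  note I = minv_inverse[OF A inj]
  show "minv A *\<^sub>v v \<in> carrier_vec n" using I(1) v by simp
  show "A *\<^sub>v (minv A *\<^sub>v v) = v" using assoc_mult_mat_vec[OF A I(1) v] I(2) v by simp
qed

lemma smult_mat_mult_vec:
  fixes A :: "real Matrix.mat"
  assumes "A \<in> carrier_mat n n" "v \<in> carrier_vec n"
  shows "(k \<cdot>\<^sub>m A) *\<^sub>v v = k \<cdot>\<^sub>v (A *\<^sub>v v)"
  using assms by (intro eq_vecI) (auto simp: scalar_prod_def sum_distrib_left mult.assoc)

text \<open>Turns a coercivity estimate, tested with the unknown itself, into a bound on its norm.\<close>

lemma square_le_mult_imp_le:
  fixes a b :: real
  assumes "3 / 4 * a\<^sup>2 \<le> b * a" "0 \<le> a" "0 \<le> b"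
  shows "a \<le> 4 / 3 * b"
  using assms by (cases "a = 0") (auto simp: power2_eq_square field_simps)

context fem
begin

abbreviation "nrm \<equiv> Mnorm L m \<phi>"
abbreviation "M \<equiv> Mmat L m \<phi>"
abbreviation "K \<equiv> Kmat L m \<phi>"
abbreviation "S \<equiv> Smat L m \<phi>"

lemma mat_carriers [simp]: "M \<in> carrier_mat N N" "K \<in> carrier_mat N N" "Rmat L khat m \<phi> \<in> carrier_mat N N" "S U \<in> carrier_mat N N"
  by (auto simp: Mmat_def Kmat_def Rmat_def Smat_def)

lemma Mnorm_eq: "V \<in> carrier_vec N \<Longrightarrow> nrm V = L2_norm L (fe V)"
  by (simp add: Mnorm_def scalar_prod_M L2_norm_def power2_eq_square)

lemma Mnorm_nonneg: "V \<in> carrier_vec N \<Longrightarrow> nrm V \<ge> 0"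
  by (simp add: Mnorm_eq)

lemma Mnorm_power2: "V \<in> carrier_vec N \<Longrightarrow> (nrm V)\<^sup>2 = (LINT p|\<mu>. (fe V p)\<^sup>2)"
  by (simp add: Mnorm_eq L2_norm_power2)

lemma fe_minus: "V \<in> carrier_vec N \<Longrightarrow> W \<in> carrier_vec N \<Longrightarrow> fe (V - W) p = fe V p - fe W p"
  by (simp add: fe_fun_def left_diff_distrib sum_subtractf)

lemma gx_minus: "V \<in> carrier_vec N \<Longrightarrow> W \<in> carrier_vec N \<Longrightarrow> gx (V - W) p = gx V p - gx W p"
  by (simp add: gx_def left_diff_distrib sum_subtractf)

lemma gy_minus: "V \<in> carrier_vec N \<Longrightarrow> W \<in> carrier_vec N \<Longrightarrow> gy (V - W) p = gy V p - gy W p"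
  by (simp add: gy_def left_diff_distrib sum_subtractf)

definition convection :: "real Matrix.vec \<Rightarrow> real Matrix.vec \<Rightarrow> real Matrix.vec \<Rightarrow> real" where
  "convection U V W = (LINT p|\<mu>. (gx U p * gy V p - gy U p * gx V p) * fe W p)"

lemma convection_self: "convection U V V = 0"
  unfolding convection_def by (rule integral_jacobian_zero)

text \<open>Bilinearity in the first two arguments, in the form in which differences of \<open>S(U) Y\<close> occur.\<close>

lemma convection_difference:
  assumes "U1 \<in> carrier_vec N" "U2 \<in> carrier_vec N" "V1 \<in> carrier_vec N" "V2 \<in> carrier_vec N"
  shows "convection U1 V1 W - convection U2 V2 W = convection U1 (V1 - V2) W + convection (U1 - U2) V2 W"
proof -
  have i: "integrable \<mu> (\<lambda>p. (gx U p * gy V p - gy U p * gx V p) * fe W p)" for U V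
    by (intro ess_bounded_integrable ess_bounded_mult ess_bounded_diff gx_ess_bounded gy_ess_bounded fe_ess_bounded)
  show ?thesis
    unfolding convection_def
    by (subst Bochner_Integration.integral_diff[symmetric, OF i i], subst Bochner_Integration.integral_add[symmetric, OF i i])
      (intro Bochner_Integration.integral_cong refl, simp add: assms gx_minus gy_minus algebra_simps)
qed

text \<open>The coefficients of the stream function that belongs to the vorticity \<open>W\<close>.\<close>

definition stream_vec :: "real Matrix.vec \<Rightarrow> real Matrix.vec" where
  "stream_vec W = minv K *\<^sub>v (M *\<^sub>v W)"

end

locale fem_shape_regular = fem +
  fixes \<rho> :: real
  assumes \<rho>: "\<rho> > 0" and balls: "\<And>T. T \<in> triangulation m \<Longrightarrow> \<exists>p. cball p (\<rho> * mesh_size m) \<subseteq> T"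
begin

definition rad :: real where "rad = \<rho> * mesh_size m"

lemma rad_pos: "rad > 0"
  using \<rho> mesh_size_pos[OF mesh] by (simp add: rad_def)

lemma ball_in_tri:
  assumes "t \<in> tri_idx m"
  obtains u v where "cball (u, v) rad \<subseteq> closed_tri m t"
proof -
  have "closed_tri m t \<in> triangulation m" using assms by (auto simp: triangulation_eq)
  then obtain p where "cball p rad \<subseteq> closed_tri m t" using balls unfolding rad_def by blast
  then show ?thesis using that by (cases p) auto
qed

text \<open>The energy on the disc inside a triangle is at most the total energy, so the global norm bounds the
  gradient on every single triangle. The constant \<open>4\<close> is \<open>\<surd>12\<close> rounded up.\<close>

lemma inverse_inequality:
  assumes t: "t \<in> tri_idx m" and V: "V \<in> carrier_vec N"
  shows "(cx V t)\<^sup>2 + (cy V t)\<^sup>2 \<le> (4 / rad\<^sup>2 * nrm V)\<^sup>2"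
proof -
  obtain u v where "cball (u, v) rad \<subseteq> closed_tri m t" using ball_in_tri[OF t] .
  from fe_energy_lower_bound[OF t rad_pos this, of V]
  have "rad\<^sup>2 * (c0 V t + cx V t * u + cy V t * v)\<^sup>2 + rad ^ 4 / 12 * ((cx V t)\<^sup>2 + (cy V t)\<^sup>2) \<le> (nrm V)\<^sup>2"
    by (simp add: Mnorm_power2[OF V])
  moreover have "0 \<le> rad\<^sup>2 * (c0 V t + cx V t * u + cy V t * v)\<^sup>2" by simp
  ultimately have "rad ^ 4 / 12 * ((cx V t)\<^sup>2 + (cy V t)\<^sup>2) \<le> (nrm V)\<^sup>2" by linarith
  then have "(cx V t)\<^sup>2 + (cy V t)\<^sup>2 \<le> 12 / rad ^ 4 * (nrm V)\<^sup>2"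
    using rad_pos by (simp add: field_simps)
  also have "\<dots> \<le> 16 / rad ^ 4 * (nrm V)\<^sup>2"
    using rad_pos by (intro mult_right_mono divide_right_mono) auto
  also have "\<dots> = (4 / rad\<^sup>2 * nrm V)\<^sup>2"
    by (simp add: power_mult_distrib power_divide flip: power_mult)
  finally show ?thesis .
qed

lemma AE_inverse_inequality:
  assumes V: "V \<in> carrier_vec N"
  shows "AE p in \<mu>. (gx V p)\<^sup>2 + (gy V p)\<^sup>2 \<le> (4 / rad\<^sup>2 * nrm V)\<^sup>2"
  using AE_gradient[of V] AE_in_open_tri[OF mesh]
proof eventually_elim
  case (elim p)
  then obtain t where t: "t \<in> tri_idx m" "gx V p = cx V t" "gy V p = cy V t" by blast
  then show ?case using inverse_inequality[OF t(1) V] by simp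
qed

text \<open>Coordinates are nodal values, and an affine function is controlled at every point of the square by
  its value and gradient at the centre of the disc. Positive definiteness of \<open>M\<close> and completeness of
  the balls both follow from this.\<close>

lemma coordinate_bound: "\<exists>D>0. \<forall>V\<in>carrier_vec N. \<forall>J<N. \<bar>V $ J\<bar> \<le> D * nrm V"
proof (rule exI[of _ "1 / rad + 8 * L / rad\<^sup>2"], intro conjI ballI allI impI)
  let ?D = "1 / rad + 8 * L / rad\<^sup>2"
  show "?D > 0" using rad_pos mesh_L_pos by (simp add: add_pos_nonneg)
  fix V :: "real Matrix.vec" and J assume V: "V \<in> carrier_vec N" and J: "J < N"
  define n where "n = npts m - 1"
  \<comment> \<open>The node is the lower left vertex of its cell.\<close>
  define t where "t = (J mod n + 1, J div n + 1, True)"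
  have "J < n * n" using J by (simp add: N1_def n_def power2_eq_square)
  then have "n > 0" by (cases n) auto
  then have "J mod n < n" "J div n < n" using \<open>J < n * n\<close> by (auto simp: less_mult_imp_div_less)
  moreover have "npts m = n + 1" using mesh_parts(3)[OF mesh] by (simp add: n_def)
  ultimately have t: "t \<in> tri_idx m" by (simp add: t_def tri_idx_def)
  have node: "node m J \<in> closed_tri m t"
    using vertices_in_closed_tri(1)[of "J mod n + 1" "J div n + 1"] by (simp add: node_def t_def n_def)
  have "fe V (node m J) = (\<Sum>I<N. if I = J then V $ I else 0)"
    unfolding fe_fun_def using basis J by (intro sum.cong) (auto simp: periodic_nodal_basis_def)
  then have VJ: "V $ J = c0 V t + cx V t * fst (node m J) + cy V t * snd (node m J)"
    using J fe_on_tri[OF t node, of V] by simp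
  obtain u v where uv: "cball (u, v) rad \<subseteq> closed_tri m t" using ball_in_tri[OF t] .
  have "(u, v) \<in> cbox (0, 0) (L, L)" "node m J \<in> cbox (0, 0) (L, L)"
    using subsetD[OF closed_tri_subset_square[OF mesh t]] subsetD[OF uv, of "(u, v)"] node rad_pos by auto
  then have dist: "\<bar>fst (node m J) - u\<bar> \<le> L" "\<bar>snd (node m J) - v\<bar> \<le> L"
    by (cases "node m J"; auto simp: mem_box Basis_prod_def)+
  from fe_energy_lower_bound[OF t rad_pos uv, of V]
  have "rad\<^sup>2 * (c0 V t + cx V t * u + cy V t * v)\<^sup>2 + rad ^ 4 / 12 * ((cx V t)\<^sup>2 + (cy V t)\<^sup>2) \<le> (nrm V)\<^sup>2"
    by (simp add: Mnorm_power2[OF V])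
  moreover have "0 \<le> rad ^ 4 / 12 * ((cx V t)\<^sup>2 + (cy V t)\<^sup>2)" by simp
  ultimately have "(rad * (c0 V t + cx V t * u + cy V t * v))\<^sup>2 \<le> (nrm V)\<^sup>2"
    unfolding power_mult_distrib by linarith
  then have "\<bar>rad * (c0 V t + cx V t * u + cy V t * v)\<bar> \<le> nrm V"
    using Mnorm_nonneg[OF V] abs_le_square_iff[of _ "nrm V"] by fastforce
  then have a: "\<bar>c0 V t + cx V t * u + cy V t * v\<bar> \<le> nrm V / rad"
    using rad_pos by (simp only: abs_mult abs_of_pos pos_le_divide_eq mult.commute[of _ rad])
  have nn: "0 \<le> 4 / rad\<^sup>2 * nrm V" using Mnorm_nonneg[OF V] by simp
  have "(cx V t)\<^sup>2 \<le> (4 / rad\<^sup>2 * nrm V)\<^sup>2" "(cy V t)\<^sup>2 \<le> (4 / rad\<^sup>2 * nrm V)\<^sup>2"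
    using inverse_inequality[OF t V] zero_le_power2[of "cx V t"] zero_le_power2[of "cy V t"] by linarith+
  then have c: "\<bar>cx V t\<bar> \<le> 4 / rad\<^sup>2 * nrm V" "\<bar>cy V t\<bar> \<le> 4 / rad\<^sup>2 * nrm V"
    using nn by (metis abs_le_square_iff abs_of_nonneg)+
  have "V $ J = (c0 V t + cx V t * u + cy V t * v) + cx V t * (fst (node m J) - u) + cy V t * (snd (node m J) - v)"
    unfolding VJ by (simp add: algebra_simps)
  also have "\<bar>\<dots>\<bar> \<le> \<bar>c0 V t + cx V t * u + cy V t * v\<bar> + \<bar>cx V t * (fst (node m J) - u)\<bar> + \<bar>cy V t * (snd (node m J) - v)\<bar>"
    by linarith
  also have "\<dots> \<le> nrm V / rad + (4 / rad\<^sup>2 * nrm V) * L + (4 / rad\<^sup>2 * nrm V) * L"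
    unfolding abs_mult by (intro add_mono a mult_mono c dist nn) auto
  also have "\<dots> = ?D * nrm V" by (simp add: field_simps)
  finally show "\<bar>V $ J\<bar> \<le> ?D * nrm V" .
qed

lemma Mnorm_zero_imp:
  assumes "V \<in> carrier_vec N" "nrm V = 0"
  shows "V = 0\<^sub>v N"
proof -
  obtain D where "\<And>V J. V \<in> carrier_vec N \<Longrightarrow> J < N \<Longrightarrow> \<bar>V $ J\<bar> \<le> D * nrm V" using coordinate_bound by blast
  from this[OF assms(1)] show ?thesis using assms by (intro eq_vecI) auto
qed

lemma scalar_prod_K_ge: 
  assumes "V \<in> carrier_vec N"
  shows "(nrm V)\<^sup>2 \<le> scalar_prod V (K *\<^sub>v V)"
  using scalar_prod_K[OF assms assms] Mnorm_power2[OF assms] by (simp add: flip: power2_eq_square)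

lemma K_injective:
  assumes "V \<in> carrier_vec N" "K *\<^sub>v V = 0\<^sub>v N"
  shows "V = 0\<^sub>v N"
  using scalar_prod_K_ge[OF assms(1)] assms by (intro Mnorm_zero_imp) auto

lemma stream_vec_carrier [simp]: "W \<in> carrier_vec N \<Longrightarrow> stream_vec W \<in> carrier_vec N"
  and K_stream: "W \<in> carrier_vec N \<Longrightarrow> K *\<^sub>v stream_vec W = M *\<^sub>v W"
  unfolding stream_vec_def
  using minv_mult_vec[OF mat_carriers(2) K_injective mult_mat_vec_carrier[OF mat_carriers(1)]] by auto

lemma stream_vec_minus:
  assumes "V \<in> carrier_vec N" "W \<in> carrier_vec N"
  shows "stream_vec (V - W) = stream_vec V - stream_vec W"
proof -
  have "minv K \<in> carrier_mat N N" by (rule minv_inverse(1)[OF mat_carriers(2) K_injective])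
  then show ?thesis unfolding stream_vec_def
    using mult_minus_distrib_mat_vec[OF mat_carriers(1) assms] mult_mat_vec_carrier[OF mat_carriers(1)] assms
    by (simp add: mult_minus_distrib_mat_vec[of _ N N])
qed

text \<open>Test \<open>K U = M W\<close> with \<open>U\<close> and complete the square:
  \<open>\<parallel>w\<parallel> \<parallel>u\<parallel> \<le> \<parallel>u\<parallel>\<^sup>2 + \<parallel>w\<parallel>\<^sup>2 / 4\<close>.\<close>

lemma gradient_stream_bound:
  assumes W: "W \<in> carrier_vec N"
  shows "(LINT p|\<mu>. (gx (stream_vec W) p)\<^sup>2) + (LINT p|\<mu>. (gy (stream_vec W) p)\<^sup>2) \<le> (nrm W / 2)\<^sup>2"
proof -
  let ?U = "stream_vec W"
  have U: "?U \<in> carrier_vec N" using W by simp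
  have "(nrm ?U)\<^sup>2 + ((LINT p|\<mu>. (gx ?U p)\<^sup>2) + (LINT p|\<mu>. (gy ?U p)\<^sup>2)) = scalar_prod ?U (K *\<^sub>v ?U)"
    by (simp add: scalar_prod_K[OF U U] Mnorm_power2[OF U] flip: power2_eq_square)
  also have "\<dots> = (LINT p|\<mu>. fe W p * fe ?U p)" unfolding K_stream[OF W] by (rule scalar_prod_M[OF W U])
  also have "\<dots> \<le> nrm W * nrm ?U"
    using abs_integral_mult_le[OF fe_ess_bounded fe_ess_bounded, of W ?U] by (simp add: Mnorm_eq W U)
  also have "\<dots> \<le> (nrm ?U)\<^sup>2 + (nrm W / 2)\<^sup>2"
    using zero_le_power2[of "nrm ?U - nrm W / 2"] by (simp add: power2_eq_square algebra_simps)
  finally show ?thesis by simp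
qed

text \<open>The gradient of the second argument is estimated in the maximum norm by the inverse inequality, that
  of the stream function in \<open>L\<^sup>2\<close> by the elliptic bound; the third argument enters through
  Cauchy-Schwarz.\<close>

lemma convection_bound:
  assumes W: "W \<in> carrier_vec N" and V: "V \<in> carrier_vec N" and X: "X \<in> carrier_vec N"
  shows "\<bar>convection (stream_vec W) V X\<bar> \<le> 2 / rad\<^sup>2 * nrm W * nrm V * nrm X"
proof -
  let ?U = "stream_vec W"
  define J where "J p = gx ?U p * gy V p - gy ?U p * gx V p" for p
  define c where "c = 4 / rad\<^sup>2 * nrm V"
  have c: "c \<ge> 0" using Mnorm_nonneg[OF V] by (simp add: c_def)
  have J: "ess_bounded L J" unfolding J_def[abs_def]
    by (intro ess_bounded_mult ess_bounded_diff gx_ess_bounded gy_ess_bounded)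
  note i = ess_bounded_integrable[OF ess_bounded_power2[OF gx_ess_bounded]] ess_bounded_integrable[OF ess_bounded_power2[OF gy_ess_bounded]]
  have "(LINT p|\<mu>. (J p)\<^sup>2) \<le> (LINT p|\<mu>. c\<^sup>2 * ((gx ?U p)\<^sup>2 + (gy ?U p)\<^sup>2))"
  proof (rule integral_mono_AE)
    show "integrable \<mu> (\<lambda>p. (J p)\<^sup>2)" using J by (auto intro: ess_bounded_integrable)
    show "integrable \<mu> (\<lambda>p. c\<^sup>2 * ((gx ?U p)\<^sup>2 + (gy ?U p)\<^sup>2))" using i by simp
    show "AE p in \<mu>. (J p)\<^sup>2 \<le> c\<^sup>2 * ((gx ?U p)\<^sup>2 + (gy ?U p)\<^sup>2)"
      using AE_inverse_inequality[OF V]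
    proof eventually_elim
      case (elim p)
      \<comment> \<open>Lagrange's identity for the determinant and the scalar product of two plane vectors.\<close>
      have "(J p)\<^sup>2 + (gx ?U p * gx V p + gy ?U p * gy V p)\<^sup>2 = ((gx V p)\<^sup>2 + (gy V p)\<^sup>2) * ((gx ?U p)\<^sup>2 + (gy ?U p)\<^sup>2)"
        unfolding J_def by (simp add: power2_eq_square algebra_simps)
      moreover have "\<dots> \<le> c\<^sup>2 * ((gx ?U p)\<^sup>2 + (gy ?U p)\<^sup>2)"
        using elim by (intro mult_right_mono) (auto simp: c_def)
      ultimately show ?case using zero_le_power2[of "gx ?U p * gx V p + gy ?U p * gy V p"] by linarith
    qed
  qed
  also have "\<dots> = c\<^sup>2 * ((LINT p|\<mu>. (gx ?U p)\<^sup>2) + (LINT p|\<mu>. (gy ?U p)\<^sup>2))" using i by simp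
  also have "\<dots> \<le> c\<^sup>2 * (nrm W / 2)\<^sup>2" by (intro mult_left_mono gradient_stream_bound W) simp
  finally have "(L2_norm L J)\<^sup>2 \<le> (c * (nrm W / 2))\<^sup>2" unfolding L2_norm_power2 power_mult_distrib .
  then have "L2_norm L J \<le> c * (nrm W / 2)"
    by (rule power2_le_imp_le) (use c Mnorm_nonneg[OF W] in auto)
  then have "L2_norm L J * L2_norm L (fe X) \<le> c * (nrm W / 2) * nrm X"
    unfolding Mnorm_eq[OF X] by (rule mult_right_mono) simp
  moreover have "\<bar>convection ?U V X\<bar> \<le> L2_norm L J * L2_norm L (fe X)"
    unfolding convection_def J_def[symmetric] by (rule abs_integral_mult_le[OF J fe_ess_bounded])
  ultimately show ?thesis by (simp add: c_def field_simps)
qed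

lemma Mnorm_triangle:
  assumes "V \<in> carrier_vec N" "W \<in> carrier_vec N"
  shows "nrm V \<le> nrm W + nrm (V - W)"
proof -
  have "L2_norm L (\<lambda>p. fe W p + fe (V - W) p) \<le> L2_norm L (fe W) + L2_norm L (fe (V - W))"
    by (intro L2_norm_triangle fe_ess_bounded)
  moreover have "(\<lambda>p. fe W p + fe (V - W) p) = fe V" using assms by (simp add: fe_minus)
  ultimately show ?thesis using assms by (simp add: Mnorm_eq)
qed

section \<open>The fixed point map\<close>

lemma Bmat_carrier [simp]: "Bmat L khat m \<phi> \<tau> \<in> carrier_mat N N"
  unfolding Bmat_def using minv_inverse(1)[OF mat_carriers(2) K_injective]
  by (intro minus_carrier_mat smult_carrier_mat mult_carrier_mat[of _ N N] mat_carriers)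

lemma scalar_prod_B:
  assumes X: "X \<in> carrier_vec N" and Y: "Y \<in> carrier_vec N"
  shows "scalar_prod X (Bmat L khat m \<phi> \<tau> *\<^sub>v Y) =
    scalar_prod X (M *\<^sub>v Y) - \<tau> * khat * (LINT p|\<mu>. gy (stream_vec Y) p * fe X p)"
proof -
  let ?R = "Rmat L khat m \<phi>"
  note mK = minv_inverse(1)[OF mat_carriers(2) K_injective]
  have MY: "M *\<^sub>v Y \<in> carrier_vec N" using mat_carriers(1) Y by (rule mult_mat_vec_carrier)
  have RK: "?R * minv K \<in> carrier_mat N N" using mK mat_carriers(3) by (intro mult_carrier_mat)
  have RKM: "?R * minv K * M \<in> carrier_mat N N" by (rule mult_carrier_mat[OF RK mat_carriers(1)])
  have RS: "?R *\<^sub>v stream_vec Y \<in> carrier_vec N" by (rule mult_mat_vec_carrier[OF mat_carriers(3) stream_vec_carrier[OF Y]])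
  have "Bmat L khat m \<phi> \<tau> *\<^sub>v Y = M *\<^sub>v Y - \<tau> \<cdot>\<^sub>v ((?R * minv K * M) *\<^sub>v Y)"
    unfolding Bmat_def using minus_mult_distrib_mat_vec[OF mat_carriers(1) smult_carrier_mat[OF RKM] Y]
    by (simp add: smult_mat_mult_vec[OF RKM Y])
  also have "(?R * minv K * M) *\<^sub>v Y = ?R *\<^sub>v stream_vec Y"
    unfolding stream_vec_def using assoc_mult_mat_vec[OF RK mat_carriers(1) Y] assoc_mult_mat_vec[OF mat_carriers(3) mK MY]
    by simp
  finally have "scalar_prod X (Bmat L khat m \<phi> \<tau> *\<^sub>v Y) = scalar_prod X (M *\<^sub>v Y) - scalar_prod X (\<tau> \<cdot>\<^sub>v (?R *\<^sub>v stream_vec Y))"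
    using scalar_prod_minus_distrib[OF X MY smult_carrier_vec[THEN iffD2, OF RS]] by simp
  also have "scalar_prod X (\<tau> \<cdot>\<^sub>v (?R *\<^sub>v stream_vec Y)) = \<tau> * (khat * (LINT p|\<mu>. gy (stream_vec Y) p * fe X p))"
    using scalar_prod_R[OF stream_vec_carrier[OF Y] X] X RS by (simp add: scalar_prod_smult_distrib[OF X RS])
  finally show ?thesis by simp
qed

text \<open>The perturbation is at most \<open>\<tau> \<bar>khat\<bar> \<parallel>u\<^sub>y\<parallel> \<parallel>w\<parallel> \<le> 1/2 \<cdot> 1/2 \<cdot> \<parallel>w\<parallel>\<^sup>2\<close>, where
  \<open>w\<close> is the function of \<open>X\<close> and \<open>u\<close> its stream function.\<close>

lemma B_coercive:
  assumes X: "X \<in> carrier_vec N" and \<tau>: "0 < \<tau>" "\<tau> * \<bar>khat\<bar> \<le> 1 / 2"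
  shows "3 / 4 * (nrm X)\<^sup>2 \<le> scalar_prod X (Bmat L khat m \<phi> \<tau> *\<^sub>v X)"
proof -
  have "(L2_norm L (gy (stream_vec X)))\<^sup>2 \<le> (nrm X / 2)\<^sup>2"
  proof -
    have "0 \<le> (LINT p|\<mu>. (gx (stream_vec X) p)\<^sup>2)" by simp
    then show ?thesis using gradient_stream_bound[OF X] unfolding L2_norm_power2 by linarith
  qed
  then have gy: "L2_norm L (gy (stream_vec X)) \<le> nrm X / 2"
    by (rule power2_le_imp_le) (use Mnorm_nonneg[OF X] in simp)
  have "\<bar>LINT p|\<mu>. gy (stream_vec X) p * fe X p\<bar> \<le> L2_norm L (gy (stream_vec X)) * nrm X"
    unfolding Mnorm_eq[OF X] by (rule abs_integral_mult_le[OF gy_ess_bounded fe_ess_bounded])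
  also have "\<dots> \<le> nrm X / 2 * nrm X" by (rule mult_right_mono[OF gy Mnorm_nonneg[OF X]])
  finally have i: "\<bar>LINT p|\<mu>. gy (stream_vec X) p * fe X p\<bar> \<le> (nrm X)\<^sup>2 / 2" by (simp add: power2_eq_square)
  have "\<bar>\<tau> * khat * (LINT p|\<mu>. gy (stream_vec X) p * fe X p)\<bar> = (\<tau> * \<bar>khat\<bar>) * \<bar>LINT p|\<mu>. gy (stream_vec X) p * fe X p\<bar>"
    using \<tau>(1) by (simp add: abs_mult)
  also have "\<dots> \<le> 1 / 2 * ((nrm X)\<^sup>2 / 2)" using \<tau> by (intro mult_mono i) auto
  finally show ?thesis
    using scalar_prod_M[OF X X] Mnorm_power2[OF X] scalar_prod_B[OF X X, of khat \<tau>]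
    by (simp add: abs_le_iff flip: power2_eq_square)
qed

lemma B_injective:
  assumes X: "X \<in> carrier_vec N" and \<tau>: "0 < \<tau>" "\<tau> * \<bar>khat\<bar> \<le> 1 / 2"
    and 0: "Bmat L khat m \<phi> \<tau> *\<^sub>v X = 0\<^sub>v N"
  shows "X = 0\<^sub>v N"
  using B_coercive[OF X \<tau>] X 0 by (intro Mnorm_zero_imp) auto

lemma G_carrier:
  assumes \<tau>: "0 < \<tau>" "\<tau> * \<bar>khat\<bar> \<le> 1 / 2" and Z: "Z \<in> carrier_vec N" and Y: "Y \<in> carrier_vec N"
  shows "G L khat m \<phi> \<tau> Z Y \<in> carrier_vec N"
    and "Bmat L khat m \<phi> \<tau> *\<^sub>v G L khat m \<phi> \<tau> Z Y = M *\<^sub>v Z - \<tau> \<cdot>\<^sub>v (S (stream_vec Y) *\<^sub>v Y)"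
proof -
  have "M *\<^sub>v Z - \<tau> \<cdot>\<^sub>v (S (stream_vec Y) *\<^sub>v Y) \<in> carrier_vec N"
    by (intro minus_carrier_vec smult_carrier_vec[THEN iffD2] mult_mat_vec_carrier[OF mat_carriers(1) Z] mult_mat_vec_carrier[OF mat_carriers(4) Y])
  from minv_mult_vec(1,2)[OF Bmat_carrier B_injective[OF _ \<tau>] this]
  show "G L khat m \<phi> \<tau> Z Y \<in> carrier_vec N"
    "Bmat L khat m \<phi> \<tau> *\<^sub>v G L khat m \<phi> \<tau> Z Y = M *\<^sub>v Z - \<tau> \<cdot>\<^sub>v (S (stream_vec Y) *\<^sub>v Y)"
    by (simp_all add: G_def stream_vec_def)
qed

lemma scalar_prod_BG:
  assumes \<tau>: "0 < \<tau>" "\<tau> * \<bar>khat\<bar> \<le> 1 / 2" and Z: "Z \<in> carrier_vec N" and Y: "Y \<in> carrier_vec N" and X: "X \<in> carrier_vec N"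
  shows "scalar_prod X (Bmat L khat m \<phi> \<tau> *\<^sub>v G L khat m \<phi> \<tau> Z Y) =
    scalar_prod X (M *\<^sub>v Z) - \<tau> * convection (stream_vec Y) Y X"
proof -
  have SY: "S (stream_vec Y) *\<^sub>v Y \<in> carrier_vec N" by (rule mult_mat_vec_carrier[OF mat_carriers(4) Y])
  have "scalar_prod X (Bmat L khat m \<phi> \<tau> *\<^sub>v G L khat m \<phi> \<tau> Z Y) =
    scalar_prod X (M *\<^sub>v Z) - scalar_prod X (\<tau> \<cdot>\<^sub>v (S (stream_vec Y) *\<^sub>v Y))"
    unfolding G_carrier(2)[OF \<tau> Z Y]
    using scalar_prod_minus_distrib[OF X mult_mat_vec_carrier[OF mat_carriers(1) Z] smult_carrier_vec[THEN iffD2, OF SY]] by simp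
  also have "scalar_prod X (\<tau> \<cdot>\<^sub>v (S (stream_vec Y) *\<^sub>v Y)) = \<tau> * convection (stream_vec Y) Y X"
    using scalar_prod_S[OF Y X, of "stream_vec Y"] by (simp add: scalar_prod_smult_distrib[OF X SY] convection_def)
  finally show ?thesis .
qed

lemma scalar_prod_M_le:
  assumes "X \<in> carrier_vec N" "Z \<in> carrier_vec N"
  shows "scalar_prod X (M *\<^sub>v Z) \<le> nrm X * nrm Z"
  using abs_integral_mult_le[OF fe_ess_bounded fe_ess_bounded, of Z X] assms
  by (simp add: scalar_prod_M Mnorm_eq mult.commute)

text \<open>Test the equation for the difference \<open>X\<close> of the two images with \<open>X\<close> itself; the
  factor \<open>4 / 3\<close> inverts the coercivity constant of \<open>B\<close>.\<close>

lemma G_lipschitz: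
  assumes \<tau>: "0 < \<tau>" "\<tau> * \<bar>khat\<bar> \<le> 1 / 2" and Z: "Z \<in> carrier_vec N"
    and Y1: "Y1 \<in> carrier_vec N" and Y2: "Y2 \<in> carrier_vec N"
  shows "nrm (G L khat m \<phi> \<tau> Z Y1 - G L khat m \<phi> \<tau> Z Y2) \<le> 4 / 3 * (\<tau> * (2 / rad\<^sup>2) * (nrm Y1 + nrm Y2) * nrm (Y1 - Y2))"
proof (rule square_le_mult_imp_le)
  let ?B = "Bmat L khat m \<phi> \<tau>"
  define G1 where "G1 = G L khat m \<phi> \<tau> Z Y1"
  define G2 where "G2 = G L khat m \<phi> \<tau> Z Y2"
  define X where "X = G1 - G2"
  have G12: "G1 \<in> carrier_vec N" "G2 \<in> carrier_vec N" using G_carrier(1)[OF \<tau> Z] Y1 Y2 by (auto simp: G1_def G2_def)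
  then have X: "X \<in> carrier_vec N" by (simp add: X_def)
  have Y: "Y1 - Y2 \<in> carrier_vec N" using Y1 Y2 by simp
  note st = stream_vec_carrier[OF Y1] stream_vec_carrier[OF Y2]
  have "3 / 4 * (nrm X)\<^sup>2 \<le> scalar_prod X (?B *\<^sub>v X)" by (rule B_coercive[OF X \<tau>])
  also have "\<dots> = scalar_prod X (?B *\<^sub>v G1) - scalar_prod X (?B *\<^sub>v G2)"
    using mult_minus_distrib_mat_vec[OF Bmat_carrier G12, of khat \<tau>]
      scalar_prod_minus_distrib[OF X mult_mat_vec_carrier[OF Bmat_carrier G12(1)] mult_mat_vec_carrier[OF Bmat_carrier G12(2)], of khat \<tau> khat \<tau>]
    by (simp add: X_def)
  also have "\<dots> = - \<tau> * (convection (stream_vec Y1) Y1 X - convection (stream_vec Y2) Y2 X)"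
    unfolding G1_def G2_def scalar_prod_BG[OF \<tau> Z Y1 X] scalar_prod_BG[OF \<tau> Z Y2 X] by (simp add: algebra_simps)
  also have "\<dots> = - \<tau> * (convection (stream_vec Y1) (Y1 - Y2) X + convection (stream_vec (Y1 - Y2)) Y2 X)"
    unfolding stream_vec_minus[OF Y1 Y2] convection_difference[OF st Y1 Y2] ..
  also have "\<dots> \<le> \<tau> * (2 / rad\<^sup>2 * nrm Y1 * nrm (Y1 - Y2) * nrm X + 2 / rad\<^sup>2 * nrm (Y1 - Y2) * nrm Y2 * nrm X)"
  proof -
    have "- (convection (stream_vec Y1) (Y1 - Y2) X + convection (stream_vec (Y1 - Y2)) Y2 X) \<le> 2 / rad\<^sup>2 * nrm Y1 * nrm (Y1 - Y2) * nrm X + 2 / rad\<^sup>2 * nrm (Y1 - Y2) * nrm Y2 * nrm X"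
      using convection_bound[OF Y1 Y X] convection_bound[OF Y Y2 X] by linarith
    from mult_left_mono[OF this, of \<tau>] show ?thesis
      using \<tau>(1) by (simp only: mult_minus_left mult_minus_right less_imp_le)
  qed
  also have "\<dots> = (\<tau> * (2 / rad\<^sup>2) * (nrm Y1 + nrm Y2) * nrm (Y1 - Y2)) * nrm X"
    by (simp add: algebra_simps add_divide_distrib)
  finally show "3 / 4 * (nrm (G L khat m \<phi> \<tau> Z Y1 - G L khat m \<phi> \<tau> Z Y2))\<^sup>2
      \<le> \<tau> * (2 / rad\<^sup>2) * (nrm Y1 + nrm Y2) * nrm (Y1 - Y2) * nrm (G L khat m \<phi> \<tau> Z Y1 - G L khat m \<phi> \<tau> Z Y2)"
    by (simp add: X_def G1_def G2_def)
  show "0 \<le> nrm (G L khat m \<phi> \<tau> Z Y1 - G L khat m \<phi> \<tau> Z Y2)"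
    using Mnorm_nonneg[OF X] by (simp add: X_def G1_def G2_def)
  show "0 \<le> \<tau> * (2 / rad\<^sup>2) * (nrm Y1 + nrm Y2) * nrm (Y1 - Y2)"
    using \<tau>(1) Mnorm_nonneg Y1 Y2 Y by (intro mult_nonneg_nonneg add_nonneg_nonneg) auto
qed

text \<open>Test the equation for \<open>G(Y)\<close> with \<open>G(Y)\<close>.\<close>

lemma G_growth:
  assumes \<tau>: "0 < \<tau>" "\<tau> * \<bar>khat\<bar> \<le> 1 / 2" and Z: "Z \<in> carrier_vec N" and Y: "Y \<in> carrier_vec N"
  shows "nrm (G L khat m \<phi> \<tau> Z Y) \<le> 4 / 3 * (nrm Z + \<tau> * (2 / rad\<^sup>2) * (nrm Y)\<^sup>2)"
proof (rule square_le_mult_imp_le)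
  let ?X = "G L khat m \<phi> \<tau> Z Y"
  have X: "?X \<in> carrier_vec N" by (rule G_carrier(1)[OF \<tau> Z Y])
  have "3 / 4 * (nrm ?X)\<^sup>2 \<le> scalar_prod ?X (M *\<^sub>v Z) - \<tau> * convection (stream_vec Y) Y ?X"
    using B_coercive[OF X \<tau>] scalar_prod_BG[OF \<tau> Z Y X] by simp
  also have "\<dots> \<le> nrm ?X * nrm Z + \<tau> * (2 / rad\<^sup>2 * nrm Y * nrm Y * nrm ?X)"
  proof -
    have "- convection (stream_vec Y) Y ?X \<le> 2 / rad\<^sup>2 * nrm Y * nrm Y * nrm ?X"
      using convection_bound[OF Y Y X] by linarith
    from mult_left_mono[OF this, of \<tau>] show ?thesis using \<tau>(1) scalar_prod_M_le[OF X Z] by simp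
  qed
  also have "\<dots> = (nrm Z + \<tau> * (2 / rad\<^sup>2) * (nrm Y)\<^sup>2) * nrm ?X" by (simp add: algebra_simps power2_eq_square)
  finally show "3 / 4 * (nrm ?X)\<^sup>2 \<le> (nrm Z + \<tau> * (2 / rad\<^sup>2) * (nrm Y)\<^sup>2) * nrm ?X" .
qed (use \<tau>(1) Mnorm_nonneg[OF Z] Mnorm_nonneg[OF G_carrier(1)[OF \<tau> Z Y]] in auto)

text \<open>Test the fixed point equation with \<open>Y\<close>; the convection term drops out by skew symmetry, so the
  bound is linear in \<open>Z\<close> although the equation is quadratic in \<open>Y\<close>.\<close>

lemma fixed_point_bound:
  assumes \<tau>: "0 < \<tau>" "\<tau> * \<bar>khat\<bar> \<le> 1 / 2" and Z: "Z \<in> carrier_vec N" and Y: "Y \<in> carrier_vec N"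
    and fp: "Y = G L khat m \<phi> \<tau> Z Y"
  shows "nrm Y \<le> 4 / 3 * nrm Z"
proof (rule square_le_mult_imp_le)
  have "3 / 4 * (nrm Y)\<^sup>2 \<le> scalar_prod Y (M *\<^sub>v Z)"
    using B_coercive[OF Y \<tau>] scalar_prod_BG[OF \<tau> Z Y Y] fp[symmetric] by (simp add: convection_self)
  also have "\<dots> \<le> nrm Y * nrm Z" by (rule scalar_prod_M_le[OF Y Z])
  finally show "3 / 4 * (nrm Y)\<^sup>2 \<le> nrm Z * nrm Y" by (simp add: mult.commute)
qed (use Mnorm_nonneg Y Z in auto)

text \<open>The distance of the mass norm, defined for all vectors through their functions, since a metric space
  must be symmetric and nonnegative off its carrier too.\<close>

definition Mdist :: "real Matrix.vec \<Rightarrow> real Matrix.vec \<Rightarrow> real" where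
  "Mdist V W = L2_norm L (\<lambda>p. fe V p - fe W p)"

lemma Mdist_eq: "V \<in> carrier_vec N \<Longrightarrow> W \<in> carrier_vec N \<Longrightarrow> Mdist V W = nrm (V - W)"
  by (simp add: Mdist_def Mnorm_eq L2_norm_def fe_minus)

lemma Metric_space_Mdist:
  assumes "A \<subseteq> carrier_vec N"
  shows "Metric_space A Mdist"
proof
  show "0 \<le> Mdist V W" for V W by (simp add: Mdist_def)
  show "Mdist V W = Mdist W V" for V W by (simp add: Mdist_def L2_norm_def power2_commute)
  show "Mdist V W = 0 \<longleftrightarrow> V = W" if "V \<in> A" "W \<in> A" for V W
  proof -
    have VW: "V \<in> carrier_vec N" "W \<in> carrier_vec N" using that assms by auto
    show ?thesis
    proof
      assume "Mdist V W = 0"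
      then have "V - W = 0\<^sub>v N" using VW by (intro Mnorm_zero_imp) (auto simp: Mdist_eq)
      then have "(V - W) $ i = 0" if "i < N" for i using that by simp
      then show "V = W" using VW by (intro eq_vecI) auto
    qed (simp add: Mdist_def L2_norm_def)
  qed
  show "Mdist U W \<le> Mdist U V + Mdist V W" for U V W
  proof -
    have "L2_norm L (\<lambda>p. (fe U p - fe V p) + (fe V p - fe W p)) \<le> Mdist U V + Mdist V W"
      unfolding Mdist_def by (intro L2_norm_triangle ess_bounded_diff fe_ess_bounded)
    then show ?thesis by (simp add: Mdist_def)
  qed
qed

lemma Mdist_tendsto_zero:
  assumes V: "\<And>k. V k \<in> carrier_vec N" and W: "W \<in> carrier_vec N"
    and lim: "\<And>J. J < N \<Longrightarrow> (\<lambda>k. V k $ J) \<longlonglongrightarrow> W $ J"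
  shows "(\<lambda>k. Mdist (V k) W) \<longlonglongrightarrow> 0"
proof -
  have eq: "Mdist (V k) W = sqrt (\<Sum>j<N. \<Sum>i<N. (V k - W) $ j * (V k - W) $ i * ip L (\<phi> i) (\<phi> j))" for k
  proof -
    have VW: "V k - W \<in> carrier_vec N" using V W by simp
    show ?thesis unfolding Mdist_eq[OF V W] Mnorm_def
      using scalar_prod_mat_mult_vec[OF VW VW] by (simp add: Mmat_def)
  qed
  have "(\<lambda>k. (V k - W) $ J) \<longlonglongrightarrow> 0" if "J < N" for J
  proof -
    have "(\<lambda>k. V k $ J - W $ J) \<longlonglongrightarrow> W $ J - W $ J" by (intro tendsto_diff lim that tendsto_const)
    then show ?thesis using V W that by simp
  qed
  then have "(\<lambda>k. sqrt (\<Sum>j<N. \<Sum>i<N. (V k - W) $ j * (V k - W) $ i * ip L (\<phi> i) (\<phi> j))) \<longlonglongrightarrow> sqrt (\<Sum>j<N. \<Sum>i<N. 0 * 0 * ip L (\<phi> i) (\<phi> j))"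
    by (intro tendsto_intros) auto
  then show ?thesis by (simp add: eq)
qed

text \<open>A Cauchy sequence converges coordinatewise by \<open>coordinate_bound\<close>, and coordinatewise convergence
  implies convergence in the mass norm.\<close>

lemma mcomplete_ball:
  assumes A: "A = {Y \<in> carrier_vec N. nrm Y \<le> C}"
  shows "Metric_space.mcomplete A Mdist"
proof -
  interpret Metric_space A Mdist by (rule Metric_space_Mdist) (simp add: A)
  obtain D where D: "D > 0" "\<And>V J. V \<in> carrier_vec N \<Longrightarrow> J < N \<Longrightarrow> \<bar>V $ J\<bar> \<le> D * nrm V" using coordinate_bound by blast
  show ?thesis unfolding mcomplete_def
  proof (intro allI impI)
    fix \<sigma> assume "MCauchy \<sigma>"
    then have \<sigma>: "\<And>k. \<sigma> k \<in> A" and cau: "\<And>e. e > 0 \<Longrightarrow> \<exists>n0. \<forall>n n'. n0 \<le> n \<longrightarrow> n0 \<le> n' \<longrightarrow> Mdist (\<sigma> n) (\<sigma> n') < e"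
      unfolding MCauchy_def by auto
    have \<sigma>c: "\<sigma> k \<in> carrier_vec N" for k using \<sigma> A by auto
    have "Cauchy (\<lambda>k. \<sigma> k $ J)" if J: "J < N" for J
    proof (rule metric_CauchyI)
      fix e :: real assume "e > 0"
      then obtain n0 where n0: "\<And>n n'. n0 \<le> n \<Longrightarrow> n0 \<le> n' \<Longrightarrow> Mdist (\<sigma> n) (\<sigma> n') < e / D"
        using cau[of "e / D"] D(1) by auto
      show "\<exists>M. \<forall>m\<ge>M. \<forall>n\<ge>M. dist (\<sigma> m $ J) (\<sigma> n $ J) < e"
      proof (intro exI allI impI)
        fix n n' assume "n0 \<le> n" "n0 \<le> n'"
        from n0[OF this] have "nrm (\<sigma> n - \<sigma> n') < e / D" by (simp add: Mdist_eq \<sigma>c)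
        then have "D * nrm (\<sigma> n - \<sigma> n') < e" using D(1) by (simp add: field_simps)
        moreover have "\<bar>(\<sigma> n - \<sigma> n') $ J\<bar> \<le> D * nrm (\<sigma> n - \<sigma> n')" using \<sigma>c J by (intro D(2)) auto
        moreover have "(\<sigma> n - \<sigma> n') $ J = \<sigma> n $ J - \<sigma> n' $ J" using \<sigma>c[of n'] J by simp
        ultimately show "dist (\<sigma> n $ J) (\<sigma> n' $ J) < e" by (simp add: dist_real_def)
      qed
    qed
    then have conv: "\<And>J. J < N \<Longrightarrow> convergent (\<lambda>k. \<sigma> k $ J)" using Cauchy_convergent by blast
    define Y where "Y = Matrix.vec N (\<lambda>J. lim (\<lambda>k. \<sigma> k $ J))"
    have Y: "Y \<in> carrier_vec N" by (simp add: Y_def)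
    have lim: "(\<lambda>k. Mdist (\<sigma> k) Y) \<longlonglongrightarrow> 0"
    proof (rule Mdist_tendsto_zero[OF \<sigma>c Y])
      show "(\<lambda>k. \<sigma> k $ J) \<longlonglongrightarrow> Y $ J" if "J < N" for J
        using conv[OF that] that by (simp add: Y_def convergent_LIMSEQ_iff)
    qed
    have "nrm Y \<le> C"
    proof (rule tendsto_upperbound)
      show "(\<lambda>k. nrm Y - Mdist (\<sigma> k) Y) \<longlonglongrightarrow> nrm Y" using tendsto_diff[OF tendsto_const lim, of "nrm Y"] by simp
      have "nrm Y - Mdist (\<sigma> k) Y \<le> C" for k
        using Mnorm_triangle[OF Y \<sigma>c[of k]] commute[of Y "\<sigma> k"] Mdist_eq[OF Y \<sigma>c[of k]] \<sigma>[of k] A by auto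
      then show "\<forall>\<^sub>F k in sequentially. nrm Y - Mdist (\<sigma> k) Y \<le> C" by simp
    qed simp
    then have "Y \<in> A" using Y A by simp
    moreover have "\<exists>n0. \<forall>n\<ge>n0. \<sigma> n \<in> A \<and> Mdist (\<sigma> n) Y < e" if "e > 0" for e
      using order_tendstoD(2)[OF lim that] \<sigma> by (auto simp: eventually_sequentially)
    ultimately have "limitin mtopology \<sigma> Y sequentially" by (simp add: limit_metric_sequentially)
    then show "\<exists>x. limitin mtopology \<sigma> x sequentially" by blast
  qed
qed

text \<open>A zero \<open>khat\<close> or \<open>C\<^sub>Z\<close> makes the corresponding quotient infinite, but then the conclusion is
  trivial.\<close>

lemma tau_boundD:
  assumes \<tau>: "0 < \<tau>" "ereal \<tau> \<le> tau_bound L khat m \<phi> (4 / \<rho>\<^sup>2) Z" and Z: "Z \<in> carrier_vec N"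
  shows "\<tau> * \<bar>khat\<bar> \<le> 1 / 2" "\<tau> * (2 / rad\<^sup>2) * CZ L m \<phi> Z \<le> 1 / 16"
proof -
  have C0: "CZ L m \<phi> Z \<ge> 0" using Mnorm_nonneg[OF Z] by (simp add: CZ_def)
  have h: "mesh_size m > 0" by (rule mesh_size_pos[OF mesh])
  have mono: "ereal \<tau> \<le> ereal (1 / 8) * a" if "ereal \<tau> \<le> ereal (1 / 8) * min a b" for a b :: ereal
    using that by (rule order_trans) (intro ereal_mult_left_mono, auto)
  have mono': "ereal \<tau> \<le> ereal (1 / 8) * b" if "ereal \<tau> \<le> ereal (1 / 8) * min a b" for a b :: ereal
    using that by (rule order_trans) (intro ereal_mult_left_mono, auto)
  have t1: "ereal \<tau> \<le> ereal (1 / 8) * (ereal 4 / ereal \<bar>khat\<bar>)"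
    and t2: "ereal \<tau> \<le> ereal (1 / 8) * (ereal ((mesh_size m)\<^sup>2) / ereal (4 / \<rho>\<^sup>2 * CZ L m \<phi> Z))"
    using \<tau>(2) mono mono' unfolding tau_bound_def by blast+
  show "\<tau> * \<bar>khat\<bar> \<le> 1 / 2"
  proof (cases "khat = 0")
    case False
    then show ?thesis using t1 by (simp add: field_simps)
  qed simp
  show "\<tau> * (2 / rad\<^sup>2) * CZ L m \<phi> Z \<le> 1 / 16"
  proof (cases "CZ L m \<phi> Z = 0")
    case False
    then have "CZ L m \<phi> Z > 0" using C0 by simp
    then show ?thesis using t2 h \<rho> by (simp add: rad_def field_simps power2_eq_square)
  qed simp
qed

text \<open>With \<open>\<tau> (2 / rad\<^sup>2) C\<^sub>Z \<le> 1/16\<close> the Lipschitz constant on the ball is at most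
  \<open>4/3 \<cdot> 1/8 = 1/6\<close>, and the image of the ball has radius at most
  \<open>4/3 \<cdot> (1 + 1/8) \<parallel>Z\<parallel> = 3/2 \<parallel>Z\<parallel> \<le> C\<^sub>Z\<close>.\<close>

lemma contraction_and_unique_fixed_point:
  assumes \<tau>: "0 < \<tau>" "ereal \<tau> \<le> tau_bound L khat m \<phi> (4 / \<rho>\<^sup>2) Z" and Z: "Z \<in> carrier_vec N"
  shows "\<forall>Y1\<in>ballN L m \<phi> Z. \<forall>Y2\<in>ballN L m \<phi> Z.
            nrm (G L khat m \<phi> \<tau> Z Y1 - G L khat m \<phi> \<tau> Z Y2) \<le> 1 / 2 * nrm (Y1 - Y2)"
    and "\<exists>!Y. Y \<in> carrier_vec N \<and> Y = G L khat m \<phi> \<tau> Z Y"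
proof -
  let ?G = "G L khat m \<phi> \<tau> Z" and ?A = "ballN L m \<phi> Z"
  have \<tau>k: "\<tau> * \<bar>khat\<bar> \<le> 1 / 2" and \<tau>C: "\<tau> * (2 / rad\<^sup>2) * CZ L m \<phi> Z \<le> 1 / 16"
    using tau_boundD[OF \<tau> Z] by auto
  have CZ: "CZ L m \<phi> Z = 2 * nrm Z" by (simp add: CZ_def)
  have A: "Y \<in> carrier_vec N" "nrm Y \<le> CZ L m \<phi> Z" if "Y \<in> ?A" for Y using that by (auto simp: ballN_def)
  have contr: "nrm (?G Y1 - ?G Y2) \<le> 1 / 2 * nrm (Y1 - Y2)" if "Y1 \<in> ?A" "Y2 \<in> ?A" for Y1 Y2
  proof -
    have n: "0 \<le> nrm (Y1 - Y2)" using A that by (intro Mnorm_nonneg) auto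
    have "\<tau> * (2 / rad\<^sup>2) * (nrm Y1 + nrm Y2) \<le> \<tau> * (2 / rad\<^sup>2) * (2 * CZ L m \<phi> Z)"
      using A(2)[OF that(1)] A(2)[OF that(2)] \<tau>(1) by (intro mult_left_mono) auto
    then have "\<tau> * (2 / rad\<^sup>2) * (nrm Y1 + nrm Y2) \<le> 1 / 8" using \<tau>C by linarith
    have "4 / 3 * a \<le> 1 / 2 * b" if "a \<le> 1 / 8 * b" "0 \<le> b" for a b :: real using that by linarith
    from this[OF mult_right_mono[OF \<open>_ \<le> 1 / 8\<close> n] n]
    show ?thesis using G_lipschitz[OF \<tau>(1) \<tau>k Z A(1)[OF that(1)] A(1)[OF that(2)]] by linarith
  qed
  then show "\<forall>Y1\<in>?A. \<forall>Y2\<in>?A. nrm (?G Y1 - ?G Y2) \<le> 1 / 2 * nrm (Y1 - Y2)" by blast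
  have self: "?G Y \<in> ?A" if Y: "Y \<in> ?A" for Y
  proof -
    have n: "0 \<le> nrm Y" using A Y by (intro Mnorm_nonneg) auto
    have "\<tau> * (2 / rad\<^sup>2) * (nrm Y)\<^sup>2 \<le> \<tau> * (2 / rad\<^sup>2) * (CZ L m \<phi> Z)\<^sup>2"
      using A(2)[OF Y] n \<tau>(1) by (intro mult_left_mono power_mono) auto
    also have "\<dots> = (\<tau> * (2 / rad\<^sup>2) * CZ L m \<phi> Z) * CZ L m \<phi> Z" by (simp add: power2_eq_square)
    also have "\<dots> \<le> 1 / 16 * CZ L m \<phi> Z" using \<tau>C by (rule mult_right_mono) (use A(2)[OF Y] n in linarith)
    finally have sq: "\<tau> * (2 / rad\<^sup>2) * (nrm Y)\<^sup>2 \<le> 1 / 16 * (2 * nrm Z)" unfolding CZ .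
    have "x \<le> 2 * z" if "x \<le> 4 / 3 * (z + a)" "a \<le> 1 / 16 * (2 * z)" "0 \<le> z" for x z a :: real
      using that by auto
    from this[OF G_growth[OF \<tau>(1) \<tau>k Z A(1)[OF Y]] sq Mnorm_nonneg[OF Z]]
    have "nrm (?G Y) \<le> CZ L m \<phi> Z" unfolding CZ .
    then show ?thesis using G_carrier(1)[OF \<tau>(1) \<tau>k Z A(1)[OF Y]] by (simp add: ballN_def)
  qed
  have Adef: "?A = {Y \<in> carrier_vec N. nrm Y \<le> CZ L m \<phi> Z}" by (simp add: ballN_def)
  interpret Metric_space ?A Mdist by (rule Metric_space_Mdist) (auto simp: ballN_def)
  have "Z \<in> ?A" using Z Mnorm_nonneg[OF Z] by (simp add: ballN_def CZ)
  obtain Y where Y: "Y \<in> ?A" "?G Y = Y"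
  proof (rule Banach_fixedpoint_thm[of ?G "1 / 2"])
    show mcomplete by (rule mcomplete_ball[OF Adef])
    show "Mdist (?G Y1) (?G Y2) \<le> 1 / 2 * Mdist Y1 Y2" if "Y1 \<in> ?A" "Y2 \<in> ?A" for Y1 Y2
      using contr[OF that] A(1)[OF self[OF that(1)]] A(1)[OF self[OF that(2)]] A(1)[OF that(1)] A(1)[OF that(2)]
      by (simp add: Mdist_eq)
  qed (use self \<open>Z \<in> ?A\<close> in auto)
  have "Y' = Y" if Y': "Y' \<in> carrier_vec N" "Y' = ?G Y'" for Y'
  proof -
    have "nrm Y' \<le> CZ L m \<phi> Z" using fixed_point_bound[OF \<tau>(1) \<tau>k Z Y'] Mnorm_nonneg[OF Z] unfolding CZ by linarith
    then have "Y' \<in> ?A" using Y' by (simp add: ballN_def)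
    from contr[OF this Y(1)] have "nrm (Y' - Y) \<le> 1 / 2 * nrm (Y' - Y)"
      unfolding Y(2) Y'(2)[symmetric] .
    then have "Mdist Y' Y = 0" using Mnorm_nonneg[of "Y' - Y"] Y' A(1)[OF Y(1)] by (simp add: Mdist_eq)
    then show ?thesis using zero[OF \<open>Y' \<in> ?A\<close> Y(1)] by simp
  qed
  moreover have "Y \<in> carrier_vec N \<and> Y = ?G Y" using A(1)[OF Y(1)] Y(2)[symmetric] by (rule conjI)
  ultimately show "\<exists>!Y. Y \<in> carrier_vec N \<and> Y = ?G Y" by (intro ex1I[of _ Y]) blast+
qed

end

theorem theorem3p5:
  fixes L khat :: real and F :: "mesh set"
  assumes "L > 0"
    and "\<forall>m\<in>F. is_mesh L m"
    and "quasi_uniform F"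
  shows "\<exists>c>0. \<forall>m\<in>F. \<forall>\<phi>. periodic_nodal_basis L m \<phi> \<longrightarrow>
    (\<forall>Z\<in>carrier_vec (N1 m). \<forall>\<tau>::real.
       0 < \<tau> \<and> ereal \<tau> \<le> tau_bound L khat m \<phi> c Z \<longrightarrow>
         (\<forall>Y1\<in>ballN L m \<phi> Z. \<forall>Y2\<in>ballN L m \<phi> Z.
            Mnorm L m \<phi> (G L khat m \<phi> \<tau> Z Y1 - G L khat m \<phi> \<tau> Z Y2)
              \<le> 1 / 2 * Mnorm L m \<phi> (Y1 - Y2)) \<and>
         (\<exists>!Y. Y \<in> carrier_vec (N1 m) \<and> Y = G L khat m \<phi> \<tau> Z Y))"
proof -
  obtain \<rho> where \<rho>: "\<rho> > 0" "\<forall>m\<in>F. \<forall>T\<in>triangulation m. \<exists>p. cball p (\<rho> * mesh_size m) \<subseteq> T"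
    using assms(3) unfolding quasi_uniform_def by blast
  \<comment> \<open>With \<open>c = 4 / \<rho>\<^sup>2\<close>, \<open>c / h\<^sup>2\<close> is the constant \<open>4 / rad\<^sup>2\<close> of the inverse inequality.\<close>
  show ?thesis
  proof (rule exI[of _ "4 / \<rho>\<^sup>2"], intro conjI ballI allI impI)
    show "4 / \<rho>\<^sup>2 > 0" using \<rho>(1) by simp
    fix m \<phi> Z \<tau>
    assume m: "m \<in> F" and \<phi>: "periodic_nodal_basis L m \<phi>" and Z: "Z \<in> carrier_vec (N1 m)"
      and \<tau>: "0 < \<tau> \<and> ereal \<tau> \<le> tau_bound L khat m \<phi> (4 / \<rho>\<^sup>2) Z"
    interpret fem_shape_regular L m \<phi> \<rho>
      using assms(2) m \<phi> \<rho> by unfold_locales auto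
    show "Mnorm L m \<phi> (G L khat m \<phi> \<tau> Z Y1 - G L khat m \<phi> \<tau> Z Y2) \<le> 1 / 2 * Mnorm L m \<phi> (Y1 - Y2)"
      if "Y1 \<in> ballN L m \<phi> Z" "Y2 \<in> ballN L m \<phi> Z" for Y1 Y2
      using contraction_and_unique_fixed_point(1) \<tau> Z that by blast
    show "\<exists>!Y. Y \<in> carrier_vec (N1 m) \<and> Y = G L khat m \<phi> \<tau> Z Y"
      using contraction_and_unique_fixed_point(2) \<tau> Z by blast
  qed
qed

end
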